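(* Let $d\ge 1$, let $R=\mathbb{Z}[u_1^{\pm1},\dots,u_d^{\pm1}]$, let $A$ be a $k\times n$ matrix over $R$ of rank $k$, and let $M_A=R^k/AR^n$. Let $J_A\subset R$ be the ideal generated by all $k\times k$ subdeterminants of $A$, and let $\gcd(J_A)\in R$ be a greatest common divisor of $J_A$. Then the principal associated primes of $M_A$ are exactly the ideals $\langle\pi\rangle$ generated by the irreducible factors $\pi$ of $\gcd(J_A)$ in $R$. Moreover, the multiplicity of each principal associated prime $\langle\pi\rangle$ in $M_A$ is equal to the multiplicity of $\pi$ as a factor in the factorization of $\gcd(J_A)$ into irreducibles.
   Context: A prime ideal $P\subset R$ is associated to an $R$-module $M$ if there is $m\in M$ with $P=\{f\in R : f\cdot m=0\}$; write $\mathrm{Ass}(M)$ for the set of associated primes. $R$ is a unique factorization domain, so the ideal $J_A$ has a greatest common divisor, well defined up to units. Multiplicity: a Noetherian $R$-module $M$ has a prime filtration $M=M_\ell\supset M_{\ell-1}\supset\cdots\supset M_1\supset M_0=\{0\}$ by submodules in which each quotient $M_j/M_{j-1}\cong R/Q_j$ for some prime ideal $Q_j\supset P$ for some $P\in\mathrm{Ass}(M)$. The multiplicity of an associated prime $P$ in such a filtration is the number of $j$ with $Q_j=P$. If $P$ is principal and $M$ has no free submodules (as is the case for $M_A$ with $A$ of rank $k$), this number is independent of the filtration and is called the multiplicity of $P$ in $M$. *)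

theory Defs
  imports
    "HOL-Library.Poly_Mapping"
    "HOL-Computational_Algebra.Computational_Algebra"
    "HOL-Algebra.Ideal"
    "HOL-Algebra.AbelCoset"
    "Jordan_Normal_Form.DL_Rank"
    "Jordan_Normal_Form.DL_Submatrix"
begin

text \<open>
  \<open>\<int>[u\<^sub>1\<^sup>\<plusminus>\<^sup>1, \<dots>, u\<^sub>d\<^sup>\<plusminus>\<^sup>1]\<close> as finitely supported functions from exponent vectors to \<open>\<int>\<close>
  (with the convolution product), where \<open>d = CARD('d) \<ge> 1\<close> for a finite type \<open>'d\<close>.
  The linear order on the index type \<open>'d\<close> only serves to obtain the library's \<^class>\<open>idom\<close> instance.
\<close>

type_synonym 'd laurent = "('d \<Rightarrow>\<^sub>0 int) \<Rightarrow>\<^sub>0 int"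


section \<open>Modules\<close>

text \<open>As for \<^const>\<open>module_vec\<close>, the ring multiplication and unit of the record are irrelevant.\<close>

definition ring_as_module :: "('a, 'x) ring_scheme \<Rightarrow> ('a, 'a) module" where
  "ring_as_module R =
     \<lparr>carrier = carrier R, mult = undefined, one = undefined,
      zero = \<zero>\<^bsub>R\<^esub>, add = add R, smult = mult R\<rparr>"

text \<open>
  On a coset \<open>X = N + x\<close>, the set \<open>N + r X\<close> is the coset \<open>N + r x\<close>.
\<close>

definition quotient_module :: "('a, 'b, 'x) module_scheme \<Rightarrow> 'b set \<Rightarrow> ('a, 'b set) module" where
  "quotient_module M N =
     \<lparr>carrier = a_rcosets\<^bsub>M\<^esub> N, mult = undefined, one = undefined,
      zero = N, add = set_add M,
      smult = (\<lambda>r X. N <+>\<^bsub>M\<^esub> ((\<lambda>x. r \<odot>\<^bsub>M\<^esub> x) ` X))\<rparr>"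

definition module_isomorphic ::
  "('a, 'x) ring_scheme \<Rightarrow> ('a, 'b, 'y) module_scheme \<Rightarrow> ('a, 'c, 'z) module_scheme \<Rightarrow> bool" where
  "module_isomorphic R M M' \<longleftrightarrow>
     (\<exists>h \<in> LinearCombinations.module_hom R M M'. bij_betw h (carrier M) (carrier M'))"

definition associated_primes ::
  "('a, 'x) ring_scheme \<Rightarrow> ('a, 'b, 'y) module_scheme \<Rightarrow> 'a set set" where
  "associated_primes R M =
     {P. primeideal P R \<and> (\<exists>m \<in> carrier M. P = {f \<in> carrier R. f \<odot>\<^bsub>M\<^esub> m = \<zero>\<^bsub>M\<^esub>})}"

text \<open>
  A prime filtration \<open>M = N l \<supset> \<dots> \<supset> N 0 = {0}\<close> with \<open>N j / N (j - 1) \<cong> R / Q j\<close> for \<open>1 \<le> j \<le> l\<close>.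
\<close>

definition prime_filtration ::
  "('a, 'x) ring_scheme \<Rightarrow> ('a, 'b, 'y) module_scheme \<Rightarrow> nat \<Rightarrow> (nat \<Rightarrow> 'b set) \<Rightarrow> (nat \<Rightarrow> 'a set) \<Rightarrow> bool" where
  "prime_filtration R M l N Q \<longleftrightarrow>
     N 0 = {\<zero>\<^bsub>M\<^esub>} \<and> N l = carrier M \<and>
     (\<forall>j \<le> l. Module.submodule (N j) R M) \<and>
     (\<forall>j \<in> {1..l}.
        N (j - 1) \<subset> N j \<and> primeideal (Q j) R \<and> (\<exists>P \<in> associated_primes R M. P \<subseteq> Q j) \<and>
        module_isomorphic R (quotient_module (M\<lparr>carrier := N j\<rparr>) (N (j - 1)))
          (quotient_module (ring_as_module R) (Q j)))"

text \<open>
  Multiplicity is only meaningful if it is the same for all prime filtrations (and there is one),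
  so it is a relation: the well-definedness is part of it.
\<close>

definition has_prime_multiplicity ::
  "('a, 'x) ring_scheme \<Rightarrow> ('a, 'b, 'y) module_scheme \<Rightarrow> 'a set \<Rightarrow> nat \<Rightarrow> bool" where
  "has_prime_multiplicity R M P m \<longleftrightarrow>
     (\<exists>l N Q. prime_filtration R M l N Q) \<and>
     (\<forall>l N Q. prime_filtration R M l N Q \<longrightarrow> card {j \<in> {1..l}. Q j = P} = m)"


section \<open>Divisibility\<close>

definition is_gcd_of :: "'a::comm_semiring_1 set \<Rightarrow> 'a \<Rightarrow> bool" where
  "is_gcd_of S g \<longleftrightarrow> (\<forall>a\<in>S. g dvd a) \<and> (\<forall>c. (\<forall>a\<in>S. c dvd a) \<longrightarrow> c dvd g)"

definition irreducible_factorization :: "'a::comm_semiring_1 \<Rightarrow> 'a multiset \<Rightarrow> bool" where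
  "irreducible_factorization a F \<longleftrightarrow>
     (\<forall>q \<in># F. Factorial_Ring.irreducible q) \<and> (\<exists>e. e dvd 1 \<and> a = e * prod_mset F)"

text \<open>The number of factors associated to \<open>p\<close>; again well-definedness is included.\<close>

definition has_factor_multiplicity :: "'a::comm_semiring_1 \<Rightarrow> 'a \<Rightarrow> nat \<Rightarrow> bool" where
  "has_factor_multiplicity p a m \<longleftrightarrow>
     (\<exists>F. irreducible_factorization a F) \<and>
     (\<forall>F. irreducible_factorization a F \<longrightarrow> size {#q \<in># F. p dvd q \<and> q dvd p#} = m)"


section \<open>Matrices\<close>

text \<open>Rank over the field of fractions.\<close>

definition fraction_rank :: "'a::idom mat \<Rightarrow> nat" where
  "fraction_rank A =
     vec_space.rank (dim_row A) (map_mat to_fract A)"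

definition minors :: "nat \<Rightarrow> 'a::comm_ring_1 mat \<Rightarrow> 'a set" where
  "minors k A = {det (submatrix A I J) | I J.
     I \<subseteq> {..<dim_row A} \<and> card I = k \<and> J \<subseteq> {..<dim_col A} \<and> card J = k}"

definition cokernel_module :: "'a::comm_ring_1 mat \<Rightarrow> ('a, 'a vec set) module" where
  "cokernel_module A =
     quotient_module (module_vec TYPE('a) (dim_row A)) ((\<lambda>x. A *\<^sub>v x) ` carrier_vec (dim_col A))"

end

theory Submission
  imports Defs
begin

text \<open>
  Let \<open>p\<close> be a prime element of \<open>R\<close>. The multiplicity of \<open>(p)\<close> in a torsion module \<open>M\<close> is the length
  of the localization of \<open>M\<close> at \<open>(p)\<close> over the discrete valuation ring \<open>R\<^sub>p\<close>, and for \<open>M = R\<^sup>k/N\<close> this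
  length is the least exponent of \<open>p\<close> in the determinants of \<open>k\<close>-tuples of vectors of \<open>N\<close>. The proof
  works with this exponent directly, under the name \<open>has_order\<close>, instead of the localized module.

  The order of \<open>R\<^sup>k\<close> is \<open>0\<close>. If \<open>N' = N + R x\<close> and \<open>N'/N\<close> is isomorphic to \<open>R/Q\<close> with \<open>Q\<close> prime, then
  \<open>N\<close> and \<open>N'\<close> have the same order when \<open>Q\<close> is not contained in \<open>(p)\<close> (\<open>has_order_step_same\<close>), and the
  order of \<open>N\<close> is larger by one when \<open>Q = (p)\<close> (\<open>has_order_step_up\<close>, by Cramer's rule). In a factorial
  domain there is no third case for nonzero \<open>Q\<close>. Hence the number of factors \<open>R/(p)\<close> in any prime
  filtration of \<open>R\<^sup>k/A R\<^sup>n\<close> is the order of \<open>A R\<^sup>n\<close>, and by multilinearity of the determinant this order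
  is the exponent of \<open>p\<close> in the greatest common divisor of the maximal minors
  (\<open>dvd_minors_iff_dvd_det_rows\<close>).

  The same determinants decide whether \<open>(p)\<close> is associated (\<open>principal_associated_iff_dvd_gcd\<close>). If
  \<open>(p)\<close> annihilates the class of \<open>x\<close> and nothing else does, Cramer's rule places every determinant in
  \<open>(p)\<close>. If \<open>p\<close> divides all determinants, there is an \<open>x\<close> that no scalar outside \<open>(p)\<close> moves into
  \<open>A R\<^sup>n\<close>; since a nonzero determinant does move it there, some multiple of \<open>x\<close> has annihilator exactly
  \<open>(p)\<close> modulo \<open>A R\<^sup>n\<close>. A principal associated prime is nonzero, again because a nonzero determinant
  annihilates the cokernel, so its generator is a prime element.

  Prime filtrations exist because ascending chains of submodules of \<open>R\<^sup>k\<close> stop. That the ring of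
  Laurent polynomials is Noetherian and factorial is obtained by adjoining the variables to \<open>\<int>\<close> one
  at a time, with Hilbert's basis theorem (\<open>noetherian_polys_over\<close>) and Gauss's lemma
  (\<open>factorial_polys_over\<close>), and by inverting the monomials at the end (\<open>localization\<close>).
\<close>

section \<open>Ascending chains\<close>

definition ascending_chains_stop :: "'a set set \<Rightarrow> bool" where
  "ascending_chains_stop \<F> \<longleftrightarrow>
     (\<forall>I :: nat \<Rightarrow> 'a set. (\<forall>n. I n \<in> \<F>) \<and> (\<forall>n. I n \<subseteq> I (Suc n)) \<longrightarrow> (\<exists>m. \<forall>n\<ge>m. I n = I m))"

lemma ascending_chains_stopD:
  assumes "ascending_chains_stop \<F>" "\<And>n. I n \<in> \<F>" "\<And>n::nat. I n \<subseteq> I (Suc n)"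
  obtains m where "\<And>n. n \<ge> m \<Longrightarrow> I n = I m"
proof -
  have "\<exists>m. \<forall>n\<ge>m. I n = I m"
    using assms(1)[unfolded ascending_chains_stop_def, rule_format, of I] assms(2,3) by blast
  then show thesis using that by blast
qed

text \<open>
  If no member of the subfamily \<open>X\<close> were maximal, a strictly ascending sequence in it could be chosen.
\<close>

lemma ascending_chains_stop_maximal:
  assumes acc: "ascending_chains_stop \<F>" and sub: "X \<subseteq> \<F>" and ne: "X \<noteq> {}"
  obtains M where "M \<in> X" "\<And>Y. Y \<in> X \<Longrightarrow> M \<subseteq> Y \<Longrightarrow> Y = M"
proof (rule ccontr)
  note result = that
  assume no: "\<not> thesis"
  then have step: "\<exists>Y\<in>X. M \<subset> Y" if M: "M \<in> X" for M
  proof -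
    have "\<not> (\<forall>Y\<in>X. M \<subseteq> Y \<longrightarrow> Y = M)" using no result[OF M] by blast
    then show ?thesis by blast
  qed
  have "\<exists>I::nat \<Rightarrow> 'a set. \<forall>n. I n \<in> X \<and> I n \<subset> I (Suc n)"
  proof (rule dependent_nat_choice)
    show "\<exists>M. M \<in> X" using ne by blast
    show "\<exists>Y. Y \<in> X \<and> M \<subset> Y" if "M \<in> X" for M and n :: nat
      using step[OF that] by blast
  qed
  then obtain I :: "nat \<Rightarrow> 'a set" where I: "\<And>n. I n \<in> X" "\<And>n. I n \<subset> I (Suc n)" by blast
  have "\<And>n. I n \<in> \<F>" "\<And>n. I n \<subseteq> I (Suc n)" using I sub by auto
  then obtain m where m: "\<And>n. n \<ge> m \<Longrightarrow> I n = I m"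
    using ascending_chains_stopD[OF acc, of I] by blast
  show False
    using m[of "Suc m"] I(2)[of m] by simp
qed

text \<open>
  The chain condition is pulled back along a monotone map that is injective on comparable members.
  Ideals and submodules are compared this way with their traces, preimages and images in a ring or
  module where the condition is known.
\<close>

lemma ascending_chains_stop_transfer:
  assumes acc: "ascending_chains_stop \<F>"
    and into: "\<And>Y. Y \<in> \<G> \<Longrightarrow> f Y \<in> \<F>"
    and mono: "\<And>Y Z. Y \<in> \<G> \<Longrightarrow> Z \<in> \<G> \<Longrightarrow> Y \<subseteq> Z \<Longrightarrow> f Y \<subseteq> f Z"
    and inj: "\<And>Y Z. Y \<in> \<G> \<Longrightarrow> Z \<in> \<G> \<Longrightarrow> Y \<subseteq> Z \<Longrightarrow> f Y = f Z \<Longrightarrow> Y = Z"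
  shows "ascending_chains_stop \<G>"
  unfolding ascending_chains_stop_def
proof (intro allI impI, elim conjE)
  fix I :: "nat \<Rightarrow> 'b set"
  assume I: "\<forall>n. I n \<in> \<G>" and up: "\<forall>n. I n \<subseteq> I (Suc n)"
  obtain m where m: "\<And>n. n \<ge> m \<Longrightarrow> f (I n) = f (I m)"
  proof (rule ascending_chains_stopD[OF acc, of "\<lambda>n. f (I n)"])
    show "f (I n) \<in> \<F>" for n using into I by blast
    show "f (I n) \<subseteq> f (I (Suc n))" for n using mono I up by blast
  qed blast
  have "I m \<subseteq> I n" if "n \<ge> m" for n
    using lift_Suc_mono_le[of I, OF _ that] up by blast
  then have "I n = I m" if "n \<ge> m" for n
    using m[OF that] inj[of "I m" "I n"] I that by simp
  then show "\<exists>m. \<forall>n\<ge>m. I n = I m" by blast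
qed

section \<open>Noetherian and factorial subrings\<close>

text \<open>
  All ring-theoretic notions are relative to a subset \<open>B\<close> of a type, because the proof for Laurent
  polynomials adjoins one variable at a time and the intermediate rings are not types of their
  own.
\<close>

definition is_subring :: "'a::comm_ring_1 set \<Rightarrow> bool" where
  "is_subring B \<longleftrightarrow> 1 \<in> B \<and> (\<forall>x\<in>B. \<forall>y\<in>B. x - y \<in> B \<and> x * y \<in> B)"

lemma is_subringD:
  assumes "is_subring B"
  shows "1 \<in> B" "0 \<in> B"
    "x \<in> B \<Longrightarrow> y \<in> B \<Longrightarrow> x - y \<in> B" "x \<in> B \<Longrightarrow> y \<in> B \<Longrightarrow> x * y \<in> B"
    "x \<in> B \<Longrightarrow> - x \<in> B" "x \<in> B \<Longrightarrow> y \<in> B \<Longrightarrow> x + y \<in> B"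
proof -
  show 1: "1 \<in> B" and d: "\<And>x y. x \<in> B \<Longrightarrow> y \<in> B \<Longrightarrow> x - y \<in> B"
    and "x \<in> B \<Longrightarrow> y \<in> B \<Longrightarrow> x * y \<in> B"
    using assms unfolding is_subring_def by blast+
  show 0: "0 \<in> B" using d[OF 1 1] by simp
  show m: "- x \<in> B" if "x \<in> B" for x using d[OF 0 that] by simp
  show "x \<in> B \<Longrightarrow> y \<in> B \<Longrightarrow> x + y \<in> B" using d[OF _ m, of x y] by simp
qed

lemma is_subring_sum:
  assumes "is_subring B" "\<And>i. i \<in> S \<Longrightarrow> f i \<in> B"
  shows "(\<Sum>i\<in>S. f i) \<in> B"
  using assms by (induction S rule: infinite_finite_induct) (auto intro: is_subringD)

definition is_ideal_of :: "'a::comm_ring_1 set \<Rightarrow> 'a set \<Rightarrow> bool" where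
  "is_ideal_of B I \<longleftrightarrow> I \<subseteq> B \<and> 0 \<in> I \<and> (\<forall>x\<in>I. \<forall>y\<in>I. x + y \<in> I) \<and> (\<forall>b\<in>B. \<forall>x\<in>I. b * x \<in> I)"

lemma is_ideal_ofD:
  assumes "is_ideal_of B I"
  shows "x \<in> I \<Longrightarrow> x \<in> B" "0 \<in> I" "x \<in> I \<Longrightarrow> y \<in> I \<Longrightarrow> x + y \<in> I" "b \<in> B \<Longrightarrow> x \<in> I \<Longrightarrow> b * x \<in> I"
  using assms unfolding is_ideal_of_def by blast+

lemma is_ideal_of_diff:
  assumes "is_subring B" "is_ideal_of B I" "x \<in> I" "y \<in> I"
  shows "x - y \<in> I"
proof -
  have "- 1 \<in> B" using assms(1) by (simp add: is_subringD)
  then have "- 1 * y \<in> I" using assms(2,4) is_ideal_ofD(4) by blast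
  then have "x + (- 1 * y) \<in> I" using is_ideal_ofD(3)[OF assms(2,3)] by blast
  then show ?thesis by simp
qed

definition noetherian_subring :: "'a::comm_ring_1 set \<Rightarrow> bool" where
  "noetherian_subring B \<longleftrightarrow> ascending_chains_stop {I. is_ideal_of B I}"

definition dvd_in :: "'a::comm_ring_1 set \<Rightarrow> 'a \<Rightarrow> 'a \<Rightarrow> bool" where
  "dvd_in B a b \<longleftrightarrow> (\<exists>c\<in>B. b = a * c)"

definition unit_in :: "'a::comm_ring_1 set \<Rightarrow> 'a \<Rightarrow> bool" where
  "unit_in B u \<longleftrightarrow> u \<in> B \<and> (\<exists>v\<in>B. u * v = 1)"

definition irreducible_in :: "'a::comm_ring_1 set \<Rightarrow> 'a \<Rightarrow> bool" where
  "irreducible_in B p \<longleftrightarrow> p \<in> B \<and> p \<noteq> 0 \<and> \<not> unit_in B p \<and>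
     (\<forall>a\<in>B. \<forall>b\<in>B. p = a * b \<longrightarrow> unit_in B a \<or> unit_in B b)"

definition prime_in :: "'a::comm_ring_1 set \<Rightarrow> 'a \<Rightarrow> bool" where
  "prime_in B p \<longleftrightarrow> p \<in> B \<and> p \<noteq> 0 \<and> \<not> unit_in B p \<and>
     (\<forall>a\<in>B. \<forall>b\<in>B. dvd_in B p (a * b) \<longrightarrow> dvd_in B p a \<or> dvd_in B p b)"

text \<open>
  Units times products of primes. That every nonzero element has this form characterizes factorial
  domains (Kaplansky), and the form allows induction over a factorization without a multiset of
  factors.
\<close>

inductive prime_product :: "'a::comm_ring_1 set \<Rightarrow> 'a \<Rightarrow> bool" for B where
  unit: "unit_in B u \<Longrightarrow> prime_product B u"
| mult: "prime_in B p \<Longrightarrow> prime_product B x \<Longrightarrow> prime_product B (p * x)"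

definition factorial_subring :: "'a::comm_ring_1 set \<Rightarrow> bool" where
  "factorial_subring B \<longleftrightarrow> (\<forall>a\<in>B. a \<noteq> 0 \<longrightarrow> prime_product B a)"

lemma unit_in_mult:
  assumes "is_subring B" "unit_in B u" "unit_in B v"
  shows "unit_in B (u * v)"
proof -
  obtain u' v' where "u' \<in> B" "v' \<in> B" "u * u' = 1" "v * v' = 1"
    using assms(2,3) unfolding unit_in_def by blast
  moreover have "(u * v) * (u' * v') = (u * u') * (v * v')" by (simp add: ac_simps)
  ultimately have "u' * v' \<in> B" "(u * v) * (u' * v') = 1"
    using assms(1) by (auto intro: is_subringD)
  then show ?thesis using assms unfolding unit_in_def by (blast intro: is_subringD)
qed

lemma unit_in_mult_cancel:
  assumes "is_subring B" "a \<in> B" "b \<in> B" "unit_in B (a * b)"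
  shows "unit_in B a"
proof -
  obtain v where v: "v \<in> B" "a * b * v = 1" using assms(4) unfolding unit_in_def by blast
  then have "a * (b * v) = 1" by (simp add: mult.assoc)
  then show ?thesis using assms v unfolding unit_in_def by (blast intro: is_subringD)
qed

lemma prime_in_unit_mult:
  fixes B :: "'a::idom set"
  assumes B: "is_subring B" and u: "unit_in B u" and p: "prime_in B p"
  shows "prime_in B (u * p)"
proof -
  obtain v where v: "u \<in> B" "v \<in> B" "u * v = 1" using u unfolding unit_in_def by blast
  have pB: "p \<in> B" "p \<noteq> 0" "\<not> unit_in B p"
    and pr: "\<And>a b. a \<in> B \<Longrightarrow> b \<in> B \<Longrightarrow> dvd_in B p (a * b) \<Longrightarrow> dvd_in B p a \<or> dvd_in B p b"
    using p unfolding prime_in_def by blast+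
  have eq: "dvd_in B (u * p) x \<longleftrightarrow> dvd_in B p x" for x
  proof
    assume "dvd_in B (u * p) x"
    then obtain c where "c \<in> B" "x = p * (u * c)" unfolding dvd_in_def by (auto simp: ac_simps)
    then show "dvd_in B p x" unfolding dvd_in_def using B v by (blast intro: is_subringD)
  next
    assume "dvd_in B p x"
    then obtain c where c: "c \<in> B" "x = p * c" unfolding dvd_in_def by blast
    then have "x = u * p * (v * c)" using v(3) by (metis mult.assoc mult.commute mult_1)
    then show "dvd_in B (u * p) x" unfolding dvd_in_def using B v c by (blast intro: is_subringD)
  qed
  have "\<not> unit_in B (u * p)"
    using unit_in_mult_cancel[OF B pB(1) v(1)] pB(3) by (auto simp: mult.commute)
  moreover have "u * p \<noteq> 0" using v pB by auto
  ultimately show ?thesis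
    unfolding prime_in_def eq using B v pB pr by (auto intro: is_subringD)
qed

lemma prime_product_mult:
  assumes "is_subring B" "prime_product B x" "prime_product B y"
  shows "prime_product B (x * y)"
  using assms(2)
proof induction
  case (unit u)
  show ?case using assms(3)
  proof induction
    case (unit v)
    then show ?case using unit_in_mult[OF assms(1) \<open>unit_in B u\<close>] prime_product.unit by blast
  next
    case (mult p y)
    then show ?case using prime_product.mult[of B p "u * y"] by (simp add: ac_simps)
  qed
next
  case (mult p x)
  then show ?case using prime_product.mult[of B p "x * y"] by (simp add: ac_simps)
qed

text \<open>
  Ascending chains of principal ideals stop, so every nonzero nonunit is a product of
  irreducibles, which are prime by assumption.
\<close>

lemma factorial_subringI:
  fixes B :: "'a::idom set"
  assumes B: "is_subring B" and noeth: "noetherian_subring B"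
    and prime: "\<And>p. irreducible_in B p \<Longrightarrow> prime_in B p"
  shows "factorial_subring B"
proof (rule ccontr)
  let ?I = "\<lambda>a. (\<lambda>c. a * c) ` B"
  let ?bad = "\<lambda>a. a \<in> B \<and> a \<noteq> 0 \<and> \<not> prime_product B a"
  assume "\<not> factorial_subring B"
  then have ne: "?I ` {a. ?bad a} \<noteq> {}" unfolding factorial_subring_def by blast
  have sub: "?I ` {a. ?bad a} \<subseteq> {I. is_ideal_of B I}"
  proof clarify
    fix a assume a: "a \<in> B"
    show "is_ideal_of B (?I a)"
      unfolding is_ideal_of_def
    proof (intro conjI ballI)
      show "?I a \<subseteq> B" using a B by (auto intro: is_subringD)
      show "0 \<in> ?I a" using is_subringD(2)[OF B] by (auto intro: image_eqI[of _ _ 0])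
      show "x + y \<in> ?I a" if "x \<in> ?I a" "y \<in> ?I a" for x y
        using that by (auto simp: distrib_left[symmetric] intro: is_subringD[OF B])
      show "b * x \<in> ?I a" if "b \<in> B" "x \<in> ?I a" for b x
        using that by (auto simp: mult.left_commute[of b] intro: is_subringD[OF B])
    qed
  qed
  obtain M where M: "M \<in> ?I ` {a. ?bad a}"
    and max: "\<And>Y. Y \<in> ?I ` {a. ?bad a} \<Longrightarrow> M \<subseteq> Y \<Longrightarrow> Y = M"
    using ascending_chains_stop_maximal[OF noeth[unfolded noetherian_subring_def] sub ne] by blast
  obtain a where a: "?bad a" and Ma: "M = ?I a" using M by blast
  have "\<not> unit_in B a" using a prime_product.unit by blast
  have "\<not> irreducible_in B a"
  proof
    assume "irreducible_in B a"
    then have "prime_in B a" by (rule prime)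
    moreover have "prime_product B 1"
      using B by (intro prime_product.unit) (auto simp: unit_in_def is_subringD intro!: bexI[of _ 1])
    ultimately have "prime_product B (a * 1)" by (rule prime_product.mult)
    then show False using a by simp
  qed
  then obtain b c where bc: "b \<in> B" "c \<in> B" "a = b * c" "\<not> unit_in B b" "\<not> unit_in B c"
    using a \<open>\<not> unit_in B a\<close> unfolding irreducible_in_def by blast
  \<comment> \<open>A bad element has no bad proper divisor, because its principal ideal is maximal among the bad ones.\<close>
  have no: "prime_product B b" if bc: "b \<in> B" "c \<in> B" "a = b * c" "\<not> unit_in B c" for b c
  proof (rule ccontr)
    assume "\<not> prime_product B b"
    then have bad: "?bad b" using bc a by auto
    have "M \<subseteq> ?I b" using bc Ma by (auto simp: mult.assoc intro: is_subringD[OF B])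
    then have "?I b = ?I a" using max bad Ma by blast
    moreover have "b \<in> ?I b" using is_subringD(1)[OF B] by (auto intro: image_eqI[of _ _ 1])
    ultimately obtain e where e: "e \<in> B" "b = a * e" by blast
    then have "b * (c * e) = b * 1" using bc by (simp add: mult.assoc)
    then have "c * e = 1" using bad by (metis mult_left_cancel)
    then show False using bc e unfolding unit_in_def by blast
  qed
  have "prime_product B (b * c)"
    using no[of b c] no[of c b] bc prime_product_mult[OF B] by (simp add: mult.commute)
  then show False using a bc by simp
qed

lemma subring_UNIV_simps:
  fixes p :: "'a::comm_ring_1"
  shows "is_subring (UNIV :: 'a set)"
    and "dvd_in UNIV p q \<longleftrightarrow> p dvd q"
    and "unit_in UNIV p \<longleftrightarrow> p dvd 1"
    and "irreducible_in UNIV p \<longleftrightarrow> Factorial_Ring.irreducible p"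
    and "prime_in UNIV p \<longleftrightarrow> prime_elem p"
proof -
  show "is_subring (UNIV :: 'a set)" by (simp add: is_subring_def)
  show dvd: "dvd_in UNIV p q \<longleftrightarrow> p dvd q" for p q :: 'a by (auto simp: dvd_in_def dvd_def)
  show unit: "unit_in UNIV p \<longleftrightarrow> p dvd 1" for p :: 'a by (auto simp: unit_in_def dvd_def eq_commute[of 1])
  show "irreducible_in UNIV p \<longleftrightarrow> Factorial_Ring.irreducible p"
    by (auto simp: irreducible_in_def irreducible_def unit)
  show "prime_in UNIV p \<longleftrightarrow> prime_elem p"
    by (auto simp: prime_in_def prime_elem_def unit dvd)
qed

section \<open>Polynomials over a subring\<close>

definition polys_over :: "'a::comm_ring_1 set \<Rightarrow> 'a poly set" where
  "polys_over B = {p. \<forall>n. coeff p n \<in> B}"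

lemma is_subring_polys_over:
  assumes "is_subring B"
  shows "is_subring (polys_over B)"
  unfolding is_subring_def
  by (auto simp: polys_over_def coeff_mult coeff_1 is_subringD[OF assms] intro!: is_subring_sum[OF assms])

lemma const_in_polys_over: "is_subring B \<Longrightarrow> a \<in> B \<Longrightarrow> [:a:] \<in> polys_over B"
  by (auto simp: polys_over_def coeff_pCons is_subringD split: nat.split)

lemma monom_in_polys_over: "is_subring B \<Longrightarrow> a \<in> B \<Longrightarrow> monom a n \<in> polys_over B"
  by (auto simp: polys_over_def is_subringD)

text \<open>
  Hilbert's basis theorem. The leading coefficients in degree \<open>n\<close> of members of the \<open>m\<close>-th ideal
  of a chain form an ideal \<open>L (I m) n\<close> of \<open>B\<close>, increasing in both \<open>m\<close> and \<open>n\<close>; the diagonal stops,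
  and with it the whole family.
\<close>

lemma noetherian_polys_over:
  fixes B :: "'a::comm_ring_1 set"
  assumes B: "is_subring B" and noeth: "noetherian_subring B"
  shows "noetherian_subring (polys_over B)"
proof -
  let ?P = "polys_over B"
  let ?id = "is_ideal_of ?P"
  have P: "is_subring ?P" by (rule is_subring_polys_over[OF B])
  define L where "L = (\<lambda>(J :: 'a poly set) n. {coeff p n | p. p \<in> J \<and> (\<forall>m>n. coeff p m = 0)})"
  have L_ideal: "is_ideal_of B (L J n)" if J: "?id J" for J n
    unfolding is_ideal_of_def
  proof (intro conjI ballI)
    show "L J n \<subseteq> B" using is_ideal_ofD(1)[OF J] by (auto simp: L_def polys_over_def)
    show "0 \<in> L J n" using is_ideal_ofD(2)[OF J] unfolding L_def by force
    fix x assume "x \<in> L J n"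
    then obtain p where p: "p \<in> J" "\<forall>m>n. coeff p m = 0" "x = coeff p n" unfolding L_def by blast
    show "x + y \<in> L J n" if "y \<in> L J n" for y
    proof -
      obtain q where "q \<in> J" "\<forall>m>n. coeff q m = 0" "y = coeff q n" using \<open>y \<in> L J n\<close> unfolding L_def by blast
      then show ?thesis using p is_ideal_ofD(3)[OF J]
        unfolding L_def by (intro CollectI exI[of _ "p + q"]) auto
    qed
    show "b * x \<in> L J n" if "b \<in> B" for b
      using p is_ideal_ofD(4)[OF J const_in_polys_over[OF B that] p(1)]
      unfolding L_def by (intro CollectI exI[of _ "[:b:] * p"]) auto
  qed
  have L_Suc: "L J n \<subseteq> L J (Suc n)" if J: "?id J" for J n
  proof
    fix x assume "x \<in> L J n"
    then obtain p where p: "p \<in> J" "\<forall>m>n. coeff p m = 0" "x = coeff p n" unfolding L_def by blast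
    have "monom 1 1 * p \<in> J"
      by (rule is_ideal_ofD(4)[OF J monom_in_polys_over[OF B is_subringD(1)[OF B]] p(1)])
    moreover have "monom 1 1 * p = pCons 0 p" by (simp add: monom_altdef)
    ultimately show "x \<in> L J (Suc n)"
      using p unfolding L_def by (intro CollectI exI[of _ "pCons 0 p"]) (auto simp: coeff_pCons split: nat.split)
  qed
  have L_mono: "L J n \<subseteq> L J' n" if "J \<subseteq> J'" for J J' n using that unfolding L_def by blast
  \<comment> \<open>Among nested ideals, equal ideals of leading coefficients in every degree force equality: subtract matching leading terms.\<close>
  have L_inj: "J' \<subseteq> J" if J: "?id J" and J': "?id J'" and sub: "J \<subseteq> J'" and eq: "\<And>n. L J n = L J' n" for J J'
  proof
    have "p \<in> J" if "p \<in> J'" "\<forall>m\<ge>n. coeff p m = 0" for p n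
      using that
    proof (induction n arbitrary: p)
      case 0
      then have "p = 0" by (auto intro: poly_eqI)
      then show ?case using is_ideal_ofD(2)[OF J] by simp
    next
      case (Suc n)
      then have "coeff p n \<in> L J' n" unfolding L_def by auto
      then obtain q where q: "q \<in> J" "\<forall>m>n. coeff q m = 0" "coeff p n = coeff q n"
        unfolding eq[of n, symmetric] unfolding L_def by blast
      have "p - q \<in> J'" using is_ideal_of_diff[OF P J'] Suc.prems(1) q(1) sub by blast
      moreover have "\<forall>m\<ge>n. coeff (p - q) m = 0"
      proof (intro allI impI)
        fix m assume "n \<le> m"
        then show "coeff (p - q) m = 0" using Suc.prems(2) q(2,3) by (cases "m = n") auto
      qed
      ultimately have "(p - q) + q \<in> J" using Suc.IH is_ideal_ofD(3)[OF J _ q(1)] by blast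
      then show ?case by simp
    qed
    note all = this
    show "p \<in> J" if "p \<in> J'" for p
      using all[OF that, of "Suc (degree p)"] by (simp add: coeff_eq_0)
  qed
  show ?thesis
    unfolding noetherian_subring_def ascending_chains_stop_def
  proof (intro allI impI, elim conjE)
    fix I :: "nat \<Rightarrow> 'a poly set" assume I: "\<forall>n. I n \<in> {I. ?id I}" and up: "\<forall>n. I n \<subseteq> I (Suc n)"
    have id: "?id (I n)" for n using I by blast
    have Imono: "I m \<subseteq> I n" if "m \<le> n" for m n using lift_Suc_mono_le[of I, OF _ that] up by blast
    have Lmono: "L (I m) n \<subseteq> L (I m') n'" if "m \<le> m'" "n \<le> n'" for m m' n n'
    proof -
      have "L (I m) n \<subseteq> L (I m') n" by (rule L_mono[OF Imono[OF that(1)]])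
      also have "\<dots> \<subseteq> L (I m') n'" by (rule lift_Suc_mono_le[of "L (I m')", OF L_Suc[OF id] that(2)])
      finally show ?thesis .
    qed
    have stop: "\<exists>m. \<forall>n\<ge>m. F n = F m" if "\<And>n. is_ideal_of B (F n)" "\<And>n. F n \<subseteq> F (Suc n)" for F :: "nat \<Rightarrow> _"
    proof -
      have "\<And>n. F n \<in> {I. is_ideal_of B I}" using that(1) by blast
      from ascending_chains_stopD[OF noeth[unfolded noetherian_subring_def], of F, OF this that(2)] obtain m
        where "\<And>n. n \<ge> m \<Longrightarrow> F n = F m" by blast
      then show ?thesis by blast
    qed
    have "\<exists>m. \<forall>n\<ge>m. L (I n) n = L (I m) m"
      by (rule stop[of "\<lambda>m. L (I m) m", OF L_ideal[OF id] Lmono]) auto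
    then obtain m0 where m0: "\<And>n. n \<ge> m0 \<Longrightarrow> L (I n) n = L (I m0) m0" by blast
    have "\<forall>n. \<exists>s. \<forall>m\<ge>s. L (I m) n = L (I s) n"
    proof
      fix n
      show "\<exists>s. \<forall>m\<ge>s. L (I m) n = L (I s) n"
        by (rule stop[of "\<lambda>m. L (I m) n", OF L_ideal[OF id] Lmono]) auto
    qed
    then obtain s where "\<forall>n. \<forall>m\<ge>s n. L (I m) n = L (I (s n)) n" by (rule choice[THEN exE])
    then have s: "\<And>n m. m \<ge> s n \<Longrightarrow> L (I m) n = L (I (s n)) n" by blast
    \<comment> \<open>Only the finitely many degrees below \<open>m0\<close> need their own bound.\<close>
    define m1 where "m1 = m0 + (\<Sum>n<m0. s n)"
    have "I m = I m1" if m: "m \<ge> m1" for m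
    proof -
      have "L (I m1) n = L (I m) n" for n
      proof (cases "n < m0")
        case True
        then have "s n \<le> m1" unfolding m1_def by (intro trans_le_add2 member_le_sum) auto
        then show ?thesis using s[of n m1] s[of n m] m by simp
      next
        case False
        \<comment> \<open>From \<open>m0\<close> on, in both arguments, the monotone family \<open>L (I m) n\<close> is squeezed between diagonal terms, which no longer move.\<close>
        have "L (I m') n = L (I m0) m0" if "m' \<ge> m1" for m'
        proof
          have "m0 \<le> m'" using that unfolding m1_def by simp
          then show "L (I m0) m0 \<subseteq> L (I m') n" using False by (intro Lmono) auto
          have "L (I m') n \<subseteq> L (I (max m' n)) (max m' n)" by (intro Lmono) auto
          also have "\<dots> = L (I m0) m0" using m0[of "max m' n"] \<open>m0 \<le> m'\<close> by simp
          finally show "L (I m') n \<subseteq> L (I m0) m0" .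
        qed
        then show ?thesis using m by simp
      qed
      then show ?thesis using L_inj[OF id id Imono[OF m]] Imono[OF m] by blast
    qed
    then show "\<exists>m. \<forall>n\<ge>m. I n = I m" by blast
  qed
qed

lemma dvd_in_polys_over_const_iff:
  assumes B: "is_subring B"
  shows "dvd_in (polys_over B) [:c:] f \<longleftrightarrow> (\<forall>n. dvd_in B c (coeff f n))"
proof
  assume "dvd_in (polys_over B) [:c:] f"
  then show "\<forall>n. dvd_in B c (coeff f n)" unfolding dvd_in_def polys_over_def by auto
next
  assume "\<forall>n. dvd_in B c (coeff f n)"
  then obtain e where e: "\<And>n. e n \<in> B" "\<And>n. coeff f n = c * e n" unfolding dvd_in_def by metis
  define q where "q = (\<Sum>n\<le>degree f. monom (e n) n)"
  have "q \<in> polys_over B"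
    unfolding q_def using B e by (intro is_subring_sum is_subring_polys_over monom_in_polys_over)
  moreover have "f = [:c:] * q"
  proof -
    have "f = (\<Sum>n\<le>degree f. monom (coeff f n) n)" by (rule poly_as_sum_of_monoms[symmetric])
    also have "\<dots> = (\<Sum>n\<le>degree f. [:c:] * monom (e n) n)" by (simp add: e(2) smult_monom)
    also have "\<dots> = [:c:] * q" unfolding q_def by (rule sum_distrib_left[symmetric])
    finally show ?thesis .
  qed
  ultimately show "dvd_in (polys_over B) [:c:] f" unfolding dvd_in_def by blast
qed

lemma dvd_in_combinations:
  assumes B: "is_subring B"
  shows "dvd_in B p a \<Longrightarrow> dvd_in B p b \<Longrightarrow> dvd_in B p (a - b)"
    and "(\<And>i. i \<in> S \<Longrightarrow> dvd_in B p (f i)) \<Longrightarrow> dvd_in B p (\<Sum>i\<in>S. f i)"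
    and "dvd_in B p a \<Longrightarrow> x \<in> B \<Longrightarrow> dvd_in B p (a * x)"
proof -
  show "dvd_in B p a \<Longrightarrow> dvd_in B p b \<Longrightarrow> dvd_in B p (a - b)"
    unfolding dvd_in_def using is_subringD(3)[OF B] by (auto simp: right_diff_distrib[symmetric])
  show "dvd_in B p a \<Longrightarrow> x \<in> B \<Longrightarrow> dvd_in B p (a * x)"
    unfolding dvd_in_def using is_subringD(4)[OF B] by (auto simp: mult.assoc)
  have add: "dvd_in B p a \<Longrightarrow> dvd_in B p b \<Longrightarrow> dvd_in B p (a + b)" for a b
    unfolding dvd_in_def using is_subringD(6)[OF B] by (auto simp: distrib_left[symmetric])
  have zero: "dvd_in B p 0" unfolding dvd_in_def using is_subringD(2)[OF B] by (intro bexI[of _ 0]) auto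
  show "(\<And>i. i \<in> S \<Longrightarrow> dvd_in B p (f i)) \<Longrightarrow> dvd_in B p (\<Sum>i\<in>S. f i)"
    by (induction S rule: infinite_finite_induct) (auto simp: add zero)
qed

text \<open>
  Gauss: in a product of two polynomials outside \<open>(p)\<close>, the first coefficients outside \<open>(p)\<close>
  multiply to one outside \<open>(p)\<close>, and nothing else interferes modulo \<open>p\<close>.
\<close>

lemma prime_in_polys_over_const:
  fixes B :: "'a::idom set"
  assumes B: "is_subring B" and p: "prime_in B p"
  shows "prime_in (polys_over B) [:p:]"
proof -
  let ?P = "polys_over B"
  note iff = dvd_in_polys_over_const_iff[OF B]
  have pB: "p \<in> B" "p \<noteq> 0" "\<not> unit_in B p"
    and pr: "\<And>a b. a \<in> B \<Longrightarrow> b \<in> B \<Longrightarrow> dvd_in B p (a * b) \<Longrightarrow> dvd_in B p a \<or> dvd_in B p b"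
    using p unfolding prime_in_def by blast+
  have "\<not> unit_in ?P [:p:]"
  proof
    assume "unit_in ?P [:p:]"
    then obtain v where v: "v \<in> ?P" "[:p:] * v = 1" unfolding unit_in_def by blast
    have "p * coeff v 0 = coeff ([:p:] * v) 0" by simp
    then have "p * coeff v 0 = 1" unfolding v(2) by simp
    then show False using v(1) pB unfolding unit_in_def polys_over_def by blast
  qed
  moreover have "dvd_in ?P [:p:] f \<or> dvd_in ?P [:p:] g"
    if f: "f \<in> ?P" and g: "g \<in> ?P" and fg: "dvd_in ?P [:p:] (f * g)" for f g
  proof (rule ccontr)
    assume "\<not> ?thesis"
    then obtain i0 j0 where "\<not> dvd_in B p (coeff f i0)" "\<not> dvd_in B p (coeff g j0)" unfolding iff by blast
    \<comment> \<open>The first coefficients of \<open>f\<close> and \<open>g\<close> outside \<open>(p)\<close> meet in the coefficient \<open>i + j\<close> of the product; every other summand lies in \<open>(p)\<close>.\<close>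
    define i where "i = (LEAST i. \<not> dvd_in B p (coeff f i))"
    define j where "j = (LEAST j. \<not> dvd_in B p (coeff g j))"
    have i: "\<not> dvd_in B p (coeff f i)" "\<And>m. m < i \<Longrightarrow> dvd_in B p (coeff f m)"
      unfolding i_def using LeastI[of "\<lambda>i. \<not> dvd_in B p (coeff f i)", OF \<open>\<not> dvd_in B p (coeff f i0)\<close>] not_less_Least by blast+
    have j: "\<not> dvd_in B p (coeff g j)" "\<And>m. m < j \<Longrightarrow> dvd_in B p (coeff g m)"
      unfolding j_def using LeastI[of "\<lambda>i. \<not> dvd_in B p (coeff g i)", OF \<open>\<not> dvd_in B p (coeff g j0)\<close>] not_less_Least by blast+
    have fB: "coeff f m \<in> B" and gB: "coeff g m \<in> B" for m using f g unfolding polys_over_def by auto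
    let ?h = "\<lambda>m. coeff f m * coeff g (i + j - m)"
    have "coeff (f * g) (i + j) = (\<Sum>m\<le>i+j. ?h m)" by (simp add: coeff_mult)
    also have "\<dots> = ?h i + (\<Sum>m\<in>{..i+j} - {i}. ?h m)" by (rule sum.remove) auto
    finally have "?h i = coeff (f * g) (i + j) - (\<Sum>m\<in>{..i+j} - {i}. ?h m)" by simp
    moreover have "dvd_in B p (coeff (f * g) (i + j))" using fg unfolding iff by blast
    moreover have "dvd_in B p (\<Sum>m\<in>{..i+j} - {i}. ?h m)"
    proof (rule dvd_in_combinations(2)[OF B])
      fix m assume m: "m \<in> {..i+j} - {i}"
      show "dvd_in B p (?h m)"
      proof (cases "m < i")
        case True
        then show ?thesis using i(2) gB dvd_in_combinations(3)[OF B] by blast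
      next
        case False
        then have "i + j - m < j" using m by auto
        then show ?thesis using j(2) fB dvd_in_combinations(3)[OF B] by (metis mult.commute)
      qed
    qed
    ultimately have "dvd_in B p (?h i)" using dvd_in_combinations(1)[OF B] by simp
    then show False using pr[OF fB[of i] gB[of j]] i(1) j(1) by simp
  qed
  ultimately show ?thesis
    using pB const_in_polys_over[OF B] unfolding prime_in_def by auto
qed

text \<open>
  Division with remainder over the field of fractions, with denominators cleared and the
  coefficients kept in \<open>B\<close>.
\<close>

lemma pseudo_division_polys_over:
  fixes B :: "'a::idom set"
  assumes B: "is_subring B" and d: "d \<in> polys_over B" "d \<noteq> 0" and f: "f \<in> polys_over B"
  shows "\<exists>c q r. c \<in> B \<and> c \<noteq> 0 \<and> q \<in> polys_over B \<and> [:c:] * f = q * d + r \<and> (r = 0 \<or> degree r < degree d)"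
  using f
proof (induction "degree f" arbitrary: f rule: less_induct)
  case less
  note P = is_subringD[OF is_subring_polys_over[OF B]]
  let ?a = "lead_coeff d" let ?b = "lead_coeff f"
  have ab: "?a \<in> B" "?a \<noteq> 0" "?b \<in> B" using d less.prems unfolding polys_over_def by auto
  show ?case
  proof (cases "f = 0 \<or> degree f < degree d")
    case True
    then show ?thesis using is_subringD[OF B] P(2) by (intro exI[of _ 1] exI[of _ 0] exI[of _ f]) (auto simp: one_pCons[symmetric])
  next
    case False
    \<comment> \<open>One step of division without inverting the leading coefficient \<open>?a\<close>.\<close>
    let ?m = "monom ?b (degree f - degree d)"
    let ?f = "[:?a:] * f - ?m * d"
    have mP: "?m \<in> polys_over B" using ab monom_in_polys_over[OF B] by blast
    have aP: "[:?a:] \<in> polys_over B" using ab const_in_polys_over[OF B] by blast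
    have fP: "?f \<in> polys_over B" using mP aP P(3,4) d less.prems by blast
    show ?thesis
    proof (cases "degree f = 0")
      case True
      then have "degree d = 0" using False by simp
      then have "f = [:?b:]" "d = [:?a:]" using True by (auto elim!: degree_eq_zeroE)
      then have "[:?a:] * f = [:?b:] * d + 0" by (metis add.right_neutral mult.commute)
      then show ?thesis using ab const_in_polys_over[OF B] by blast
    next
      case pos: False
      have "degree ?f < degree f"
      proof (rule degree_lessI)
        show "?f \<noteq> 0 \<or> 0 < degree f" using pos by simp
        show "\<forall>k\<ge>degree f. coeff ?f k = 0"
        proof (intro allI impI)
          fix k assume k: "degree f \<le> k"
          show "coeff ?f k = 0"
          proof (cases "k = degree f")
            case True
            then show ?thesis using False by (simp add: coeff_monom_mult)
          next
            case kk: False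
            then have "coeff f k = 0" "coeff d (k - (degree f - degree d)) = 0"
              using k False by (auto intro!: coeff_eq_0)
            then show ?thesis by (simp add: coeff_monom_mult)
          qed
        qed
      qed
      then obtain c q r where c: "c \<in> B" "c \<noteq> 0" "q \<in> polys_over B" "[:c:] * ?f = q * d + r" "r = 0 \<or> degree r < degree d"
        using less.hyps[OF _ fP] by blast
      have "[:c * ?a:] * f = [:c:] * ([:?a:] * f)" by (simp add: mult.commute)
      also have "\<dots> = [:c:] * ?f + [:c:] * (?m * d)" by (simp add: algebra_simps smult_diff_right)
      also have "\<dots> = (q + [:c:] * ?m) * d + r" unfolding c(4) by (simp add: algebra_simps)
      finally have "[:c * ?a:] * f = (q + [:c:] * ?m) * d + r" .
      moreover have "q + [:c:] * ?m \<in> polys_over B"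
        using c(1,3) mP P(4,6) const_in_polys_over[OF B] by blast
      moreover have "c * ?a \<in> B" "c * ?a \<noteq> 0" using c ab is_subringD[OF B] by auto
      ultimately show ?thesis using c(5) by blast
    qed
  qed
qed

lemma prime_product_in:
  assumes "is_subring B" "prime_product B x"
  shows "x \<in> B"
  using assms(2) by induction (auto simp: unit_in_def prime_in_def intro: is_subringD(4)[OF assms(1)])

text \<open>
  For a polynomial \<open>f\<close> without constant prime factors, divisibility over the field of fractions
  implies divisibility over \<open>B\<close>: the prime factors of \<open>c\<close> are removed one at a time.
\<close>

lemma dvd_in_cancel_const:
  fixes B :: "'a::idom set"
  assumes B: "is_subring B" and c: "prime_product B c" and f: "f \<in> polys_over B"
    and prim: "\<And>p. prime_in B p \<Longrightarrow> \<not> dvd_in (polys_over B) [:p:] f"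
    and h: "h \<in> polys_over B" and dvd: "dvd_in (polys_over B) f ([:c:] * h)"
  shows "dvd_in (polys_over B) f h"
  using c dvd
proof (induction rule: prime_product.induct)
  case (unit u)
  then obtain v w where v: "v \<in> B" "u * v = 1" and w: "w \<in> polys_over B" "[:u:] * h = f * w"
    unfolding unit_in_def dvd_in_def by blast
  have "h = [:u * v:] * h" using v by (simp add: one_pCons[symmetric])
  also have "\<dots> = [:v:] * ([:u:] * h)" by (simp add: mult.commute)
  also have "\<dots> = f * ([:v:] * w)" unfolding w(2) by simp
  finally have "h = f * ([:v:] * w)" .
  moreover have "[:v:] * w \<in> polys_over B"
    using w(1) v(1) is_subringD(4)[OF is_subring_polys_over[OF B]] const_in_polys_over[OF B] by blast
  ultimately show ?case unfolding dvd_in_def by blast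
next
  case (mult p x)
  then obtain w where w: "w \<in> polys_over B" "[:p * x:] * h = f * w" unfolding dvd_in_def by blast
  have xh: "[:x:] * h \<in> polys_over B"
    using prime_product_in[OF B mult.hyps(2)] h is_subringD(4)[OF is_subring_polys_over[OF B]] const_in_polys_over[OF B]
    by blast
  have eq: "f * w = [:p:] * ([:x:] * h)" using w(2) by (simp add: mult.commute)
  then have "dvd_in (polys_over B) [:p:] (f * w)" unfolding dvd_in_def using xh by blast
  then have "dvd_in (polys_over B) [:p:] w"
    using prime_in_polys_over_const[OF B mult.hyps(1)] f w(1) prim[OF mult.hyps(1)] unfolding prime_in_def by blast
  then obtain w' where w': "w' \<in> polys_over B" "w = [:p:] * w'" unfolding dvd_in_def by blast
  have "[:p:] * (f * w') = [:p:] * ([:x:] * h)" using eq w'(2) by (simp add: mult.left_commute)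
  moreover have "[:p:] \<noteq> 0" using mult.hyps(1) unfolding prime_in_def by simp
  ultimately have "f * w' = [:x:] * h" using mult_left_cancel by blast
  then show ?case using mult.IH w'(1) unfolding dvd_in_def by metis
qed

text \<open>
  A factorization over the field of fractions can be rescaled to one over \<open>B\<close>: each prime factor
  of the common denominator \<open>c\<close> divides one of the two factors.
\<close>

lemma split_const_mult:
  fixes B :: "'a::idom set"
  assumes B: "is_subring B" and c: "prime_product B c"
    and f: "f \<in> polys_over B" and "q \<in> polys_over B" "d \<in> polys_over B" "[:c:] * f = q * d"
  shows "\<exists>a b q' d'. a \<in> B \<and> b \<in> B \<and> q' \<in> polys_over B \<and> d' \<in> polys_over B
           \<and> q = [:a:] * q' \<and> d = [:b:] * d' \<and> f = q' * d'"
  using c assms(4-)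
proof (induction arbitrary: q d rule: prime_product.induct)
  case (unit u)
  then obtain v where v: "u \<in> B" "v \<in> B" "u * v = 1" unfolding unit_in_def by blast
  have "f = [:u * v:] * f" using v by (simp add: one_pCons[symmetric])
  also have "\<dots> = [:v:] * ([:u:] * f)" by (simp add: mult.commute)
  also have "\<dots> = ([:v:] * q) * d" unfolding unit(4) by simp
  finally have f: "f = ([:v:] * q) * d" .
  have "q = [:u * v:] * q" using v by (simp add: one_pCons[symmetric])
  then have "q = [:u:] * ([:v:] * q)" by (simp add: mult.commute)
  moreover have "d = [:1:] * d" by simp
  moreover have "[:v:] * q \<in> polys_over B"
    using unit(2) v(2) is_subringD(4)[OF is_subring_polys_over[OF B]] const_in_polys_over[OF B] by blast
  ultimately show ?case using f v(1) unit(3) is_subringD(1)[OF B] by blast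
next
  case (mult p x)
  have pP: "prime_in (polys_over B) [:p:]" by (rule prime_in_polys_over_const[OF B mult.hyps(1)])
  then have p0: "[:p:] \<noteq> 0" and pB: "p \<in> B" using mult.hyps(1) unfolding prime_in_def by auto
  have eq: "q * d = [:p:] * ([:x:] * f)" using mult.prems(3) by (simp add: mult.commute)
  have "[:x:] * f \<in> polys_over B"
    using prime_product_in[OF B mult.hyps(2)] f is_subringD(4)[OF is_subring_polys_over[OF B]] const_in_polys_over[OF B]
    by blast
  then have "dvd_in (polys_over B) [:p:] (q * d)" using eq unfolding dvd_in_def by blast
  then have "dvd_in (polys_over B) [:p:] q \<or> dvd_in (polys_over B) [:p:] d"
    using pP mult.prems(1,2) unfolding prime_in_def by blast
  then show ?case
  proof
    assume "dvd_in (polys_over B) [:p:] q"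
    then obtain e where e: "e \<in> polys_over B" "q = [:p:] * e" unfolding dvd_in_def by blast
    have "[:p:] * ([:x:] * f) = [:p:] * (e * d)" using eq unfolding e(2) by (simp add: mult.assoc)
    then have "[:x:] * f = e * d" using p0 mult_left_cancel by blast
    then obtain a b q' d' where "a \<in> B" "b \<in> B" "q' \<in> polys_over B" "d' \<in> polys_over B"
      "e = [:a:] * q'" "d = [:b:] * d'" "f = q' * d'"
      using mult.IH[OF e(1) mult.prems(2)] by blast
    moreover from this have "q = [:p * a:] * q'" using e(2) by (simp add: mult.commute)
    ultimately show ?thesis using is_subringD(4)[OF B pB] by blast
  next
    assume "dvd_in (polys_over B) [:p:] d"
    then obtain e where e: "e \<in> polys_over B" "d = [:p:] * e" unfolding dvd_in_def by blast
    have "[:p:] * ([:x:] * f) = [:p:] * (q * e)" using eq unfolding e(2) by (simp add: mult.left_commute)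
    then have "[:x:] * f = q * e" using p0 mult_left_cancel by blast
    then obtain a b q' d' where "a \<in> B" "b \<in> B" "q' \<in> polys_over B" "d' \<in> polys_over B"
      "q = [:a:] * q'" "e = [:b:] * d'" "f = q' * d'"
      using mult.IH[OF mult.prems(1) e(1)] by blast
    moreover from this have "d = [:p * b:] * d'" using e(2) by (simp add: mult.commute)
    ultimately show ?thesis using is_subringD(4)[OF B pB] by blast
  qed
qed


text \<open>
  Gauss's lemma. If \<open>f\<close> has no constant prime factor and divides \<open>g h\<close>, take a nonzero \<open>d\<close> of
  least degree in the ideal \<open>(f, g)\<close>; up to constants it divides both \<open>f\<close> and \<open>g\<close>. Irreducibility
  of \<open>f\<close> makes \<open>d\<close> either a constant up to units, and then \<open>f\<close> divides a constant multiple of \<open>h\<close>,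
  or an associate of \<open>f\<close> up to constants, and then \<open>f\<close> divides a constant multiple of \<open>g\<close>. The
  constants cancel.
\<close>

lemma irreducible_polys_over_imp_prime:
  fixes B :: "'a::idom set"
  assumes B: "is_subring B" and fact: "factorial_subring B" and irr: "irreducible_in (polys_over B) f"
  shows "prime_in (polys_over B) f"
proof -
  let ?P = "polys_over B"
  have P: "is_subring ?P" by (rule is_subring_polys_over[OF B])
  note PD = is_subringD[OF P] and const = const_in_polys_over[OF B]
  have f: "f \<in> ?P" "f \<noteq> 0" "\<not> unit_in ?P f"
    and split: "\<And>a b. a \<in> ?P \<Longrightarrow> b \<in> ?P \<Longrightarrow> f = a * b \<Longrightarrow> unit_in ?P a \<or> unit_in ?P b"
    using irr unfolding irreducible_in_def by blast+
  show ?thesis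
  proof (cases "\<exists>p. prime_in B p \<and> dvd_in ?P [:p:] f")
    case True
    then obtain p w where p: "prime_in B p" and w: "w \<in> ?P" "f = [:p:] * w" unfolding dvd_in_def by blast
    have pP: "prime_in ?P [:p:]" by (rule prime_in_polys_over_const[OF B p])
    then have "unit_in ?P w" using split[OF _ w] unfolding prime_in_def by blast
    then have "prime_in ?P (w * [:p:])" by (rule prime_in_unit_mult[OF P _ pP])
    then show ?thesis using w(2) by (simp add: mult.commute)
  next
    case False
    then have prim: "\<And>p. prime_in B p \<Longrightarrow> \<not> dvd_in ?P [:p:] f" by blast
    have cancel: "dvd_in ?P f h" if "c \<in> B" "c \<noteq> 0" "h \<in> ?P" "dvd_in ?P f ([:c:] * h)" for c h
      using dvd_in_cancel_const[OF B _ f(1) prim that(3,4)] fact that(1,2) unfolding factorial_subring_def by blast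
    have "dvd_in ?P f g \<or> dvd_in ?P f h" if g: "g \<in> ?P" and h: "h \<in> ?P" and gh: "dvd_in ?P f (g * h)" for g h
    proof -
      \<comment> \<open>\<open>d\<close> below generates the ideal \<open>(f, g)\<close> over the field of fractions.\<close>
      define I where "I = {a * f + b * g | a b. a \<in> ?P \<and> b \<in> ?P}"
      have fI: "f \<in> I" unfolding I_def using PD(1,2) by (intro CollectI exI[of _ 1] exI[of _ 0]) auto
      have gI: "g \<in> I" unfolding I_def using PD(1,2) by (intro CollectI exI[of _ 0] exI[of _ 1]) auto
      have IP: "I \<subseteq> ?P" unfolding I_def using f(1) g PD(4,6) by blast
      have comb: "u * x - v * y \<in> I" if "u \<in> ?P" "v \<in> ?P" "x \<in> I" "y \<in> I" for u v x y
      proof -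
        obtain a b a' b' where *: "a \<in> ?P" "b \<in> ?P" "a' \<in> ?P" "b' \<in> ?P" "x = a * f + b * g" "y = a' * f + b' * g"
          using \<open>x \<in> I\<close> \<open>y \<in> I\<close> unfolding I_def by blast
        then have "u * x - v * y = (u * a - v * a') * f + (u * b - v * b') * g" by (simp add: algebra_simps)
        moreover have "u * a - v * a' \<in> ?P" "u * b - v * b' \<in> ?P" using * that(1,2) PD(3,4) by blast+
        ultimately show ?thesis unfolding I_def by blast
      qed
      obtain d where d: "d \<in> I" "d \<noteq> 0" and least: "\<And>e. e \<in> I \<Longrightarrow> e \<noteq> 0 \<Longrightarrow> degree d \<le> degree e"
        using arg_min_nat_lemma[of "\<lambda>e. e \<in> I \<and> e \<noteq> 0" f degree] fI f(2) by blast
      have dP: "d \<in> ?P" using d IP by blast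
      have multiple: "\<exists>c q. c \<in> B \<and> c \<noteq> 0 \<and> q \<in> ?P \<and> [:c:] * e = q * d" if e: "e \<in> I" for e
      proof -
        obtain c q r where c: "c \<in> B" "c \<noteq> 0" "q \<in> ?P" "[:c:] * e = q * d + r" "r = 0 \<or> degree r < degree d"
          using pseudo_division_polys_over[OF B dP d(2), of e] e IP by blast
        have "r = [:c:] * e - q * d" using c(4) by simp
        then have "r \<in> I" using comb[OF const[OF c(1)] c(3) e d(1)] by simp
        then have "r = 0" using c(5) least by fastforce
        then show ?thesis using c by auto
      qed
      obtain c q where c: "c \<in> B" "c \<noteq> 0" "q \<in> ?P" "[:c:] * f = q * d" using multiple[OF fI] by blast
      obtain a b q' d' where ab: "a \<in> B" "b \<in> B" and q'd': "q' \<in> ?P" "d' \<in> ?P"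
        and eqs: "q = [:a:] * q'" "d = [:b:] * d'" "f = q' * d'"
        using split_const_mult[OF B _ f(1) c(3) dP c(4)] fact c(1,2) unfolding factorial_subring_def by blast
      have b0: "b \<noteq> 0" using eqs(2) d(2) by auto
      from split[OF q'd' eqs(3)] show ?thesis
      proof
        assume "unit_in ?P d'"
        then obtain e where e: "e \<in> ?P" "d' * e = 1" unfolding unit_in_def by blast
        have "e * d - 0 * d \<in> I" using e(1) PD(2) d(1) by (intro comb) auto
        moreover have "e * d - 0 * d = [:b:] * (d' * e)" unfolding eqs(2) by (simp only: mult_zero_left diff_zero ac_simps)
        ultimately have "[:b:] \<in> I" using e(2) by simp
        then obtain u v where uv: "u \<in> ?P" "v \<in> ?P" "[:b:] = u * f + v * g" unfolding I_def by blast
        obtain w where w: "w \<in> ?P" "g * h = f * w" using gh unfolding dvd_in_def by blast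
        have "[:b:] * h = u * f * h + v * (g * h)" unfolding uv(3) by (simp only: distrib_right mult.assoc)
        also have "\<dots> = f * (u * h + v * w)" unfolding w(2) by (simp only: distrib_left ac_simps)
        finally have "dvd_in ?P f ([:b:] * h)"
          unfolding dvd_in_def using uv(1,2) w(1) h PD(4,6) by blast
        then show ?thesis using cancel[OF ab(2) b0 h] by blast
      next
        assume "unit_in ?P q'"
        then obtain e where e: "e \<in> ?P" "q' * e = 1" unfolding unit_in_def by blast
        obtain c' r where c': "c' \<in> B" "c' \<noteq> 0" "r \<in> ?P" "[:c':] * g = r * d" using multiple[OF gI] by blast
        have "d' = e * f" unfolding eqs(3) using e(2) by (metis mult.assoc mult.commute mult_1_left)
        then have "[:c':] * g = f * (r * ([:b:] * e))" unfolding c'(4) eqs(2) by (simp only: ac_simps)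
        then have "dvd_in ?P f ([:c':] * g)"
          unfolding dvd_in_def using c'(3) e(1) const[OF ab(2)] PD(4) by blast
        then show ?thesis using cancel[OF c'(1,2) g] by blast
      qed
    qed
    then show ?thesis using f unfolding prime_in_def by blast
  qed
qed

lemma factorial_polys_over:
  fixes B :: "'a::idom set"
  assumes "is_subring B" "noetherian_subring B" "factorial_subring B"
  shows "factorial_subring (polys_over B)"
  using assms is_subring_polys_over noetherian_polys_over irreducible_polys_over_imp_prime
  by (intro factorial_subringI) auto

section \<open>Laurent polynomials form a factorial Noetherian ring\<close>

text \<open>
  Used for the embedding of the integers as constants and for substituting a variable for the
  indeterminate of a polynomial.
\<close>

lemma image_ring_hom:
  fixes f :: "'a::idom \<Rightarrow> 'b::idom"
  assumes one: "f 1 = 1" and diff: "\<And>x y. f (x - y) = f x - f y" and mult: "\<And>x y. f (x * y) = f x * f y"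
    and inj: "inj_on f B" and B: "is_subring B"
  shows is_subring_image: "is_subring (f ` B)"
    and noetherian_image: "noetherian_subring B \<Longrightarrow> noetherian_subring (f ` B)"
    and factorial_image: "factorial_subring B \<Longrightarrow> factorial_subring (f ` B)"
proof -
  note BD = is_subringD[OF B]
  have zero: "f 0 = 0" using diff[of 0 0] by simp
  have add: "f (x + y) = f x + f y" for x y
    using diff[of x "- y"] diff[of 0 y] zero by simp
  have eq_iff: "f x = f y \<longleftrightarrow> x = y" if "x \<in> B" "y \<in> B" for x y
    using inj that by (auto simp: inj_on_eq_iff)
  show "is_subring (f ` B)"
    unfolding is_subring_def
  proof (intro conjI ballI)
    show "1 \<in> f ` B" using BD(1) one by (auto intro: image_eqI[of _ _ 1])
    fix x y assume "x \<in> f ` B" "y \<in> f ` B"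
    then show "x - y \<in> f ` B" "x * y \<in> f ` B" using BD(3,4) by (auto simp: diff[symmetric] mult[symmetric])
  qed
  show "noetherian_subring (f ` B)" if noeth: "noetherian_subring B"
    unfolding noetherian_subring_def
  proof (rule ascending_chains_stop_transfer[OF noeth[unfolded noetherian_subring_def], of _ "\<lambda>J. {x \<in> B. f x \<in> J}"])
    fix J assume "J \<in> {I. is_ideal_of (f ` B) I}"
    then have J: "is_ideal_of (f ` B) J" by simp
    then show "{x \<in> B. f x \<in> J} \<in> {I. is_ideal_of B I}"
      using BD is_ideal_ofD[OF J] by (auto simp: is_ideal_of_def zero add mult)
    fix J' assume "J' \<in> {I. is_ideal_of (f ` B) I}"
    then have J': "is_ideal_of (f ` B) J'" by simp
    show "J = J'" if "{x \<in> B. f x \<in> J} = {x \<in> B. f x \<in> J'}"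
    proof -
      have "J = f ` {x \<in> B. f x \<in> J}" if "is_ideal_of (f ` B) J" for J
        using is_ideal_ofD(1)[OF that] by blast
      then show ?thesis using J J' that by metis
    qed
  qed blast
  have dvd: "dvd_in (f ` B) (f x) (f y) \<longleftrightarrow> dvd_in B x y" if "x \<in> B" "y \<in> B" for x y
    unfolding dvd_in_def using that BD(4) by (auto simp: mult[symmetric] eq_iff)
  have unit: "unit_in (f ` B) (f x) \<longleftrightarrow> unit_in B x" if "x \<in> B" for x
    unfolding unit_in_def using that BD(1,4) by (auto simp: mult[symmetric] one[symmetric] eq_iff)
  have prime: "prime_in (f ` B) (f p)" if p: "prime_in B p" for p
  proof -
    have pB: "p \<in> B" "p \<noteq> 0" using p unfolding prime_in_def by blast+
    then have "f p \<noteq> 0" using eq_iff[of p 0] BD(2) zero by simp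
    moreover have "dvd_in (f ` B) (f p) (f a) \<or> dvd_in (f ` B) (f p) (f b)"
      if "a \<in> B" "b \<in> B" "dvd_in (f ` B) (f p) (f a * f b)" for a b
      using p that BD(4) dvd[OF pB(1)] unfolding prime_in_def by (auto simp: mult[symmetric])
    ultimately show ?thesis using pB p unit[OF pB(1)] unfolding prime_in_def by auto
  qed
  have "prime_product (f ` B) (f x)" if "prime_product B x" for x
    using that
  proof induction
    case (unit u)
    then show ?case using \<open>\<And>x. x \<in> B \<Longrightarrow> unit_in (f ` B) (f x) = unit_in B x\<close>
      by (intro prime_product.unit) (auto simp: unit_in_def)
  next
    case (mult p x)
    then show ?case unfolding \<open>\<And>x y. f (x * y) = f x * f y\<close> by (intro prime_product.mult prime)
  qed
  then show "factorial_subring (f ` B)" if "factorial_subring B"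
    using that zero unfolding factorial_subring_def by auto
qed

text \<open>
  The least positive element of the union of the chain generates it, so the chain stops where that
  element appears.
\<close>

lemma noetherian_subring_int: "noetherian_subring (UNIV :: int set)"
  unfolding noetherian_subring_def ascending_chains_stop_def
proof (intro allI impI, elim conjE)
  fix I :: "nat \<Rightarrow> int set"
  assume I: "\<forall>n. I n \<in> {I. is_ideal_of UNIV I}" and up: "\<forall>n. I n \<subseteq> I (Suc n)"
  have id: "is_ideal_of UNIV (I n)" for n using I by blast
  have mono: "I m \<subseteq> I n" if "m \<le> n" for m n using lift_Suc_mono_le[of I, OF _ that] up by blast
  have sub: "is_subring (UNIV :: int set)" by (simp add: is_subring_def)
  show "\<exists>m. \<forall>n\<ge>m. I n = I m"
  proof (cases "\<exists>n. \<exists>x\<in>I n. x \<noteq> 0")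
    case False
    then have "I n = {0}" for n using is_ideal_ofD(2)[OF id[of n]] by auto
    then show ?thesis by simp
  next
    case True
    let ?Q = "\<lambda>g. g > 0 \<and> (\<exists>n. int g \<in> I n)"
    obtain n x where x: "x \<in> I n" "x \<noteq> 0" using True by blast
    have "sgn x * x \<in> I n" by (rule is_ideal_ofD(4)[OF id UNIV_I x(1)])
    then have "\<bar>x\<bar> \<in> I n" by (simp add: sgn_if abs_if split: if_splits)
    then have ex: "?Q (nat \<bar>x\<bar>)" using x(2) by (intro conjI exI[of _ n]) simp_all
    define g where "g = (LEAST g. ?Q g)"
    have g: "?Q g" unfolding g_def by (rule LeastI[of ?Q, OF ex])
    have least: "g \<le> h" if "?Q h" for h unfolding g_def by (rule Least_le[of ?Q, OF that])
    obtain m where m: "int g \<in> I m" using g by blast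
    have "y \<in> I m" if n: "n \<ge> m" and y: "y \<in> I n" for n y
    proof -
      have "y - y div int g * int g \<in> I n"
        by (intro is_ideal_of_diff[OF sub id y] is_ideal_ofD(4)[OF id UNIV_I] subsetD[OF mono[OF n] m])
      then have in_I: "y mod int g \<in> I n" by (simp add: minus_div_mult_eq_mod)
      have "y mod int g = 0"
      proof (rule ccontr)
        assume "y mod int g \<noteq> 0"
        moreover have "0 \<le> y mod int g" and lt: "y mod int g < int g" using g by simp_all
        ultimately have pos: "0 < y mod int g" by linarith
        then have "?Q (nat (y mod int g))" using in_I by (intro conjI exI[of _ n]) simp_all
        then have "g \<le> nat (y mod int g)" by (rule least)
        then show False using pos lt by linarith
      qed
      then have "y = y div int g * int g" using div_mult_mod_eq[of y "int g"] by simp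
      moreover have "y div int g * int g \<in> I m" by (rule is_ideal_ofD(4)[OF id UNIV_I m])
      ultimately show ?thesis by simp
    qed
    then have "I n \<subseteq> I m" if "n \<ge> m" for n using that by blast
    then have "I n = I m" if "n \<ge> m" for n using mono[OF that] that by (simp add: subset_antisym)
    then show ?thesis by blast
  qed
qed

lemma factorial_subring_int: "factorial_subring (UNIV :: int set)"
proof (rule factorial_subringI[OF subring_UNIV_simps(1) noetherian_subring_int])
  fix p :: int
  assume "irreducible_in UNIV p"
  then show "prime_in UNIV p" unfolding subring_UNIV_simps by (rule irreducible_imp_prime_elem)
qed

text \<open>
  Passing to a ring of fractions keeps both properties: an ideal is determined by its trace on
  \<open>P\<close>, and a prime of \<open>P\<close> stays prime or becomes a unit.
\<close>

lemma localization:
  fixes P :: "'a::idom set"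
  assumes P: "is_subring P" and frac: "\<And>x. \<exists>m\<in>P. m dvd 1 \<and> m * x \<in> P"
  shows noetherian_localization: "noetherian_subring P \<Longrightarrow> noetherian_subring (UNIV :: 'a set)"
    and factorial_localization: "factorial_subring P \<Longrightarrow> factorial_subring (UNIV :: 'a set)"
proof -
  note PD = is_subringD[OF P]
  have frac': "\<exists>m n. m \<in> P \<and> m * n = 1 \<and> m * x \<in> P \<and> n * (m * x) = x" for x
  proof -
    obtain m n where m: "m \<in> P" "1 = m * n" "m * x \<in> P" using frac[of x] unfolding dvd_def by blast
    have "n * (m * x) = m * n * x" by (simp only: ac_simps)
    also have "\<dots> = x" by (simp flip: m(2))
    finally show ?thesis using m by metis
  qed
  show "noetherian_subring (UNIV :: 'a set)" if noeth: "noetherian_subring P"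
    unfolding noetherian_subring_def
  proof (rule ascending_chains_stop_transfer[OF noeth[unfolded noetherian_subring_def], of _ "\<lambda>J. J \<inter> P"])
    fix J :: "'a set" assume "J \<in> {I. is_ideal_of UNIV I}"
    then have J: "is_ideal_of UNIV J" by simp
    then show "J \<inter> P \<in> {I. is_ideal_of P I}"
      using PD is_ideal_ofD[OF J] by (auto simp: is_ideal_of_def)
    fix J' :: "'a set" assume "J' \<in> {I. is_ideal_of UNIV I}"
    then have J': "is_ideal_of UNIV J'" by simp
    have gen: "x \<in> K'" if "is_ideal_of UNIV K" "is_ideal_of UNIV K'" "K \<inter> P = K' \<inter> P" "x \<in> K" for K K' x
    proof -
      obtain m n where m: "m \<in> P" "m * n = 1" "m * x \<in> P" "n * (m * x) = x" using frac'[of x] by blast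
      have "m * x \<in> K" using is_ideal_ofD(4)[OF that(1) _ that(4)] by blast
      then have "m * x \<in> K'" using m(3) that(3) by blast
      then have "n * (m * x) \<in> K'" using is_ideal_ofD(4)[OF that(2)] by blast
      then show ?thesis unfolding m(4) .
    qed
    show "J = J'" if "J \<inter> P = J' \<inter> P"
      using gen[OF J J' that] gen[OF J' J that[symmetric]] by blast
  qed blast
  have prime: "prime_elem p" if p: "prime_in P p" and nu: "\<not> p dvd 1" for p
    unfolding prime_elem_def
  proof (intro conjI allI impI)
    have pP: "p \<in> P" and "p \<noteq> 0" using p unfolding prime_in_def by blast+
    then show "p \<noteq> 0" by blast
    show "\<not> p dvd 1" by (rule nu)
    fix a b assume "p dvd a * b"
    then obtain c where c: "a * b = p * c" by (auto simp: dvd_def)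
    obtain k where k: "k \<in> P" "k dvd 1" "k * a \<in> P" using frac[of a] by blast
    obtain l where l: "l \<in> P" "l dvd 1" "l * b \<in> P" using frac[of b] by blast
    obtain m where m: "m \<in> P" "m dvd 1" "m * c \<in> P" using frac[of c] by blast
    have "m * ((k * a) * (l * b)) = p * (k * l * (m * c))" using c by (simp add: algebra_simps)
    moreover have "k * l * (m * c) \<in> P" using k(1) l(1) m(3) PD(4) by blast
    ultimately have "dvd_in P p (m * ((k * a) * (l * b)))" unfolding dvd_in_def by blast
    moreover have primeD: "dvd_in P p x \<or> dvd_in P p y" if "x \<in> P" "y \<in> P" "dvd_in P p (x * y)" for x y
      using p that unfolding prime_in_def by blast
    ultimately have "dvd_in P p m \<or> dvd_in P p (k * a) \<or> dvd_in P p (l * b)"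
      using primeD[OF m(1) PD(4)[OF k(3) l(3)]] primeD[OF k(3) l(3)] by blast
    then have "p dvd m \<or> p dvd k * a \<or> p dvd l * b" unfolding dvd_in_def by (auto simp: dvd_def)
    moreover have "\<not> p dvd m" using m(2) nu dvd_trans by blast
    moreover have "u * x dvd x" if "u dvd 1" for u x :: 'a using mult_dvd_mono[OF that dvd_refl[of x]] by simp
    ultimately show "p dvd a \<or> p dvd b" using k(2) l(2) dvd_trans by blast
  qed
  have "prime_product UNIV x" if "prime_product P x" for x
    using that
  proof induction
    case (unit u)
    then show ?case unfolding unit_in_def by (intro prime_product.unit) (auto simp: unit_in_def)
  next
    case (mult p x)
    show ?case
    proof (cases "p dvd 1")
      case True
      then have "prime_product UNIV p" by (intro prime_product.unit) (simp add: subring_UNIV_simps)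
      then show ?thesis using mult.IH prime_product_mult subring_UNIV_simps(1) by blast
    next
      case False
      then show ?thesis using mult.IH prime[OF mult.hyps(1)]
        by (intro prime_product.mult) (auto simp: subring_UNIV_simps)
    qed
  qed
  note lift = this
  show "factorial_subring (UNIV :: 'a set)" if fact: "factorial_subring P"
    unfolding factorial_subring_def
  proof (intro ballI impI)
    fix x :: 'a assume "x \<noteq> 0"
    obtain m n where m: "m \<in> P" "m * n = 1" "m * x \<in> P" "n * (m * x) = x" using frac'[of x] by blast
    have "m \<noteq> 0" using m(2) by auto
    then have "prime_product UNIV (m * x)"
      using fact m \<open>x \<noteq> 0\<close> lift unfolding factorial_subring_def by simp
    moreover have "prime_product UNIV n"
      using m(2) by (intro prime_product.unit) (auto simp: unit_in_def mult.commute[of n])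
    ultimately have "prime_product UNIV (n * (m * x))" using prime_product_mult subring_UNIV_simps(1) by blast
    then show "prime_product UNIV x" unfolding m(4) .
  qed
qed

definition var :: "'d \<Rightarrow> 'd laurent" where
  "var i = Poly_Mapping.single (Poly_Mapping.single i 1) 1"

text \<open>
  The polynomial ring over the integers in the listed variables, inside the ring of Laurent
  polynomials. Its elements are obtained by substitution into univariate polynomials, so that the
  results on \<^const>\<open>polys_over\<close> apply at each step.
\<close>

primrec adjoin_vars :: "'d::linorder list \<Rightarrow> 'd laurent set" where
  "adjoin_vars [] = range of_int"
| "adjoin_vars (i # js) = (\<lambda>p. poly p (var i)) ` polys_over (adjoin_vars js)"

definition free_of :: "'d \<Rightarrow> 'd laurent set" where
  "free_of i = {x. \<forall>k\<in>Poly_Mapping.keys x. Poly_Mapping.lookup k i = 0}"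

lemma is_subring_free_of: "is_subring (free_of (i :: 'd::linorder))"
  unfolding is_subring_def
proof (intro conjI ballI)
  show "1 \<in> free_of i" by (simp add: free_of_def)
  fix x y :: "'d laurent" assume xy: "x \<in> free_of i" "y \<in> free_of i"
  then show "x - y \<in> free_of i" using keys_diff[of x y] unfolding free_of_def by blast
  show "x * y \<in> free_of i" using xy keys_mult[of x y] unfolding free_of_def by (force simp: lookup_add)
qed

lemma is_subring_power: "is_subring B \<Longrightarrow> x \<in> B \<Longrightarrow> x ^ n \<in> B"
  by (induction n) (auto intro: is_subringD)

lemma is_subring_of_int:
  assumes B: "is_subring B"
  shows "of_int z \<in> B"
proof -
  have n: "of_nat n \<in> B" for n by (induction n) (auto intro: is_subringD[OF B])
  show ?thesis
  proof (cases z)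
    case (nonneg n)
    then show ?thesis using n by simp
  next
    case (neg n)
    then show ?thesis using is_subringD(5)[OF B n[of "Suc n"]] by (simp only: of_int_minus of_int_of_nat_eq)
  qed
qed

lemma poly_in_subring:
  assumes B: "is_subring B" and p: "p \<in> polys_over B" and x: "x \<in> B"
  shows "poly p x \<in> B"
  unfolding poly_altdef
  using p by (intro is_subring_sum[OF B] is_subringD(4)[OF B] is_subring_power[OF B x]) (simp add: polys_over_def)

lemma adjoin_vars_free_of: "x \<in> adjoin_vars js \<Longrightarrow> i \<notin> set js \<Longrightarrow> x \<in> free_of i"
proof (induction js arbitrary: x)
  case Nil
  then show ?case using is_subring_of_int[OF is_subring_free_of] by auto
next
  case (Cons j js)
  then obtain p where p: "p \<in> polys_over (adjoin_vars js)" "x = poly p (var j)" by auto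
  have "p \<in> polys_over (free_of i)" using p(1) Cons.IH Cons.prems(2) unfolding polys_over_def by auto
  moreover have "var j \<in> free_of i" using Cons.prems(2) by (auto simp: var_def free_of_def lookup_single)
  ultimately show ?case unfolding p(2) by (rule poly_in_subring[OF is_subring_free_of])
qed

lemma sum_single: "x = (\<Sum>k\<in>Poly_Mapping.keys x. Poly_Mapping.single k (Poly_Mapping.lookup x k))"
proof (rule poly_mapping_eqI)
  fix k
  have "Poly_Mapping.lookup (\<Sum>k\<in>Poly_Mapping.keys x. Poly_Mapping.single k (Poly_Mapping.lookup x k)) k = (\<Sum>l\<in>Poly_Mapping.keys x. if l = k then Poly_Mapping.lookup x l else 0)"
    by (simp add: lookup_sum lookup_single when_def)
  also have "\<dots> = Poly_Mapping.lookup x k" by (simp add: in_keys_iff)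
  finally show "Poly_Mapping.lookup x k = Poly_Mapping.lookup (\<Sum>k\<in>Poly_Mapping.keys x. Poly_Mapping.single k (Poly_Mapping.lookup x k)) k" ..
qed

lemma lookup_mult_monomial:
  fixes x :: "'a::ab_group_add \<Rightarrow>\<^sub>0 'b::comm_ring_1"
  shows "Poly_Mapping.lookup (x * Poly_Mapping.single a 1) k = Poly_Mapping.lookup x (k - a)"
proof -
  have "Poly_Mapping.lookup (x * Poly_Mapping.single a 1) k
      = Poly_Mapping.lookup ((\<Sum>l\<in>Poly_Mapping.keys x. Poly_Mapping.single l (Poly_Mapping.lookup x l)) * Poly_Mapping.single a 1) k"
    by (simp flip: sum_single)
  also have "\<dots> = (\<Sum>l\<in>Poly_Mapping.keys x. Poly_Mapping.lookup x l when l + a = k)"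
    by (simp add: sum_distrib_right mult_single lookup_sum lookup_single)
  also have "\<dots> = (\<Sum>l\<in>Poly_Mapping.keys x. if l = k - a then Poly_Mapping.lookup x l else 0)"
    by (intro sum.cong) (auto simp: when_def)
  also have "\<dots> = Poly_Mapping.lookup x (k - a)" by (simp add: in_keys_iff)
  finally show ?thesis .
qed

lemma var_power: "var i ^ n = Poly_Mapping.single (Poly_Mapping.single i (int n)) 1"
proof (induction n)
  case (Suc n)
  then show ?case by (simp add: var_def mult_single flip: single_add)
qed simp

text \<open>
  A variable is transcendental over the Laurent polynomials that do not involve it.
\<close>

lemma inj_on_poly_var:
  "inj_on (\<lambda>p. poly p (var i)) (polys_over (free_of (i :: 'd::linorder)))"
proof (rule inj_onI)
  fix p q :: "'d laurent poly"
  assume p: "p \<in> polys_over (free_of i)" and q: "q \<in> polys_over (free_of i)" and eq: "poly p (var i) = poly q (var i)"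
  define r where "r = p - q"
  have r: "r \<in> polys_over (free_of i)"
    unfolding r_def using p q is_subringD(3)[OF is_subring_polys_over[OF is_subring_free_of]] by blast
  have "coeff r n = 0" for n
  proof (rule poly_mapping_eqI)
    fix k
    let ?e = "\<lambda>m. Poly_Mapping.single i (int m) :: 'd \<Rightarrow>\<^sub>0 int"
    have free: "Poly_Mapping.lookup (coeff r m) l = 0" if "Poly_Mapping.lookup l i \<noteq> 0" for m l
    proof -
      have "coeff r m \<in> free_of i" using r unfolding polys_over_def by blast
      then show ?thesis using that unfolding free_of_def by (auto simp: in_keys_iff)
    qed
    show "Poly_Mapping.lookup (coeff r n) k = Poly_Mapping.lookup 0 k"
    proof (cases "Poly_Mapping.lookup k i = 0")
      case False
      then show ?thesis using free by simp
    next
      case True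
      \<comment> \<open>The coefficients do not involve variable \<open>i\<close>, so the exponent of \<open>i\<close> tells the summands apart.\<close>
      have "0 = Poly_Mapping.lookup (poly r (var i)) (k + ?e n)" using eq by (simp add: r_def)
      also have "\<dots> = (\<Sum>m\<le>degree r. Poly_Mapping.lookup (coeff r m) (k + ?e n - ?e m))"
        by (simp add: poly_altdef lookup_sum var_power lookup_mult_monomial)
      also have "\<dots> = (\<Sum>m\<le>degree r. if m = n then Poly_Mapping.lookup (coeff r m) k else 0)"
        by (intro sum.cong) (auto intro!: free simp: True lookup_add lookup_minus)
      also have "\<dots> = Poly_Mapping.lookup (coeff r n) k" by (simp add: coeff_eq_0)
      finally show ?thesis by simp
    qed
  qed
  then have "r = 0" by (simp add: poly_eqI)
  then show "p = q" by (simp add: r_def)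
qed

lemma adjoin_vars:
  assumes "distinct js"
  shows "is_subring (adjoin_vars js)" "noetherian_subring (adjoin_vars js)" "factorial_subring (adjoin_vars js)"
  using assms
proof (induction js)
  case Nil
  have "inj_on (of_int :: int \<Rightarrow> 'a laurent) UNIV" by (simp add: inj_on_def)
  note hom = image_ring_hom[of "of_int :: int \<Rightarrow> 'a laurent", OF _ _ _ this subring_UNIV_simps(1)]
  {
    case 1 show ?case using hom(1) by simp
  next
    case 2 show ?case using hom(2) noetherian_subring_int by simp
  next
    case 3 show ?case using hom(3) factorial_subring_int by simp
  }
next
  case (Cons i js)
  have "polys_over (adjoin_vars js) \<subseteq> polys_over (free_of i)" if "i \<notin> set js"
    using adjoin_vars_free_of[OF _ that] unfolding polys_over_def by blast
  then have inj: "inj_on (\<lambda>p. poly p (var i)) (polys_over (adjoin_vars js))" if "i \<notin> set js"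
    using inj_on_poly_var that by (blast intro: inj_on_subset)
  note hom = image_ring_hom[of "\<lambda>p. poly p (var i)", OF _ _ _ inj is_subring_polys_over]
  {
    case 1 then show ?case using hom(1) Cons.IH by simp
  next
    case 2 then show ?case using hom(2) Cons.IH noetherian_polys_over[of "adjoin_vars js"] by simp
  next
    case 3 then show ?case using hom(3) Cons.IH factorial_polys_over[of "adjoin_vars js"] by simp
  }
qed

lemma var_in_adjoin_vars: "distinct js \<Longrightarrow> i \<in> set js \<Longrightarrow> var i \<in> adjoin_vars js"
proof (induction js)
  case (Cons j js)
  have B: "is_subring (adjoin_vars js)" using adjoin_vars(1)[of js] Cons.prems(1) by simp
  show ?case
  proof (cases "i = j")
    case True
    have "monom 1 1 \<in> polys_over (adjoin_vars js)"
      using B by (intro monom_in_polys_over is_subringD)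
    then show ?thesis using True by (auto simp: poly_monom intro!: image_eqI[of _ _ "monom 1 1"])
  next
    case False
    then have "[:var i:] \<in> polys_over (adjoin_vars js)" using Cons B by (intro const_in_polys_over) auto
    then show ?thesis by (auto intro!: image_eqI[of _ _ "[:var i:]"])
  qed
qed simp

text \<open>
  Multiplication by a monomial clears the negative exponents of a Laurent polynomial.
\<close>

lemma laurent_fraction:
  fixes x :: "'d::{finite,linorder} laurent"
  assumes "distinct js" and all: "set js = UNIV"
  shows "\<exists>m\<in>adjoin_vars js. m dvd 1 \<and> m * x \<in> adjoin_vars js"
proof -
  let ?P = "adjoin_vars js"
  have P: "is_subring ?P" by (rule adjoin_vars(1)[OF assms(1)])
  note PD = is_subringD[OF P]
  \<comment> \<open>\<open>T\<close>, the ring of fractions, is closed under sums and products and contains all powers of the variables, hence every Laurent monomial.\<close>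
  define T where "T = {x. \<exists>m\<in>?P. m dvd 1 \<and> m * x \<in> ?P}"
  have PT: "x \<in> T" if "x \<in> ?P" for x
    unfolding T_def using that PD(1) by (intro CollectI bexI[of _ 1]) simp_all
  have mult: "x * y \<in> T" if "x \<in> T" "y \<in> T" for x y
  proof -
    obtain m n where mn: "m \<in> ?P" "m dvd 1" "m * x \<in> ?P" "n \<in> ?P" "n dvd 1" "n * y \<in> ?P"
      using \<open>x \<in> T\<close> \<open>y \<in> T\<close> unfolding T_def by blast
    have u: "m * n dvd 1" using mult_dvd_mono[OF mn(2,5)] by simp
    have "m * n * (x * y) = (m * x) * (n * y)" by (simp only: ac_simps)
    then have "m * n * (x * y) \<in> ?P" using PD(4)[OF mn(3,6)] by (simp only:)
    then show ?thesis unfolding T_def using u PD(4)[OF mn(1,4)] by blast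
  qed
  have add: "x + y \<in> T" if "x \<in> T" "y \<in> T" for x y
  proof -
    obtain m n where mn: "m \<in> ?P" "m dvd 1" "m * x \<in> ?P" "n \<in> ?P" "n dvd 1" "n * y \<in> ?P"
      using \<open>x \<in> T\<close> \<open>y \<in> T\<close> unfolding T_def by blast
    have u: "m * n dvd 1" using mult_dvd_mono[OF mn(2,5)] by simp
    have "m * n * (x + y) = n * (m * x) + m * (n * y)" by (simp add: algebra_simps)
    then have "m * n * (x + y) \<in> ?P" using PD(6)[OF PD(4)[OF mn(4,3)] PD(4)[OF mn(1,6)]] by (simp only:)
    then show ?thesis unfolding T_def using u PD(4)[OF mn(1,4)] by blast
  qed
  have varP: "var i ^ n \<in> ?P" for i n
    using var_in_adjoin_vars[OF assms(1)] all by (intro is_subring_power[OF P]) auto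
  have unit: "var i ^ n * Poly_Mapping.single (Poly_Mapping.single i (- int n)) 1 = 1" for i :: 'd and n
    by (simp add: var_power mult_single flip: single_add)
  have single: "Poly_Mapping.single (Poly_Mapping.single i z) 1 \<in> T" for i :: 'd and z
  proof (cases z)
    case (nonneg n)
    then show ?thesis using PT[OF varP[of i n]] by (simp only: var_power)
  next
    case (neg n)
    have "var i ^ Suc n * Poly_Mapping.single (Poly_Mapping.single i z) 1 = 1"
      unfolding neg by (rule unit)
    note eq = this
    have "var i ^ Suc n dvd 1" by (rule dvdI[OF eq[symmetric]])
    moreover have "var i ^ Suc n * Poly_Mapping.single (Poly_Mapping.single i z) 1 \<in> ?P"
      unfolding eq by (rule PD(1))
    ultimately show ?thesis unfolding T_def using varP by blast
  qed
  have prod: "Poly_Mapping.single (\<Sum>i\<in>S. f i) 1 \<in> T" if "\<And>i. i \<in> S \<Longrightarrow> Poly_Mapping.single (f i) 1 \<in> T"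
    for S and f :: "'d \<Rightarrow> 'd \<Rightarrow>\<^sub>0 int"
    using that
  proof (induction S rule: infinite_finite_induct)
    case (insert i S)
    then have "Poly_Mapping.single (f i) 1 * Poly_Mapping.single (\<Sum>i\<in>S. f i) 1 \<in> T" by (intro mult) auto
    then show ?case using insert by (simp add: mult_single)
  qed (use PT[OF PD(1)] in auto)
  have mono: "Poly_Mapping.single k 1 \<in> T" for k :: "'d \<Rightarrow>\<^sub>0 int"
    by (subst sum_single[of k], rule prod, rule single)
  have monomial: "Poly_Mapping.single k c \<in> T" for k c
  proof -
    have "of_int c * Poly_Mapping.single k 1 \<in> T" by (intro mult mono PT is_subring_of_int[OF P])
    moreover have "of_int c = (Poly_Mapping.single 0 c :: 'd laurent)" 
      by (subst single_of_int[symmetric]) simp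
    ultimately show ?thesis by (simp only: mult_single add_0_left mult_1_right)
  qed
  have "(\<Sum>k\<in>S. Poly_Mapping.single k (Poly_Mapping.lookup x k)) \<in> T" for S
    by (induction S rule: infinite_finite_induct) (simp_all add: add monomial PT[OF PD(2)])
  from this[of "Poly_Mapping.keys x"] have "x \<in> T" unfolding sum_single[of x, symmetric] .
  then show ?thesis unfolding T_def by blast
qed

theorem noetherian_laurent: "noetherian_subring (UNIV :: 'd::{finite,linorder} laurent set)"
  and factorial_laurent: "factorial_subring (UNIV :: 'd::{finite,linorder} laurent set)"
proof -
  obtain js :: "'d list" where js: "set js = UNIV" "distinct js"
    using finite_distinct_list[OF finite_class.finite_UNIV] by blast
  note * = adjoin_vars[OF js(2)] laurent_fraction[OF js(2,1)]
  show "noetherian_subring (UNIV :: 'd laurent set)" by (rule noetherian_localization[OF *(1,4,2)])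
  show "factorial_subring (UNIV :: 'd laurent set)" by (rule factorial_localization[OF *(1,4,3)])
qed

section \<open>Prime factorization in a factorial domain\<close>

lemma factorial_irreducible_imp_prime:
  fixes p :: "'a::idom"
  assumes fact: "factorial_subring (UNIV :: 'a set)" and irr: "Factorial_Ring.irreducible p"
  shows "prime_elem p"
proof -
  have "p \<noteq> 0" "\<not> p dvd 1" using irr by (auto simp: irreducible_def)
  then have "prime_product UNIV p" using fact unfolding factorial_subring_def by blast
  then show ?thesis
  proof cases
    case unit
    then show ?thesis using \<open>\<not> p dvd 1\<close> by (simp add: subring_UNIV_simps)
  next
    case (mult q x)
    then have q: "prime_in UNIV q" "\<not> q dvd 1" by (auto simp: subring_UNIV_simps prime_elem_def)
    then have "x dvd 1" using irr mult(1) irreducibleD by blast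
    then have "prime_in UNIV (x * q)"
      using prime_in_unit_mult[of UNIV x q] q(1) by (simp add: subring_UNIV_simps)
    then show ?thesis using mult(1) by (simp add: subring_UNIV_simps mult.commute)
  qed
qed

lemma prime_elem_dvd_prime_elem:
  fixes p q :: "'a::idom"
  assumes "prime_elem p" "prime_elem q" "p dvd q"
  shows "q dvd p"
proof -
  obtain r where r: "q = p * r" using assms(3) by blast
  have "q dvd p \<or> q dvd r" using assms(2) r by (metis dvd_refl prime_elem_dvd_multD)
  moreover have "\<not> q dvd r"
  proof
    assume "q dvd r"
    then obtain s where "r = q * s" by blast
    then have "q * (p * s) = q * 1" using r by (simp add: ac_simps)
    then have "p * s = 1" using assms(2) by (simp add: prime_elem_def)
    then show False using assms(1) dvdI[of 1 p s] by (simp add: prime_elem_def)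
  qed
  ultimately show ?thesis by blast
qed

lemma prime_power_part:
  fixes p a :: "'a::idom"
  assumes fact: "factorial_subring (UNIV :: 'a set)" and p: "prime_elem p" and a: "a \<noteq> 0"
  obtains e s where "a = p ^ e * s" "\<not> p dvd s"
proof -
  have "prime_product UNIV a" using fact a unfolding factorial_subring_def by blast
  then have "\<exists>e s. a = p ^ e * s \<and> \<not> p dvd s"
  proof induction
    case (unit u)
    then have "\<not> p dvd u" using p dvd_trans[of p u 1] by (auto simp: subring_UNIV_simps prime_elem_def)
    then have "u = p ^ 0 * u \<and> \<not> p dvd u" by simp
    then show ?case by blast
  next
    case (mult q x)
    obtain e s where e: "x = p ^ e * s" "\<not> p dvd s" using mult.IH by blast
    have q: "prime_elem q" using mult.hyps(1) by (simp add: subring_UNIV_simps)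
    show ?case
    proof (cases "p dvd q")
      case True
      obtain r where r: "q = p * r" using True by blast
      obtain t where t: "p = q * t" using prime_elem_dvd_prime_elem[OF p q True] by blast
      have "p * (r * t) = p * 1" using r t by (metis mult.assoc mult_1_right)
      then have "r * t = 1" using p by (simp add: prime_elem_def)
      then have "\<not> p dvd r" using p dvdI[of 1 r t] dvd_trans[of p r 1] by (auto simp: prime_elem_def)
      then have "\<not> p dvd r * s" using e(2) prime_elem_dvd_multD[OF p] by blast
      moreover have "q * x = p ^ Suc e * (r * s)" by (simp add: e r ac_simps)
      ultimately show ?thesis by blast
    next
      case False
      then have "\<not> p dvd q * s" using e(2) prime_elem_dvd_multD[OF p] by blast
      moreover have "q * x = p ^ e * (q * s)" by (simp add: e ac_simps)
      ultimately show ?thesis by blast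
    qed
  qed
  then show ?thesis using that by blast
qed

lemma prime_power_dvd_iff:
  fixes p a :: "'a::idom"
  assumes p: "prime_elem p" and a: "a = p ^ e * s" "\<not> p dvd s"
  shows "p ^ n dvd a \<longleftrightarrow> n \<le> e"
proof
  assume n: "p ^ n dvd a"
  show "n \<le> e"
  proof (rule ccontr)
    assume "\<not> n \<le> e"
    then obtain m where m: "n = e + Suc m" using less_imp_Suc_add by (metis not_le add_Suc_right)
    have "p ^ e * p ^ Suc m dvd p ^ e * s" using n unfolding a(1) m power_add .
    moreover have "p ^ e \<noteq> 0" using p by (simp add: prime_elem_def)
    ultimately have "p ^ Suc m dvd s" using dvd_times_left_cancel_iff by blast
    then show False using a(2) dvd_trans[of p "p ^ Suc m" s] by simp
  qed
next
  assume "n \<le> e"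
  then show "p ^ n dvd a" unfolding a(1) by (intro dvd_mult2 le_imp_power_dvd)
qed

lemma prime_product_irreducible_factorization:
  fixes a :: "'a::idom"
  assumes "prime_product UNIV a"
  shows "\<exists>F. irreducible_factorization a F"
  using assms
proof induction
  case (unit u)
  then have "irreducible_factorization u {#}"
    by (simp add: irreducible_factorization_def subring_UNIV_simps)
  then show ?case ..
next
  case (mult p x)
  obtain F where F: "irreducible_factorization x F" using mult.IH ..
  then obtain e where e: "e dvd 1" "x = e * prod_mset F" unfolding irreducible_factorization_def by blast
  have "Factorial_Ring.irreducible p"
    using mult.hyps(1) by (simp add: subring_UNIV_simps prime_elem_imp_irreducible)
  moreover have "p * x = e * prod_mset (add_mset p F)" using e(2) by (simp add: ac_simps)
  ultimately have "irreducible_factorization (p * x) (add_mset p F)"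
    using F e(1) unfolding irreducible_factorization_def by auto
  then show ?case ..
qed

lemma irreducible_factorization_count:
  fixes p a :: "'a::idom"
  assumes fact: "factorial_subring (UNIV :: 'a set)" and p: "prime_elem p"
    and F: "irreducible_factorization a F"
  shows "\<exists>s. a = p ^ size {#q \<in># F. p dvd q \<and> q dvd p#} * s \<and> \<not> p dvd s"
proof -
  obtain e where e: "e dvd 1" "a = e * prod_mset F" and irr: "\<forall>q\<in>#F. Factorial_Ring.irreducible q"
    using F unfolding irreducible_factorization_def by blast
  have unit: "\<not> p dvd u" if "u dvd 1" for u using p that dvd_trans[of p u 1] by (auto simp: prime_elem_def)
  have "\<exists>s. prod_mset F = p ^ size {#q \<in># F. p dvd q \<and> q dvd p#} * s \<and> \<not> p dvd s"
    using irr
  proof (induction F)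
    case empty
    then show ?case using unit[of 1] by simp
  next
    case (add q F)
    then obtain s where s: "prod_mset F = p ^ size {#q \<in># F. p dvd q \<and> q dvd p#} * s" "\<not> p dvd s" by auto
    have q: "prime_elem q" using add.prems factorial_irreducible_imp_prime[OF fact] by simp
    show ?case
    proof (cases "p dvd q")
      case True
      have qp: "q dvd p" by (rule prime_elem_dvd_prime_elem[OF p q True])
      obtain r where r: "q = p * r" using True by blast
      have "\<not> p dvd r"
      proof
        assume "p dvd r"
        then have "q dvd r" using qp dvd_trans by blast
        then obtain t where "r = q * t" by blast
        then have "q * (p * t) = q * 1" using r by (simp add: ac_simps)
        then have "p * t = 1" using q by (simp add: prime_elem_def)
        then show False using p dvdI[of 1 p t] by (simp add: prime_elem_def)
      qed
      then have "\<not> p dvd r * s" using s(2) prime_elem_dvd_multD[OF p] by blast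
      moreover have "prod_mset (add_mset q F) = p ^ size {#x \<in># add_mset q F. p dvd x \<and> x dvd p#} * (r * s)"
        using True qp by (simp add: s(1)) (simp add: r ac_simps)
      ultimately show ?thesis by blast
    next
      case False
      then have "\<not> p dvd q * s" using s(2) prime_elem_dvd_multD[OF p] by blast
      moreover have "prod_mset (add_mset q F) = p ^ size {#x \<in># add_mset q F. p dvd x \<and> x dvd p#} * (q * s)"
        using False by (simp add: s(1) ac_simps)
      ultimately show ?thesis by blast
    qed
  qed
  then obtain s where s: "prod_mset F = p ^ size {#q \<in># F. p dvd q \<and> q dvd p#} * s" "\<not> p dvd s" by blast
  have "\<not> p dvd e * s" using s(2) unit[OF e(1)] prime_elem_dvd_multD[OF p] by blast
  moreover have "a = p ^ size {#q \<in># F. p dvd q \<and> q dvd p#} * (e * s)" by (simp add: e(2) s(1) ac_simps)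
  ultimately show ?thesis by blast
qed

lemma has_factor_multiplicityI:
  fixes p a :: "'a::idom"
  assumes fact: "factorial_subring (UNIV :: 'a set)" and p: "prime_elem p"
    and a: "a \<noteq> 0" "p ^ m dvd a" "\<not> p ^ Suc m dvd a"
  shows "has_factor_multiplicity p a m"
  unfolding has_factor_multiplicity_def
proof (intro conjI allI impI)
  show "\<exists>F. irreducible_factorization a F"
    using fact a(1) prime_product_irreducible_factorization unfolding factorial_subring_def by blast
  fix F assume "irreducible_factorization a F"
  then obtain s where "a = p ^ size {#q \<in># F. p dvd q \<and> q dvd p#} * s" "\<not> p dvd s"
    using irreducible_factorization_count[OF fact p] by blast
  note iff = prime_power_dvd_iff[OF p this]
  show "size {#q \<in># F. p dvd q \<and> q dvd p#} = m" using a(2,3) unfolding iff by simp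
qed

text \<open>
  A nonzero prime ideal contains a prime factor of each of its nonzero elements; inside \<open>(p)\<close> that
  factor is an associate of \<open>p\<close>. In other words \<open>(p)\<close> has height one.
\<close>

lemma prime_ideal_below_principal:
  fixes p :: "'a::idom"
  assumes fact: "factorial_subring (UNIV :: 'a set)" and p: "prime_elem p"
    and Q: "primeideal Q (class_ring :: 'a ring)" and c: "c \<in> Q" "c \<noteq> 0" and sub: "\<And>x. x \<in> Q \<Longrightarrow> p dvd x"
  shows "Q = {x. p dvd x}"
proof -
  interpret Q: primeideal Q "class_ring :: 'a ring" by (rule Q)
  have Qmult: "x * y \<in> Q" if "y \<in> Q" for x y using Q.I_l_closed[of y x] that by (simp add: class_ring_simps)
  have "prime_product UNIV c" using fact c(2) unfolding factorial_subring_def by blast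
  then have "\<exists>q. prime_elem q \<and> q \<in> Q" using c(1)
  proof induction
    case (unit u)
    then obtain v where "v * u = 1" unfolding unit_in_def by (auto simp: mult.commute)
    then have "1 \<in> Q" using Qmult[OF unit(2), of v] by simp
    then have "p dvd 1" by (rule sub)
    then show ?case using p by (simp add: prime_elem_def)
  next
    case (mult q x)
    then have "q \<in> Q \<or> x \<in> Q" using Q.I_prime[of q x] by (simp add: class_ring_simps)
    then show ?case using mult by (auto simp: subring_UNIV_simps)
  qed
  then obtain q where q: "prime_elem q" "q \<in> Q" by blast
  have "q dvd p" by (rule prime_elem_dvd_prime_elem[OF p q(1) sub[OF q(2)]])
  then obtain t where "p = q * t" by blast
  then have "p \<in> Q" using Qmult[OF q(2), of t] by (simp add: mult.commute)
  show ?thesis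
  proof (intro equalityI subsetI CollectI)
    fix x assume "x \<in> {x. p dvd x}"
    then obtain y where "x = p * y" by blast
    then show "x \<in> Q" using Qmult[OF \<open>p \<in> Q\<close>, of y] by (simp add: mult.commute)
  qed (rule sub)
qed

section \<open>Determinants of tuples of vectors of a submodule\<close>

definition vec_submodule :: "nat \<Rightarrow> 'a::comm_ring_1 vec set \<Rightarrow> bool" where
  "vec_submodule k N \<longleftrightarrow> N \<subseteq> carrier_vec k \<and> 0\<^sub>v k \<in> N \<and>
     (\<forall>x\<in>N. \<forall>y\<in>N. x + y \<in> N) \<and> (\<forall>r. \<forall>x\<in>N. r \<cdot>\<^sub>v x \<in> N)"

lemma vec_submoduleD:
  assumes "vec_submodule k N"
  shows "x \<in> N \<Longrightarrow> x \<in> carrier_vec k" "0\<^sub>v k \<in> N" "x \<in> N \<Longrightarrow> y \<in> N \<Longrightarrow> x + y \<in> N"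
    "x \<in> N \<Longrightarrow> r \<cdot>\<^sub>v x \<in> N"
  using assms unfolding vec_submodule_def by blast+

abbreviation det_rows :: "nat \<Rightarrow> (nat \<Rightarrow> 'a::comm_ring_1 vec) \<Rightarrow> 'a" where
  "det_rows k f \<equiv> det (mat\<^sub>r k k f)"

lemma det_rows_cong: "(\<And>i. i < k \<Longrightarrow> f i = g i) \<Longrightarrow> det_rows k f = det_rows k g"
  by (rule arg_cong[of _ _ det], rule eq_matI) auto

lemma det_rows_add:
  assumes "\<forall>i<k. f i \<in> carrier_vec k" "x \<in> carrier_vec k" "y \<in> carrier_vec k" "j < k"
  shows "det_rows k (f(j := x + y)) = det_rows k (f(j := x)) + det_rows k (f(j := y))"
  using det_row_add[of "\<lambda>_. x" j k "\<lambda>_. y" f] assms by (simp add: fun_upd_def)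

lemma det_rows_smult:
  assumes f: "\<forall>i<k. f i \<in> carrier_vec k" and x: "x \<in> carrier_vec k" and j: "j < k"
  shows "det_rows k (f(j := r \<cdot>\<^sub>v x)) = r * det_rows k (f(j := x))"
proof -
  have "det_rows k (f(j := r \<cdot>\<^sub>v x)) = det_rows k (\<lambda>i. (if i = j then r else 1) \<cdot>\<^sub>v (f(j := x)) i)"
    by (rule det_rows_cong) auto
  also have "\<dots> = (\<Prod>i\<in>{0..<k}. if i = j then r else 1) * det_rows k (\<lambda>i. (f(j := x)) i)"
    by (rule det_rows_mul) (use f x in auto)
  also have "(\<Prod>i\<in>{0..<k}. if i = j then r else 1) = r" using j by simp
  finally show ?thesis .
qed

lemma det_rows_smult_all:
  assumes "\<forall>i<k. f i \<in> carrier_vec k"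
  shows "det_rows k (\<lambda>i. c i \<cdot>\<^sub>v f i) = (\<Prod>i<k. c i) * det_rows k f"
  using det_rows_mul[of f k c] assms by (simp add: atLeast0LessThan Pi_def)

lemma det_rows_repeated:
  assumes "\<forall>i<k. f i \<in> carrier_vec k" "i < k" "j < k" "i \<noteq> j" "f i = f j"
  shows "det_rows k f = 0"
  by (rule det_identical_rows[of _ k i j]) (use assms in auto)

text \<open>
  Divisibility of determinants of tuples extends from a set \<open>S\<close> to its span, one row at a time.
  The span enters only through the property that it lies in every submodule containing \<open>S\<close>.
\<close>

lemma dvd_det_rows_span:
  fixes S :: "'a::comm_ring_1 vec set"
  assumes S: "S \<subseteq> carrier_vec k"
    and span: "\<And>T. vec_submodule k T \<Longrightarrow> S \<subseteq> T \<Longrightarrow> N \<subseteq> T"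
    and dvd: "\<And>f. (\<And>i. i < k \<Longrightarrow> f i \<in> S) \<Longrightarrow> c dvd det_rows k f"
    and f: "\<And>i. i < k \<Longrightarrow> f i \<in> N"
  shows "c dvd det_rows k f"
proof -
  have N: "N \<subseteq> carrier_vec k"
    using S by (intro span) (auto simp: vec_submodule_def)
  have "c dvd det_rows k f" if "j \<le> k" "\<And>i. i < j \<Longrightarrow> f i \<in> N" "\<And>i. j \<le> i \<Longrightarrow> i < k \<Longrightarrow> f i \<in> S" for j f
    using that
  proof (induction j arbitrary: f)
    case 0
    then show ?case using dvd by simp
  next
    case (Suc j)
    \<comment> \<open>Row \<open>j\<close> is moved from \<open>S\<close> to its span, by linearity in that row.\<close>
    define T where "T = {y \<in> carrier_vec k. c dvd det_rows k (f(j := y))}"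
    have j: "j < k" using Suc.prems(1) by simp
    have fc: "\<forall>i<k. f i \<in> carrier_vec k"
    proof (intro allI impI)
      fix i assume "i < k"
      then show "f i \<in> carrier_vec k"
        using Suc.prems(2)[of i] Suc.prems(3)[of i] N S by (cases "i < Suc j") auto
    qed
    have zero: "det_rows k (f(j := 0\<^sub>v k)) = 0"
    proof -
      have "0 \<cdot>\<^sub>v 0\<^sub>v k = (0\<^sub>v k :: 'a vec)" by (rule eq_vecI) auto
      then show ?thesis using det_rows_smult[OF fc, of "0\<^sub>v k" j 0] j by simp
    qed
    have "vec_submodule k T"
      unfolding vec_submodule_def T_def
      using zero det_rows_add[OF fc _ _ j] det_rows_smult[OF fc _ j] by auto
    moreover have "S \<subseteq> T"
    proof
      fix y assume y: "y \<in> S"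
      have "c dvd det_rows k (f(j := y))"
      proof (rule Suc.IH)
        show "j \<le> k" using j by simp
        show "(f(j := y)) i \<in> N" if "i < j" for i using that Suc.prems(2)[of i] by simp
        show "(f(j := y)) i \<in> S" if "j \<le> i" "i < k" for i using that y Suc.prems(3)[of i] by simp
      qed
      then show "y \<in> T" using y S unfolding T_def by blast
    qed
    ultimately have "N \<subseteq> T" by (rule span)
    then have "f j \<in> T" using Suc.prems(2)[of j] by blast
    then show ?case unfolding T_def by simp
  qed
  from this[of k f] f show ?thesis by simp
qed

lemma mult_mat_vec_in_submodule:
  assumes N: "vec_submodule k N" and A: "A \<in> carrier_mat k n" and cols: "\<And>j. j < n \<Longrightarrow> col A j \<in> N"
    and x: "x \<in> carrier_vec n"
  shows "A *\<^sub>v x \<in> N"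
proof -
  have "vec k (\<lambda>i. \<Sum>j<m. A $$ (i, j) * x $ j) \<in> N" if "m \<le> n" for m
    using that
  proof (induction m)
    case 0
    have "vec k (\<lambda>i. \<Sum>j<0. A $$ (i, j) * x $ j) = 0\<^sub>v k" by (rule eq_vecI) auto
    then show ?case using vec_submoduleD(2)[OF N] by simp
  next
    case (Suc m)
    let ?v = "\<lambda>m. vec k (\<lambda>i. \<Sum>j<m. A $$ (i, j) * x $ j)"
    have eq: "?v (Suc m) = ?v m + x $ m \<cdot>\<^sub>v col A m"
      using A Suc.prems by (intro eq_vecI) (auto simp: mult.commute)
    have "x $ m \<cdot>\<^sub>v col A m \<in> N" using cols[of m] Suc.prems by (intro vec_submoduleD(4)[OF N]) simp
    moreover have "?v m \<in> N" by (rule Suc.IH) (use Suc.prems in simp)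
    ultimately show ?case unfolding eq by (intro vec_submoduleD(3)[OF N])
  qed
  moreover have "A *\<^sub>v x = vec k (\<lambda>i. \<Sum>j<n. A $$ (i, j) * x $ j)"
    using A x by (intro eq_vecI) (auto simp: scalar_prod_def atLeast0LessThan)
  ultimately show ?thesis by simp
qed

text \<open>
  Cramer's rule expresses \<open>det f\<close> times \<open>x\<close> through the \<open>f i\<close> with the determinants
  \<open>det (f(i := x))\<close> as coefficients; a common factor \<open>c\<close> of all these determinants cancels.
\<close>

lemma cramer_in_submodule:
  fixes N :: "'a::idom vec set"
  assumes N: "vec_submodule k N" and f: "\<And>i. i < k \<Longrightarrow> f i \<in> N" and x: "x \<in> carrier_vec k"
    and det: "det_rows k f = c * s" and nz: "c \<noteq> 0" "s \<noteq> 0"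
    and dvd: "\<And>i. i < k \<Longrightarrow> c dvd det_rows k (f(i := x))"
  shows "s \<cdot>\<^sub>v x \<in> N"
proof -
  let ?R = "mat\<^sub>r k k f"
  define A where "A = transpose_mat ?R"
  have fc: "\<forall>i<k. f i \<in> carrier_vec k" using f vec_submoduleD(1)[OF N] by blast
  have A: "A \<in> carrier_mat k k" unfolding A_def by simp
  have detA: "det A = c * s" unfolding A_def using det det_transpose[of ?R k] by simp
  define z where "z = adj_mat A *\<^sub>v x"
  have adj: "adj_mat A \<in> carrier_mat k k" using adj_mat(1)[OF A] .
  have z: "z \<in> carrier_vec k" unfolding z_def using adj x by simp
  have Az: "A *\<^sub>v z = (c * s) \<cdot>\<^sub>v x"
  proof -
    have "A *\<^sub>v z = (A * adj_mat A) *\<^sub>v x" unfolding z_def using assoc_mult_mat_vec[OF A adj x] by simp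
    also have "\<dots> = (det A \<cdot>\<^sub>m 1\<^sub>m k) *\<^sub>v x" using adj_mat(2)[OF A] by simp
    also have "\<dots> = det A \<cdot>\<^sub>v (1\<^sub>m k *\<^sub>v x)" using x by auto
    finally show ?thesis using x detA by simp
  qed
  have zi: "z $ i = det_rows k (f(i := x))" if i: "i < k" for i
  proof -
    have "replace_col A (A *\<^sub>v z) i = transpose_mat (mat\<^sub>r k k (f(i := (c * s) \<cdot>\<^sub>v x)))"
      unfolding Az using x fc A by (intro eq_matI) (auto simp: replace_col_def A_def)
    then have "det (replace_col A (A *\<^sub>v z) i) = det_rows k (f(i := (c * s) \<cdot>\<^sub>v x))"
      using det_transpose[of "mat\<^sub>r k k (f(i := (c * s) \<cdot>\<^sub>v x))" k] by simp
    also have "\<dots> = (c * s) * det_rows k (f(i := x))" by (rule det_rows_smult[OF fc x i])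
    finally have "(c * s) * det_rows k (f(i := x)) = z $ i * (c * s)"
      using cramer_lemma_mat[OF A z i] unfolding detA by (rule trans[OF sym])
    then have "(c * s) * z $ i = (c * s) * det_rows k (f(i := x))" by (simp only: mult.commute)
    moreover have "c * s \<noteq> 0" using nz by simp
    ultimately show ?thesis using mult_left_cancel by blast
  qed
  have "\<forall>i. \<exists>w. i < k \<longrightarrow> z $ i = c * w" using zi dvd by (auto simp: dvd_def)
  then obtain w where w: "\<And>i. i < k \<Longrightarrow> z $ i = c * w i" by metis
  have z_eq: "z = c \<cdot>\<^sub>v vec k w" using z w by (intro eq_vecI) auto
  have "c \<cdot>\<^sub>v (A *\<^sub>v vec k w) = A *\<^sub>v z" unfolding z_eq 
    using A by (intro eq_vecI) (auto simp: scalar_prod_def sum_distrib_left ac_simps)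
  also have "\<dots> = c \<cdot>\<^sub>v (s \<cdot>\<^sub>v x)" unfolding Az by (simp add: smult_smult_assoc)
  finally have eq: "c \<cdot>\<^sub>v (A *\<^sub>v vec k w) = c \<cdot>\<^sub>v (s \<cdot>\<^sub>v x)" .
  have "A *\<^sub>v vec k w = s \<cdot>\<^sub>v x"
  proof (rule eq_vecI)
    fix i assume i: "i < dim_vec (s \<cdot>\<^sub>v x)"
    then have "c * (A *\<^sub>v vec k w) $ i = c * (s \<cdot>\<^sub>v x) $ i"
      using arg_cong[OF eq, of "\<lambda>v. vec_index v i"] x A by simp
    then show "(A *\<^sub>v vec k w) $ i = (s \<cdot>\<^sub>v x) $ i" using nz(1) by simp
  qed (use x A in simp)
  moreover have "A *\<^sub>v vec k w \<in> N"
  proof (rule mult_mat_vec_in_submodule[OF N A])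
    fix j assume "j < k"
    then have "col A j = f j" unfolding A_def using fc by (simp add: col_transpose)
    then show "col A j \<in> N" using f[OF \<open>j < k\<close>] by simp
  qed simp
  ultimately show ?thesis by simp
qed

section \<open>The order of a prime along a submodule\<close>

text \<open>
  The least exponent of \<open>p\<close> in a determinant of \<open>k\<close> vectors from \<open>N\<close>. In a factorial domain this
  is the length of the localization of \<open>R\<^sup>k/N\<close> at the prime ideal \<open>(p)\<close>, when \<open>N\<close> has rank
  \<open>k\<close>; it replaces that localization in the proof.
\<close>

definition has_order :: "nat \<Rightarrow> 'a::idom \<Rightarrow> 'a vec set \<Rightarrow> nat \<Rightarrow> bool" where
  "has_order k p N e \<longleftrightarrow>
     (\<forall>f. (\<forall>i<k. f i \<in> N) \<longrightarrow> p ^ e dvd det_rows k f) \<and>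
     (\<exists>f. (\<forall>i<k. f i \<in> N) \<and> \<not> p ^ Suc e dvd det_rows k f)"

lemma has_order_dvd:
  assumes "has_order k p N e" "\<forall>i<k. f i \<in> N"
  shows "p ^ e dvd det_rows k f"
  using conjunct1[OF assms(1)[unfolded has_order_def], THEN spec, of f] assms(2) by (rule mp)

lemma has_order_witness:
  assumes "has_order k p N e"
  obtains f where "\<forall>i<k. f i \<in> N" "\<not> p ^ Suc e dvd det_rows k f"
  using conjunct2[OF assms(1)[unfolded has_order_def]] by (elim exE conjE)

lemma has_order_full:
  fixes p :: "'a::idom"
  assumes "prime_elem p"
  shows "has_order k p (carrier_vec k) 0"
proof -
  have "mat\<^sub>r k k (unit_vec k) = (1\<^sub>m k :: 'a mat)" by (rule eq_matI) auto
  then have "det_rows k (unit_vec k) = (1 :: 'a)" by simp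
  then show ?thesis
    unfolding has_order_def using assms by (auto simp: prime_elem_def intro!: exI[of _ "unit_vec k"])
qed

text \<open>
  If a scalar \<open>s\<close> outside \<open>(p)\<close> maps \<open>N'\<close> into \<open>N\<close>, multiplying all \<open>k\<close> rows by \<open>s\<close> changes a
  determinant by \<open>s ^ k\<close>, which does not affect its exponent of \<open>p\<close>.
\<close>

lemma has_order_step_same:
  fixes p :: "'a::idom"
  assumes p: "prime_elem p" and N': "vec_submodule k N'" and sub: "N \<subseteq> N'"
    and s: "\<not> p dvd s" "\<And>y. y \<in> N' \<Longrightarrow> s \<cdot>\<^sub>v y \<in> N" and ord: "has_order k p N' e"
  shows "has_order k p N e"
proof -
  obtain f where f: "\<forall>i<k. f i \<in> N'" "\<not> p ^ Suc e dvd det_rows k f" by (rule has_order_witness[OF ord])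
  have fc: "\<forall>i<k. f i \<in> carrier_vec k" using f(1) vec_submoduleD(1)[OF N'] by blast
  have det: "det_rows k (\<lambda>i. s \<cdot>\<^sub>v f i) = s ^ k * det_rows k f"
    using det_rows_smult_all[OF fc, of "\<lambda>_. s"] by simp
  have "\<not> p dvd s ^ k" using p s(1) prime_elem_dvd_power by blast
  have cancel: "p ^ n dvd a" if "p ^ n dvd s ^ k * a" for n a
    using that
  proof (induction n arbitrary: a)
    case (Suc n)
    have "p dvd s ^ k * a" by (rule dvd_mult_left[OF Suc.prems[unfolded power_Suc]])
    then have "p dvd a" using prime_elem_dvd_multD[OF p] \<open>\<not> p dvd s ^ k\<close> by blast
    then obtain b where b: "a = p * b" by blast
    have "s ^ k * a = p * (s ^ k * b)" unfolding b by (rule mult.left_commute)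
    then have "p * p ^ n dvd p * (s ^ k * b)" using Suc.prems by (simp only: power_Suc)
    moreover have "p \<noteq> 0" using p by (simp add: prime_elem_def)
    ultimately have "p ^ n dvd s ^ k * b" using dvd_mult_cancel_left[of p "p ^ n" "s ^ k * b"] by blast
    then have "p ^ n dvd b" by (rule Suc.IH)
    then show ?case unfolding b power_Suc by (rule mult_dvd_mono[OF dvd_refl])
  qed simp
  have "\<not> p ^ Suc e dvd det_rows k (\<lambda>i. s \<cdot>\<^sub>v f i)" unfolding det using cancel f(2) by blast
  moreover have "\<forall>i<k. s \<cdot>\<^sub>v f i \<in> N" using f(1) s(2) by blast
  moreover have "p ^ e dvd det_rows k f" if "\<forall>i<k. f i \<in> N" for f
    using sub that by (intro has_order_dvd[OF ord]) blast
  ultimately show ?thesis unfolding has_order_def by (intro conjI exI[of _ "\<lambda>i. s \<cdot>\<^sub>v f i"]) simp_all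
qed

text \<open>
  If \<open>N'/N\<close> is isomorphic to \<open>R/(p)\<close>, generated by the class of \<open>x\<close>, the order grows by exactly
  one. It grows, for otherwise Cramer's rule would put \<open>s x\<close> into \<open>N\<close> for some \<open>s\<close> outside \<open>(p)\<close>.
  It grows by at most one, because determinants of tuples from \<open>N'\<close> are combinations of those with
  at most one row \<open>x\<close> and the others in \<open>N\<close>, and \<open>p x\<close> lies in \<open>N\<close>.
\<close>

lemma has_order_step_up:
  fixes p :: "'a::idom"
  assumes p: "prime_elem p" and N: "vec_submodule k N" and N': "vec_submodule k N'" and sub: "N \<subseteq> N'"
    and x: "x \<in> N'" and gen: "\<And>y. y \<in> N' \<Longrightarrow> \<exists>n\<in>N. \<exists>r. y = n + r \<cdot>\<^sub>v x"
    and ann: "\<And>r. r \<cdot>\<^sub>v x \<in> N \<longleftrightarrow> p dvd r" and ord: "has_order k p N' e"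
  shows "has_order k p N (Suc e)"
  unfolding has_order_def
proof (intro conjI allI impI)
  have p0: "p \<noteq> 0" using p by (simp add: prime_elem_def)
  have xc: "x \<in> carrier_vec k" using x vec_submoduleD(1)[OF N'] by blast
  have dvd: "p ^ e dvd det_rows k f" if "\<And>i. i < k \<Longrightarrow> f i \<in> N'" for f
    using that by (intro has_order_dvd[OF ord]) simp
  fix f assume f: "\<forall>i<k. f i \<in> N"
  show "p ^ Suc e dvd det_rows k f"
  proof (rule ccontr)
    assume no: "\<not> p ^ Suc e dvd det_rows k f"
    have "p ^ e dvd det_rows k f" using f sub by (intro dvd) blast
    then obtain s where s: "det_rows k f = p ^ e * s" by blast
    have ns: "\<not> p dvd s"
    proof
      assume "p dvd s"
      then obtain t where "s = p * t" by blast
      then have "det_rows k f = p ^ Suc e * t" using s by (simp add: ac_simps)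
      then show False using no by simp
    qed
    have "s \<noteq> 0" using ns by auto
    \<comment> \<open>If the bound were attained by \<open>f\<close>, then \<open>f\<close> would be a basis of \<open>N\<close> after inverting everything outside \<open>(p)\<close>, so \<open>x\<close> would lie in that localization of \<open>N\<close>.\<close>
    have "s \<cdot>\<^sub>v x \<in> N"
    proof (rule cramer_in_submodule[OF N _ xc s _ \<open>s \<noteq> 0\<close>])
      show "f i \<in> N" if "i < k" for i using f that by blast
      show "p ^ e \<noteq> 0" using p0 by simp
      show "p ^ e dvd det_rows k (f(i := x))" if "i < k" for i
        using f sub x by (intro dvd) auto
    qed
    then show False using ann ns by blast
  qed
next
  have p0: "p \<noteq> 0" using p by (simp add: prime_elem_def)
  have xc: "x \<in> carrier_vec k" using x vec_submoduleD(1)[OF N'] by blast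
  show "\<exists>f. (\<forall>i<k. f i \<in> N) \<and> \<not> p ^ Suc (Suc e) dvd det_rows k f"
  proof (rule ccontr)
    assume "\<not> ?thesis"
    then have all: "p ^ Suc (Suc e) dvd det_rows k f" if "\<forall>i<k. f i \<in> N" for f using that by metis
    have Nc: "y \<in> carrier_vec k" if "y \<in> N" for y using that vec_submoduleD(1)[OF N] by blast
    have "p ^ Suc e dvd det_rows k f" if "\<And>i. i < k \<Longrightarrow> f i \<in> N'" for f
    proof (rule dvd_det_rows_span[of "insert x N" k N'])
      show "insert x N \<subseteq> carrier_vec k" using xc Nc by blast
      show "N' \<subseteq> T" if T: "vec_submodule k T" and "insert x N \<subseteq> T" for T
      proof
        fix y assume "y \<in> N'"
        then obtain n r where "n \<in> N" "y = n + r \<cdot>\<^sub>v x" using gen by blast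
        then show "y \<in> T" using \<open>insert x N \<subseteq> T\<close> vec_submoduleD(3,4)[OF T] by blast
      qed
      fix f assume f: "\<And>i. i < k \<Longrightarrow> f i \<in> insert x N"
      have fc: "\<forall>i<k. f i \<in> carrier_vec k" using f xc Nc by blast
      show "p ^ Suc e dvd det_rows k f"
      proof (cases "\<exists>i<k. f i = x")
        case False
        then have "p ^ Suc (Suc e) dvd det_rows k f" using f by (intro all) blast
        moreover have "p ^ Suc e dvd p ^ Suc (Suc e)" by (rule le_imp_power_dvd) simp
        ultimately show ?thesis by (rule dvd_trans[rotated])
      next
        case True
        then obtain i where i: "i < k" "f i = x" by blast
        show ?thesis
        proof (cases "\<exists>j<k. j \<noteq> i \<and> f j = x")
          case True
          then obtain j where "j < k" "j \<noteq> i" "f j = x" by blast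
          then have "det_rows k f = 0" using det_rows_repeated[OF fc i(1), of j] i(2) by simp
          then show ?thesis by (simp only: dvd_0_right)
        next
          case False
          \<comment> \<open>A single row \<open>x\<close> may be multiplied by \<open>p\<close> to land in \<open>N\<close>.\<close>
          have "p ^ Suc (Suc e) dvd det_rows k (f(i := p \<cdot>\<^sub>v x))"
          proof (rule all, intro allI impI)
            fix j assume "j < k"
            then show "(f(i := p \<cdot>\<^sub>v x)) j \<in> N" using f[of j] False ann[of p] by auto
          qed
          also have "det_rows k (f(i := p \<cdot>\<^sub>v x)) = p * det_rows k f"
            using det_rows_smult[OF fc xc i(1), of p] i(2) by (metis fun_upd_triv)
          finally have "p * p ^ Suc e dvd p * det_rows k f" unfolding power_Suc[of p "Suc e"] .
          then show ?thesis using p0 dvd_mult_cancel_left[of p "p ^ Suc e" "det_rows k f"] by blast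
        qed
      qed
    qed (rule that)
    note contra = this
    obtain f where "\<forall>i<k. f i \<in> N'" "\<not> p ^ Suc e dvd det_rows k f" by (rule has_order_witness[OF ord])
    then show False using contra[of f] by simp
  qed
qed

lemma has_order_unique:
  assumes "has_order k p N e" "has_order k p N e'"
  shows "e = e'"
proof -
  have "e' \<le> e" if o1: "has_order k p N e" and o2: "has_order k p N e'" for e e'
  proof (rule ccontr)
    assume "\<not> e' \<le> e"
    then have le: "p ^ Suc e dvd p ^ e'" by (intro le_imp_power_dvd) simp
    obtain f where f: "\<forall>i<k. f i \<in> N" "\<not> p ^ Suc e dvd det_rows k f" by (rule has_order_witness[OF o1])
    show False using f(2) dvd_trans[OF le has_order_dvd[OF o2 f(1)]] by blast
  qed
  then show ?thesis using assms by (meson le_antisym)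
qed

section \<open>Minors\<close>

definition column_span :: "'a::comm_ring_1 mat \<Rightarrow> 'a vec set" where
  "column_span A = (\<lambda>x. A *\<^sub>v x) ` carrier_vec (dim_col A)"

lemma vec_submodule_column_span:
  assumes A: "A \<in> carrier_mat k n"
  shows "vec_submodule k (column_span A)"
  unfolding vec_submodule_def column_span_def
proof (intro conjI ballI allI)
  show "(\<lambda>x. A *\<^sub>v x) ` carrier_vec (dim_col A) \<subseteq> carrier_vec k" using A by auto
  have "A *\<^sub>v 0\<^sub>v (dim_col A) = 0\<^sub>v k" using A by (intro eq_vecI) auto
  then show "0\<^sub>v k \<in> (\<lambda>x. A *\<^sub>v x) ` carrier_vec (dim_col A)"
    by (intro image_eqI[of _ _ "0\<^sub>v (dim_col A)"]) simp_all
  fix v assume "v \<in> (\<lambda>x. A *\<^sub>v x) ` carrier_vec (dim_col A)"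
  then obtain x where x: "x \<in> carrier_vec (dim_col A)" "v = A *\<^sub>v x" by blast
  show "r \<cdot>\<^sub>v v \<in> (\<lambda>x. A *\<^sub>v x) ` carrier_vec (dim_col A)" for r
  proof (rule image_eqI[of _ _ "r \<cdot>\<^sub>v x"])
    show "r \<cdot>\<^sub>v v = A *\<^sub>v (r \<cdot>\<^sub>v x)" using x
      by (intro eq_vecI) (auto simp: scalar_prod_def sum_distrib_left ac_simps)
  qed (use x in simp)
  fix w assume "w \<in> (\<lambda>x. A *\<^sub>v x) ` carrier_vec (dim_col A)"
  then obtain y where y: "y \<in> carrier_vec (dim_col A)" "w = A *\<^sub>v y" by blast
  show "v + w \<in> (\<lambda>x. A *\<^sub>v x) ` carrier_vec (dim_col A)"
  proof (rule image_eqI[of _ _ "x + y"])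
    show "v + w = A *\<^sub>v (x + y)" using x y mult_add_distrib_mat_vec[of A k "dim_col A" x y] A by simp
  qed (use x y in simp)
qed

lemma col_in_column_span:
  assumes A: "A \<in> carrier_mat k n" and j: "j < n"
  shows "col A j \<in> column_span A"
proof -
  have "col A j = A *\<^sub>v unit_vec n j"
    using A j by (intro eq_vecI) (auto simp: scalar_prod_right_unit)
  then show ?thesis unfolding column_span_def using A by (intro image_eqI[of _ _ "unit_vec n j"]) auto
qed

lemma minor_eq_det_rows:
  assumes A: "A \<in> carrier_mat k n" and IJ: "I \<subseteq> {..<k}" "card I = k" "J \<subseteq> {..<n}" "card J = k"
  shows "submatrix A I J = transpose_mat (mat\<^sub>r k k (\<lambda>i. col A (pick J i)))"
    and "det (submatrix A I J) = det_rows k (\<lambda>i. col A (pick J i))"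
proof -
  have I: "I = {..<k}" using IJ(1,2) card_subset_eq[of "{..<k}" I] by simp
  have dims: "{i. i < dim_row A \<and> i \<in> I} = {..<k}" "{j. j < dim_col A \<and> j \<in> J} = J" using A I IJ(3) by auto
  have pickI: "pick I i = i" if "i < k" for i
  proof -
    have "pick UNIV i = pick {a. a < k \<and> a \<in> UNIV} i" by (rule pick_reduce_set) (use that in simp)
    then show ?thesis unfolding pick_UNIV I lessThan_def by simp
  qed
  have pickJ: "pick J j < n" if "j < k" for j
    using pick_in_set_le[of j J] IJ(3,4) that by auto
  show *: "submatrix A I J = transpose_mat (mat\<^sub>r k k (\<lambda>i. col A (pick J i)))"
    unfolding submatrix_def dims using A pickI pickJ IJ(4) by (intro eq_matI) auto
  show "det (submatrix A I J) = det_rows k (\<lambda>i. col A (pick J i))"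
    unfolding * by (rule det_transpose[of _ k]) simp
qed

text \<open>
  By multilinearity only tuples of columns matter; a tuple with a repeated column has determinant
  zero, and any other is a maximal minor up to sign.
\<close>

lemma dvd_minors_iff_dvd_det_rows:
  fixes A :: "'a::comm_ring_1 mat"
  assumes A: "A \<in> carrier_mat k n"
  shows "(\<forall>a\<in>minors k A. c dvd a) \<longleftrightarrow> (\<forall>f. (\<forall>i<k. f i \<in> column_span A) \<longrightarrow> c dvd det_rows k f)"
proof
  assume rows: "\<forall>f. (\<forall>i<k. f i \<in> column_span A) \<longrightarrow> c dvd det_rows k f"
  show "\<forall>a\<in>minors k A. c dvd a"
  proof
    fix a assume "a \<in> minors k A"
    then obtain I J where IJ: "I \<subseteq> {..<k}" "card I = k" "J \<subseteq> {..<n}" "card J = k" "a = det (submatrix A I J)"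
      using A unfolding minors_def by auto
    have "col A (pick J i) \<in> column_span A" if "i < k" for i
      using pick_in_set_le[of i J] IJ(3,4) that by (intro col_in_column_span[OF A]) auto
    then show "c dvd a"
      unfolding IJ(5) minor_eq_det_rows(2)[OF A IJ(1-4)] using rows by simp
  qed
next
  assume minors: "\<forall>a\<in>minors k A. c dvd a"
  have cols: "c dvd det_rows k (\<lambda>i. col A (h i))" if h: "\<forall>i<k. h i < n" for h
  proof (cases "inj_on h {..<k}")
    case False
    then obtain i j where "i < k" "j < k" "i \<noteq> j" "h i = h j" unfolding inj_on_def by blast
    then have "det_rows k (\<lambda>i. col A (h i)) = 0" using A by (intro det_rows_repeated[of k _ i j]) auto
    then show ?thesis by simp
  next
    case True
    define J where "J = h ` {..<k}"
    have J: "J \<subseteq> {..<n}" "card J = k" unfolding J_def using h True by (auto simp: card_image)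
    have finJ: "finite J" unfolding J_def by simp
    \<comment> \<open>\<open>p\<close> sorts the selected columns.\<close>
    define p where "p i = (if i < k then card {a\<in>J. a < h i} else i)" for i
    have hJ: "h i \<in> J" if "i < k" for i using that unfolding J_def by simp
    have pick_p: "pick J (p i) = h i" if "i < k" for i
      unfolding p_def using that pick_card_in_set[OF hJ[OF that]] by simp
    have p_lt: "p i < k" if "i < k" for i
    proof -
      have "{a\<in>J. a < h i} \<subset> J" using hJ[OF that] by auto
      then have "card {a\<in>J. a < h i} < card J" using finJ by (rule psubset_card_mono[rotated])
      then show ?thesis unfolding p_def using that J(2) by simp
    qed
    have inj: "inj_on p {0..<k}"
    proof (rule inj_onI)
      fix i j assume "i \<in> {0..<k}" "j \<in> {0..<k}" "p i = p j"
      then have "h i = h j" using pick_p[of i] pick_p[of j] by simp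
      then show "i = j" using True \<open>i \<in> {0..<k}\<close> \<open>j \<in> {0..<k}\<close> by (auto dest: inj_onD)
    qed
    have "p ` {0..<k} = {0..<k}" using inj p_lt by (intro endo_inj_surj) auto
    then have perm: "p permutes {0..<k}"
      using inj by (intro bij_imp_permutes) (auto simp: bij_betw_def p_def)
    let ?f = "\<lambda>i. col A (pick J i)"
    have "mat\<^sub>r k k (\<lambda>i. col A (h i)) = mat k k (\<lambda>(i, j). mat\<^sub>r k k ?f $$ (p i, j))"
      using A p_lt pick_p h by (intro eq_matI) auto
    then have "det_rows k (\<lambda>i. col A (h i)) = signof p * det_rows k ?f"
      using det_permute_rows[of "mat\<^sub>r k k ?f" k p] perm by simp
    moreover have "det_rows k ?f \<in> minors k A"
      unfolding minors_def using minor_eq_det_rows(2)[OF A subset_refl _ J] J A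
      by (intro CollectI exI[of _ "{..<k}"] exI[of _ J]) auto
    ultimately show ?thesis using minors by simp
  qed
  show "\<forall>f. (\<forall>i<k. f i \<in> column_span A) \<longrightarrow> c dvd det_rows k f"
  proof (intro allI impI)
    fix f assume f: "\<forall>i<k. f i \<in> column_span A"
    show "c dvd det_rows k f"
    proof (rule dvd_det_rows_span[of "col A ` {..<n}" k "column_span A"])
      show "col A ` {..<n} \<subseteq> carrier_vec k" using A by auto
      show "column_span A \<subseteq> T" if T: "vec_submodule k T" "col A ` {..<n} \<subseteq> T" for T
      proof
        fix v assume "v \<in> column_span A"
        then obtain x where "x \<in> carrier_vec n" "v = A *\<^sub>v x" unfolding column_span_def using A by auto
        then show "v \<in> T" using T(2) by (auto intro!: mult_mat_vec_in_submodule[OF T(1) A])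
      qed
      fix g assume g: "\<And>i. i < k \<Longrightarrow> g i \<in> col A ` {..<n}"
      have "\<forall>i. \<exists>j. i < k \<longrightarrow> j < n \<and> g i = col A j" using g by blast
      then obtain h where h: "\<forall>i. i < k \<longrightarrow> h i < n \<and> g i = col A (h i)" by (rule choice[THEN exE])
      have "det_rows k g = det_rows k (\<lambda>i. col A (h i))" using h by (intro det_rows_cong) simp
      then show "c dvd det_rows k g" using cols[of h] h by simp
    qed (use f in simp)
  qed
qed

text \<open>
  Over the field of fractions, \<open>k\<close> linearly independent columns form an invertible matrix.
\<close>

lemma full_rank_imp_nonzero_minor:
  fixes A :: "'a::idom mat"
  assumes A: "A \<in> carrier_mat k n" and rank: "fraction_rank A = k"
  shows "\<exists>a\<in>minors k A. a \<noteq> 0"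
proof -
  let ?h = "to_fract :: 'a \<Rightarrow> 'a fract"
  let ?A = "map_mat ?h A"
  interpret inj_comm_ring_hom ?h by (unfold_locales, auto)
  interpret vec_space "TYPE('a fract)" k .
  have A': "?A \<in> carrier_mat k n" using A by simp
  have rank': "rank ?A = k" using rank A unfolding fraction_rank_def by simp
  obtain S where S: "maximal S (\<lambda>T. T \<subseteq> set (cols ?A) \<and> lin_indpt T)"
    using maximal_exists_superset[of "set (cols ?A)" "\<lambda>T. T \<subseteq> set (cols ?A) \<and> lin_indpt T" "{}"]
      finite_lin_indpt2[of "{}"] by auto
  have card: "card S = k" using rank_card_indpt[OF A' S] rank' by simp
  have sub: "S \<subseteq> set (cols ?A)" and ind: "lin_indpt S" using S unfolding maximal_def by blast+
  obtain ls where ls: "set ls = S" "distinct ls"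
    using finite_distinct_list[of S] finite_subset[OF sub] by auto
  have len: "length ls = k" using ls card distinct_card by fastforce
  have lsc: "set ls \<subseteq> carrier_vec k" using ls(1) sub cols_dim[of ?A] A' by auto
  define B where "B = mat_of_cols k ls"
  have B: "B \<in> carrier_mat k k" unfolding B_def using mat_of_cols_carrier(1)[of k ls] len by simp
  have colsB: "cols B = ls" unfolding B_def by (rule cols_mat_of_cols[OF lsc])
  have "rank B = k" using lin_indpt_full_rank[OF B] colsB ls ind by simp
  then have detB: "det B \<noteq> 0" using det_rank_iff[OF B] by simp
  have "\<forall>i. \<exists>j. i < k \<longrightarrow> j < n \<and> ls ! i = col ?A j"
  proof
    fix i
    show "\<exists>j. i < k \<longrightarrow> j < n \<and> ls ! i = col ?A j"
    proof (cases "i < k")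
      case True
      then have "ls ! i \<in> set (cols ?A)" using ls(1) sub len nth_mem by blast
      then show ?thesis using A' by (auto simp: cols_def)
    qed simp
  qed
  then obtain h where h: "\<forall>i. i < k \<longrightarrow> h i < n \<and> ls ! i = col ?A (h i)" by (rule choice[THEN exE])
  have "transpose_mat B = map_mat ?h (mat\<^sub>r k k (\<lambda>i. col A (h i)))"
  proof (rule eq_matI)
    fix i j assume "i < dim_row (map_mat ?h (mat\<^sub>r k k (\<lambda>i. col A (h i))))" "j < dim_col (map_mat ?h (mat\<^sub>r k k (\<lambda>i. col A (h i))))"
    then have ij: "i < k" "j < k" by auto
    then have "transpose_mat B $$ (i, j) = ls ! i $ j"
      unfolding B_def using len by (simp add: mat_of_cols_index)
    also have "\<dots> = ?h (A $$ (j, h i))" using h ij A by simp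
    finally show "transpose_mat B $$ (i, j) = map_mat ?h (mat\<^sub>r k k (\<lambda>i. col A (h i))) $$ (i, j)"
      using ij h A by simp
  qed (use B in auto)
  then have "?h (det_rows k (\<lambda>i. col A (h i))) = det B" using det_transpose[OF B] by (simp add: hom_det)
  then have "det_rows k (\<lambda>i. col A (h i)) \<noteq> 0" using detB by auto
  moreover have "\<forall>i<k. col A (h i) \<in> column_span A" using h col_in_column_span[OF A] by blast
  ultimately have "\<not> (\<forall>f. (\<forall>i<k. f i \<in> column_span A) \<longrightarrow> 0 dvd det_rows k f)" by auto
  then have "\<not> (\<forall>a\<in>minors k A. 0 dvd a)" unfolding dvd_minors_iff_dvd_det_rows[OF A] .
  then show ?thesis by simp
qed

section \<open>Quotient modules\<close>

abbreviation submod :: "'b set \<Rightarrow> ('a::comm_ring_1, 'b, 'x) module_scheme \<Rightarrow> bool" where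
  "submod N M \<equiv> Module.submodule N (class_ring :: 'a ring) M"

lemma submod_iff:
  fixes M :: "('a::comm_ring_1, 'b, 'x) module_scheme" (structure)
  assumes "Module.module class_ring M"
  shows "submod N M \<longleftrightarrow> N \<subseteq> carrier M \<and> \<zero> \<in> N \<and> (\<forall>x\<in>N. \<forall>y\<in>N. x \<oplus> y \<in> N) \<and> (\<forall>r. \<forall>x\<in>N. r \<odot> x \<in> N)"
proof -
  interpret M: Module.module class_ring M by (rule assms)
  have minus: "\<ominus> x = (- 1) \<odot> x" if "x \<in> carrier M" for x
    using M.smult_l_minus[of 1 x] M.smult_one[OF that] that by (simp add: class_ring_simps)
  show ?thesis
  proof
    assume N: "submod N M"
    interpret N: Module.submodule N class_ring M by (rule N)
    have "x \<oplus> y \<in> N" if "x \<in> N" "y \<in> N" for x y using N.m_closed[OF that] by simp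
    then show "N \<subseteq> carrier M \<and> \<zero> \<in> N \<and> (\<forall>x\<in>N. \<forall>y\<in>N. x \<oplus> y \<in> N) \<and> (\<forall>r. \<forall>x\<in>N. r \<odot> x \<in> N)"
      using N.subset N.one_closed N.smult_closed by auto
  next
    assume N: "N \<subseteq> carrier M \<and> \<zero> \<in> N \<and> (\<forall>x\<in>N. \<forall>y\<in>N. x \<oplus> y \<in> N) \<and> (\<forall>r. \<forall>x\<in>N. r \<odot> x \<in> N)"
    show "submod N M"
      using N by (intro M.submoduleI) (auto simp: minus subset_iff)
  qed
qed

text \<open>
  Computation with cosets \<open>N + x\<close>, for an arbitrary module and submodule. It is used for the
  cokernel, for the quotients of its filtrations and for \<open>R/Q\<close>.
\<close>

locale submodule_quotient =
  fixes M :: "('a::comm_ring_1, 'b, 'x) module_scheme" (structure) and N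
  assumes M: "Module.module (class_ring :: 'a ring) M" and N: "submod N M"
begin

sublocale M: Module.module "class_ring :: 'a ring" M by (rule M)

lemma N_facts: "N \<subseteq> carrier M" "\<zero> \<in> N" "x \<in> N \<Longrightarrow> y \<in> N \<Longrightarrow> x \<oplus> y \<in> N" "x \<in> N \<Longrightarrow> r \<odot> x \<in> N"
  "x \<in> N \<Longrightarrow> \<ominus> x \<in> N"
proof -
  show "N \<subseteq> carrier M" "\<zero> \<in> N" "x \<in> N \<Longrightarrow> y \<in> N \<Longrightarrow> x \<oplus> y \<in> N" "x \<in> N \<Longrightarrow> r \<odot> x \<in> N"
    using N unfolding submod_iff[OF M] by blast+
  show "x \<in> N \<Longrightarrow> \<ominus> x \<in> N" by (rule M.submoduleE(3)[OF N])
qed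

sublocale S: abelian_subgroup N M
proof (rule abelian_subgroupI3)
  show "additive_subgroup N M" using N unfolding Module.submodule_def by (intro additive_subgroupI) simp
qed (rule M.abelian_group_axioms)

lemma in_coset_iff:
  assumes "x \<in> carrier M"
  shows "y \<in> N +> x \<longleftrightarrow> (\<exists>n\<in>N. y = n \<oplus> x)"
  unfolding a_r_coset_def' by auto

lemma coset_eq_iff:
  assumes x: "x \<in> carrier M" and y: "y \<in> carrier M"
  shows "N +> x = N +> y \<longleftrightarrow> (\<exists>n\<in>N. x = n \<oplus> y)"
proof
  assume "N +> x = N +> y"
  then show "\<exists>n\<in>N. x = n \<oplus> y" using S.a_rcos_self[OF x] in_coset_iff[OF y] by simp
next
  assume "\<exists>n\<in>N. x = n \<oplus> y"
  then have "x \<in> N +> y" using in_coset_iff[OF y] by simp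
  then show "N +> x = N +> y"
    using M.a_repr_independence[of x N y] y S.a_subgroup by simp
qed

lemma coset_zero: "N +> \<zero> = N"
  using M.a_coset_add_zero[of N] N_facts(1) by simp

lemma coset_eq_N_iff:
  assumes x: "x \<in> carrier M"
  shows "N +> x = N \<longleftrightarrow> x \<in> N"
proof -
  have "N +> x = N +> \<zero> \<longleftrightarrow> (\<exists>n\<in>N. x = n \<oplus> \<zero>)" by (rule coset_eq_iff[OF x]) simp
  also have "\<dots> \<longleftrightarrow> x \<in> N" using N_facts(1) by (auto simp: subset_iff)
  finally show ?thesis unfolding coset_zero .
qed

lemma carrier_quotient: "carrier (quotient_module M N) = (\<lambda>x. N +> x) ` carrier M"
  unfolding quotient_module_def A_RCOSETS_def' by auto

lemma zero_quotient: "\<zero>\<^bsub>quotient_module M N\<^esub> = N"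
  unfolding quotient_module_def by simp

lemma add_quotient:
  assumes "x \<in> carrier M" "y \<in> carrier M"
  shows "(N +> x) \<oplus>\<^bsub>quotient_module M N\<^esub> (N +> y) = N +> (x \<oplus> y)"
  unfolding quotient_module_def using S.a_rcos_sum[OF assms] by simp

lemma smult_quotient:
  assumes x: "x \<in> carrier M"
  shows "r \<odot>\<^bsub>quotient_module M N\<^esub> (N +> x) = N +> (r \<odot> x)"
proof -
  have sc: "s \<odot> y \<in> carrier M" if "y \<in> carrier M" for s y using M.smult_closed[of s y] that by simp
  have Nc: "n \<in> carrier M" if "n \<in> N" for n using that N_facts(1) by blast
  have dist: "r \<odot> (y \<oplus> z) = r \<odot> y \<oplus> r \<odot> z" if "y \<in> carrier M" "z \<in> carrier M" for y z
    using M.smult_r_distr[of r y z] that by simp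
  have "N <+> ((\<lambda>x. r \<odot> x) ` (N +> x)) = N +> (r \<odot> x)"
  proof (rule Set.set_eqI)
    fix y
    show "y \<in> N <+> ((\<lambda>x. r \<odot> x) ` (N +> x)) \<longleftrightarrow> y \<in> N +> (r \<odot> x)"
    proof
      assume "y \<in> N <+> ((\<lambda>x. r \<odot> x) ` (N +> x))"
      then obtain m n where mn: "m \<in> N" "n \<in> N" "y = m \<oplus> r \<odot> (n \<oplus> x)"
        unfolding set_add_def' a_r_coset_def' by auto
      then have "y = (m \<oplus> r \<odot> n) \<oplus> r \<odot> x" using dist[of n x] Nc sc x by (simp add: M.a_assoc)
      moreover have "m \<oplus> r \<odot> n \<in> N" by (rule N_facts(3)[OF mn(1) N_facts(4)[OF mn(2)]])
      ultimately show "y \<in> N +> (r \<odot> x)" unfolding a_r_coset_def' by blast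
    next
      assume "y \<in> N +> (r \<odot> x)"
      then obtain n where "n \<in> N" "y = n \<oplus> r \<odot> x" unfolding a_r_coset_def' by auto
      moreover have "x \<in> N +> x" by (rule S.a_rcos_self[OF x])
      ultimately show "y \<in> N <+> ((\<lambda>x. r \<odot> x) ` (N +> x))" unfolding set_add_def' by blast
    qed
  qed
  then show ?thesis unfolding quotient_module_def by simp
qed

lemma module_quotient: "Module.module (class_ring :: 'a ring) (quotient_module M N)"
proof (rule moduleI)
  let ?Q = "quotient_module M N"
  show "cring (class_ring :: 'a ring)" by (rule Module.module.axioms(1)[OF M])
  have sc: "s \<odot> y \<in> carrier M" if "y \<in> carrier M" for s y using M.smult_closed[of s y] that by simp
  show "abelian_group ?Q"
  proof (rule abelian_groupI)
    show "x \<oplus>\<^bsub>?Q\<^esub> y \<in> carrier ?Q" if "x \<in> carrier ?Q" "y \<in> carrier ?Q" for x y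
      using that unfolding carrier_quotient by (auto simp: add_quotient)
    show "\<zero>\<^bsub>?Q\<^esub> \<in> carrier ?Q"
      unfolding carrier_quotient zero_quotient by (rule image_eqI[of _ _ "\<zero>"]) (simp_all add: coset_zero)
    show "x \<oplus>\<^bsub>?Q\<^esub> y \<oplus>\<^bsub>?Q\<^esub> z = x \<oplus>\<^bsub>?Q\<^esub> (y \<oplus>\<^bsub>?Q\<^esub> z)" if "x \<in> carrier ?Q" "y \<in> carrier ?Q" "z \<in> carrier ?Q" for x y z
      using that unfolding carrier_quotient by (auto simp: add_quotient M.a_assoc)
    show "x \<oplus>\<^bsub>?Q\<^esub> y = y \<oplus>\<^bsub>?Q\<^esub> x" if "x \<in> carrier ?Q" "y \<in> carrier ?Q" for x y
      using that unfolding carrier_quotient by (auto simp: add_quotient M.a_comm)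
    show "\<zero>\<^bsub>?Q\<^esub> \<oplus>\<^bsub>?Q\<^esub> x = x" if xQ: "x \<in> carrier ?Q" for x
    proof -
      obtain a where a: "a \<in> carrier M" "x = N +> a" using xQ unfolding carrier_quotient by blast
      have "\<zero>\<^bsub>?Q\<^esub> = N +> \<zero>" by (simp add: zero_quotient coset_zero)
      then show ?thesis using a add_quotient[of \<zero> a] by simp
    qed
    show "\<exists>y\<in>carrier ?Q. y \<oplus>\<^bsub>?Q\<^esub> x = \<zero>\<^bsub>?Q\<^esub>" if xQ: "x \<in> carrier ?Q" for x
    proof -
      obtain a where a: "a \<in> carrier M" "x = N +> a" using xQ unfolding carrier_quotient by blast
      have "(N +> (\<ominus> a)) \<oplus>\<^bsub>?Q\<^esub> x = \<zero>\<^bsub>?Q\<^esub>"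
        using a add_quotient[of "\<ominus> a" a] by (simp add: M.l_neg zero_quotient coset_zero)
      moreover have "N +> (\<ominus> a) \<in> carrier ?Q" unfolding carrier_quotient using a by blast
      ultimately show ?thesis by blast
    qed
  qed
  fix a b :: 'a
  fix X assume "X \<in> carrier ?Q"
  then obtain x where x: "x \<in> carrier M" "X = N +> x" unfolding carrier_quotient by blast
  show "a \<odot>\<^bsub>?Q\<^esub> X \<in> carrier ?Q" unfolding x(2) smult_quotient[OF x(1)] carrier_quotient using sc x(1) by blast
  show "(a \<oplus>\<^bsub>class_ring\<^esub> b) \<odot>\<^bsub>?Q\<^esub> X = a \<odot>\<^bsub>?Q\<^esub> X \<oplus>\<^bsub>?Q\<^esub> b \<odot>\<^bsub>?Q\<^esub> X"
    using x(1) M.smult_l_distr[of a b x] sc unfolding x(2) by (simp add: smult_quotient add_quotient)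
  show "(a \<otimes>\<^bsub>class_ring\<^esub> b) \<odot>\<^bsub>?Q\<^esub> X = a \<odot>\<^bsub>?Q\<^esub> (b \<odot>\<^bsub>?Q\<^esub> X)"
    using x(1) M.smult_assoc1[of a b x] sc unfolding x(2) by (simp add: smult_quotient)
  show "\<one>\<^bsub>class_ring\<^esub> \<odot>\<^bsub>?Q\<^esub> X = X"
    using x(1) M.smult_one[of x] unfolding x(2) by (simp add: smult_quotient)
  fix Y assume "Y \<in> carrier ?Q"
  then obtain y where y: "y \<in> carrier M" "Y = N +> y" unfolding carrier_quotient by blast
  show "a \<odot>\<^bsub>?Q\<^esub> (X \<oplus>\<^bsub>?Q\<^esub> Y) = a \<odot>\<^bsub>?Q\<^esub> X \<oplus>\<^bsub>?Q\<^esub> a \<odot>\<^bsub>?Q\<^esub> Y"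
    using x(1) y(1) M.smult_r_distr[of a x y] sc unfolding x(2) y(2) by (simp add: smult_quotient add_quotient)
qed

end

lemma module_ring_as_module: "Module.module (class_ring :: 'a::comm_ring_1 ring) (ring_as_module class_ring)"
proof (rule moduleI)
  show "cring (class_ring :: 'a ring)"
    by (rule class_cring.is_cring)
  show "abelian_group (ring_as_module (class_ring :: 'a ring))"
  proof (rule abelian_groupI)
    fix x :: 'a assume "x \<in> carrier (ring_as_module class_ring)"
    show "\<exists>y\<in>carrier (ring_as_module class_ring). y \<oplus>\<^bsub>ring_as_module class_ring\<^esub> x = \<zero>\<^bsub>ring_as_module class_ring\<^esub>"
      by (rule bexI[of _ "- x"]) (simp_all add: ring_as_module_def)
  qed (simp_all add: ring_as_module_def algebra_simps)
qed (auto simp: ring_as_module_def algebra_simps)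

lemma ideal_submod_ring_as_module:
  assumes "ideal Q (class_ring :: 'a::comm_ring_1 ring)"
  shows "submod Q (ring_as_module (class_ring :: 'a ring))"
proof -
  interpret Q: ideal Q "class_ring :: 'a ring" by (rule assms)
  show ?thesis
    unfolding submod_iff[OF module_ring_as_module]
    using Q.zero_closed Q.a_closed Q.I_l_closed by (auto simp: ring_as_module_def)
qed

text \<open>
  \<open>M/N\<close> is isomorphic to \<open>R/Q\<close> precisely when it is generated by one class, with annihilator \<open>Q\<close>:
  the generator corresponds to the class of \<open>1\<close>. This turns the steps of a filtration into
  statements about elements.
\<close>

lemma module_isomorphic_cyclic_iff:
  fixes M :: "('a::comm_ring_1, 'b, 'x) module_scheme" (structure)
  assumes M: "Module.module (class_ring :: 'a ring) M" and N: "submod N M"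
    and Q: "ideal Q (class_ring :: 'a ring)"
  shows "module_isomorphic class_ring (quotient_module M N) (quotient_module (ring_as_module (class_ring :: 'a ring)) Q)
    \<longleftrightarrow> (\<exists>x\<in>carrier M. (\<forall>y\<in>carrier M. \<exists>n\<in>N. \<exists>r. y = n \<oplus> r \<odot> x) \<and> (\<forall>r. r \<odot> x \<in> N \<longleftrightarrow> r \<in> Q))"
proof -
  interpret A: submodule_quotient M N by (rule submodule_quotient.intro[OF M N])
  let ?R = "ring_as_module (class_ring :: 'a ring)"
  interpret B: submodule_quotient ?R Q by (rule submodule_quotient.intro[OF module_ring_as_module ideal_submod_ring_as_module[OF Q]])
  let ?A = "quotient_module M N" let ?B = "quotient_module ?R Q"
  have R: "carrier ?R = UNIV" "add ?R = (+)" "smult ?R = (*)" "zero ?R = 0" by (simp_all add: ring_as_module_def)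
  note Bfacts = B.coset_eq_iff[unfolded R, OF UNIV_I UNIV_I] B.coset_eq_N_iff[unfolded R, OF UNIV_I]
    B.smult_quotient[unfolded R, OF UNIV_I] B.add_quotient[unfolded R, OF UNIV_I UNIV_I] B.carrier_quotient[unfolded R]
  have sc: "s \<odot> y \<in> carrier M" if "y \<in> carrier M" for s y using A.M.smult_closed[of s y] that by simp
  show ?thesis
  proof
    assume "module_isomorphic class_ring ?A ?B"
    then obtain h where h: "h \<in> LinearCombinations.module_hom class_ring ?A ?B" and bij: "bij_betw h (carrier ?A) (carrier ?B)"
      unfolding module_isomorphic_def by blast
    have hsm: "h (r \<odot>\<^bsub>?A\<^esub> X) = r \<odot>\<^bsub>?B\<^esub> h X" if "X \<in> carrier ?A" for r X
      using h that unfolding module_hom_def by simp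
    have inj: "X = Y" if "X \<in> carrier ?A" "Y \<in> carrier ?A" "h X = h Y" for X Y
      using bij that unfolding bij_betw_def inj_on_def by blast
    have "Q +>\<^bsub>?R\<^esub> 1 \<in> carrier ?B" unfolding Bfacts by blast
    then obtain X where X: "X \<in> carrier ?A" "h X = Q +>\<^bsub>?R\<^esub> 1"
      using bij unfolding bij_betw_def by (metis imageE)
    obtain x where x: "x \<in> carrier M" "X = N +> x" using X(1) unfolding A.carrier_quotient by blast
    have inA: "N +> y \<in> carrier ?A" if "y \<in> carrier M" for y unfolding A.carrier_quotient using that by blast
    have hrx: "h (N +> (r \<odot> x)) = Q +>\<^bsub>?R\<^esub> r" for r
      using hsm[OF X(1), of r] X(2) unfolding x(2) A.smult_quotient[OF x(1)] by (simp add: Bfacts(3))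
    have "0 \<odot> x = \<zero>" using A.M.smult_l_null[OF x(1)] by simp
    then have hN: "h N = Q" using hrx[of 0] B.coset_zero A.coset_zero by (simp add: R)
    have "\<exists>n\<in>N. \<exists>r. y = n \<oplus> r \<odot> x" if y: "y \<in> carrier M" for y
    proof -
      have "h (N +> y) \<in> carrier ?B" using bij inA[OF y] unfolding bij_betw_def by blast
      then obtain r where "h (N +> y) = Q +>\<^bsub>?R\<^esub> r" unfolding Bfacts by blast
      then have "N +> y = N +> (r \<odot> x)" using hrx inj inA y sc[OF x(1)] by simp
      then show ?thesis using A.coset_eq_iff[OF y sc[OF x(1)]] by blast
    qed
    moreover have "r \<odot> x \<in> N \<longleftrightarrow> r \<in> Q" for r
    proof -
      have NA: "N \<in> carrier ?A" using inA[of "\<zero>"] A.coset_zero by simp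
      have "r \<odot> x \<in> N \<longleftrightarrow> N +> (r \<odot> x) = N" using A.coset_eq_N_iff[OF sc[OF x(1)]] by simp
      also have "\<dots> \<longleftrightarrow> h (N +> (r \<odot> x)) = h N" using inj[OF inA[OF sc[OF x(1)]] NA] by auto
      also have "\<dots> \<longleftrightarrow> Q +>\<^bsub>?R\<^esub> r = Q" unfolding hrx hN ..
      also have "\<dots> \<longleftrightarrow> r \<in> Q" by (rule Bfacts(2))
      finally show ?thesis .
    qed
    ultimately show "\<exists>x\<in>carrier M. (\<forall>y\<in>carrier M. \<exists>n\<in>N. \<exists>r. y = n \<oplus> r \<odot> x) \<and> (\<forall>r. r \<odot> x \<in> N \<longleftrightarrow> r \<in> Q)"
      using x(1) by blast
  next
    assume "\<exists>x\<in>carrier M. (\<forall>y\<in>carrier M. \<exists>n\<in>N. \<exists>r. y = n \<oplus> r \<odot> x) \<and> (\<forall>r. r \<odot> x \<in> N \<longleftrightarrow> r \<in> Q)"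
    then obtain x where x: "x \<in> carrier M" and gen: "\<And>y. y \<in> carrier M \<Longrightarrow> \<exists>n\<in>N. \<exists>r. y = n \<oplus> r \<odot> x"
      and ann: "\<And>r. r \<odot> x \<in> N \<longleftrightarrow> r \<in> Q" by blast
    have sx: "s \<odot> x \<in> carrier M" for s by (rule sc[OF x])
    \<comment> \<open>The inverse of \<open>r \<mapsto> r x\<close>, written so that no representative of the coset has to be chosen.\<close>
    define h where "h Y = {r. r \<odot> x \<in> Y}" for Y
    have carrier_A: "\<exists>s. Y = N +> (s \<odot> x)" if Y: "Y \<in> carrier ?A" for Y
    proof -
      obtain y where y: "y \<in> carrier M" "Y = N +> y" using Y unfolding A.carrier_quotient by blast
      obtain n r where "n \<in> N" "y = n \<oplus> r \<odot> x" using gen[OF y(1)] by blast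
      then have "N +> y = N +> (r \<odot> x)" using A.coset_eq_iff[OF y(1) sx] by blast
      then show ?thesis using y(2) by blast
    qed
    have diff: "(\<exists>n\<in>N. r \<odot> x = n \<oplus> s \<odot> x) \<longleftrightarrow> r - s \<in> Q" for r s
    proof -
      have eq: "r \<odot> x = (r - s) \<odot> x \<oplus> s \<odot> x"
        using A.M.smult_l_distr[of "r - s" s x] x by simp
      show ?thesis
      proof
        assume "\<exists>n\<in>N. r \<odot> x = n \<oplus> s \<odot> x"
        then obtain n where n: "n \<in> N" "r \<odot> x = n \<oplus> s \<odot> x" by blast
        have "n \<in> carrier M" using n(1) A.N_facts(1) by blast
        then have "n = (r - s) \<odot> x" using n(2) eq sx A.M.add.right_cancel[of "s \<odot> x" n "(r - s) \<odot> x"] by simp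
        then show "r - s \<in> Q" using ann n(1) by blast
      next
        assume "r - s \<in> Q"
        then show "\<exists>n\<in>N. r \<odot> x = n \<oplus> s \<odot> x" using ann eq by blast
      qed
    qed
    have h: "h (N +> (s \<odot> x)) = Q +>\<^bsub>?R\<^esub> s" for s
    proof (rule Set.set_eqI)
      fix r
      have "r \<in> h (N +> (s \<odot> x)) \<longleftrightarrow> r - s \<in> Q"
        unfolding h_def using diff A.in_coset_iff[OF sx] by simp
      also have "\<dots> \<longleftrightarrow> r \<in> Q +>\<^bsub>?R\<^esub> s"
        unfolding a_r_coset_def' by (force simp: R)
      finally show "r \<in> h (N +> (s \<odot> x)) \<longleftrightarrow> r \<in> Q +>\<^bsub>?R\<^esub> s" .
    qed
    have inA: "N +> (s \<odot> x) \<in> carrier ?A" for s unfolding A.carrier_quotient using sx by blast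
    have "h \<in> LinearCombinations.module_hom class_ring ?A ?B"
      unfolding module_hom_def
    proof (intro CollectI conjI allI impI funcsetI)
      show "h Y \<in> carrier ?B" if Y: "Y \<in> carrier ?A" for Y
      proof -
        obtain s where "Y = N +> (s \<odot> x)" using carrier_A[OF Y] by blast
        then show ?thesis unfolding Bfacts(5) by (simp add: h)
      qed
      show "h (Y \<oplus>\<^bsub>?A\<^esub> Z) = h Y \<oplus>\<^bsub>?B\<^esub> h Z" if YZ: "Y \<in> carrier ?A \<and> Z \<in> carrier ?A" for Y Z
      proof -
        obtain s t where "Y = N +> (s \<odot> x)" "Z = N +> (t \<odot> x)" using carrier_A YZ by blast
        moreover have "s \<odot> x \<oplus> t \<odot> x = (s + t) \<odot> x" using A.M.smult_l_distr[of s t x] x by simp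
        ultimately show ?thesis by (simp add: A.add_quotient[OF sx sx] h Bfacts(4))
      qed
      show "h (r \<odot>\<^bsub>?A\<^esub> Y) = r \<odot>\<^bsub>?B\<^esub> h Y" if rY: "r \<in> carrier class_ring \<and> Y \<in> carrier ?A" for r Y
      proof -
        obtain s where "Y = N +> (s \<odot> x)" using carrier_A rY by blast
        moreover have "r \<odot> (s \<odot> x) = (r * s) \<odot> x" using A.M.smult_assoc1[of r s x] x by simp
        ultimately show ?thesis by (simp add: A.smult_quotient[OF sx] h Bfacts(3))
      qed
    qed
    moreover have "bij_betw h (carrier ?A) (carrier ?B)"
      unfolding bij_betw_def
    proof
      show "inj_on h (carrier ?A)"
      proof (rule inj_onI)
        fix Y Z assume YZ: "Y \<in> carrier ?A" "Z \<in> carrier ?A" "h Y = h Z"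
        obtain s where s: "Y = N +> (s \<odot> x)" using carrier_A[OF YZ(1)] by blast
        obtain t where t: "Z = N +> (t \<odot> x)" using carrier_A[OF YZ(2)] by blast
        have "\<exists>n\<in>Q. s = n + t" using YZ(3) unfolding s t h Bfacts(1) .
        then have "s - t \<in> Q" by auto
        then show "Y = Z" unfolding s t A.coset_eq_iff[OF sx sx] diff .
      qed
      show "h ` carrier ?A = carrier ?B"
      proof
        show "h ` carrier ?A \<subseteq> carrier ?B" using module_hom_closed[OF calculation] by blast
        show "carrier ?B \<subseteq> h ` carrier ?A"
        proof
          fix Y assume "Y \<in> carrier ?B"
          then obtain s where "Y = Q +>\<^bsub>?R\<^esub> s" unfolding Bfacts(5) by blast
          then show "Y \<in> h ` carrier ?A" using inA[of s] h[of s] by (metis imageI)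
        qed
      qed
    qed
    ultimately show "module_isomorphic class_ring ?A ?B" unfolding module_isomorphic_def by blast
  qed
qed

section \<open>Existence of prime filtrations\<close>

lemma ideal_class_ring_iff: "ideal I (class_ring :: 'a::comm_ring_1 ring) \<longleftrightarrow> is_ideal_of UNIV I"
proof
  assume "ideal I (class_ring :: 'a ring)"
  then interpret ideal I "class_ring :: 'a ring" .
  show "is_ideal_of UNIV I"
    unfolding is_ideal_of_def using zero_closed a_closed I_l_closed by auto
next
  assume I: "is_ideal_of UNIV I"
  show "ideal I (class_ring :: 'a ring)"
  proof (rule idealI)
    show "ring (class_ring :: 'a ring)" by (rule class_ring.ring_axioms)
    have inv: "m_inv (add_monoid (class_ring :: 'a ring)) x = - x" for x
    proof -
      have "m_inv (add_monoid (class_ring :: 'a ring)) x = a_inv class_ring x" by (simp add: a_inv_def)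
      also have "\<dots> = - x" by (simp only: class_ring_simps)
      finally show ?thesis .
    qed
    have minus: "- x \<in> I" if "x \<in> I" for x using is_ideal_ofD(4)[OF I UNIV_I that, of "- 1"] by simp
    show "subgroup I (add_monoid (class_ring :: 'a ring))"
    proof (rule subgroup.intro)
      show "m_inv (add_monoid (class_ring :: 'a ring)) x \<in> I" if "x \<in> I" for x
        unfolding inv by (rule minus[OF that])
    qed (simp_all add: is_ideal_ofD(2,3)[OF I])
    fix a x assume a: "a \<in> I"
    show "x \<otimes>\<^bsub>class_ring\<^esub> a \<in> I" "a \<otimes>\<^bsub>class_ring\<^esub> x \<in> I"
      using is_ideal_ofD(4)[OF I UNIV_I a, of x] by (simp_all add: mult.commute)
  qed
qed

lemma primeideal_class_ring_iff:
  "primeideal I (class_ring :: 'a::comm_ring_1 ring) \<longleftrightarrow>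
     is_ideal_of UNIV I \<and> 1 \<notin> I \<and> (\<forall>a b. a * b \<in> I \<longrightarrow> a \<in> I \<or> b \<in> I)"
proof
  assume "primeideal I (class_ring :: 'a ring)"
  then interpret primeideal I "class_ring :: 'a ring" .
  have "1 \<notin> I" using one_imp_carrier I_notcarr by auto
  then show "is_ideal_of UNIV I \<and> 1 \<notin> I \<and> (\<forall>a b. a * b \<in> I \<longrightarrow> a \<in> I \<or> b \<in> I)"
    using I_prime ideal_class_ring_iff is_ideal by auto
next
  assume "is_ideal_of UNIV I \<and> 1 \<notin> I \<and> (\<forall>a b. a * b \<in> I \<longrightarrow> a \<in> I \<or> b \<in> I)"
  then show "primeideal I (class_ring :: 'a ring)"
    using class_cring.is_cring by (intro primeidealI) (auto simp: ideal_class_ring_iff)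
qed

lemma is_ideal_of_colon:
  fixes M :: "('a::comm_ring_1, 'b, 'x) module_scheme" (structure)
  assumes M: "Module.module class_ring M" and N: "submod N M" and x: "x \<in> carrier M"
  shows "is_ideal_of UNIV {r. r \<odot> x \<in> N}"
proof -
  interpret M: Module.module class_ring M by (rule M)
  note Nf = N[unfolded submod_iff[OF M]]
  have "0 \<odot> x = \<zero>" using M.smult_l_null[OF x] by simp
  moreover have "(a + b) \<odot> x = a \<odot> x \<oplus> b \<odot> x" for a b using M.smult_l_distr[of a b x] x by simp
  moreover have "(a * b) \<odot> x = a \<odot> (b \<odot> x)" for a b using M.smult_assoc1[of a b x] x by simp
  ultimately show ?thesis using Nf unfolding is_ideal_of_def by simp
qed

text \<open>
  A nonzero module has an associated prime, applied to \<open>M/N\<close>: a maximal annihilator of a nonzero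
  element is prime.
\<close>

lemma ex_prime_colon:
  fixes M :: "('a::comm_ring_1, 'b, 'x) module_scheme" (structure)
  assumes M: "Module.module class_ring M" and noeth: "noetherian_subring (UNIV :: 'a set)"
    and N: "submod N M" and ne: "N \<noteq> carrier M"
  obtains x where "x \<in> carrier M" "x \<notin> N" "primeideal {r. r \<odot> x \<in> N} class_ring"
proof -
  interpret M: Module.module class_ring M by (rule M)
  let ?ann = "\<lambda>x. {r. r \<odot> x \<in> N}"
  let ?X = "?ann ` (carrier M - N)"
  note Nf = N[unfolded submod_iff[OF M]]
  have ex: "?X \<noteq> {}" using ne Nf by blast
  have sub: "?X \<subseteq> {I. is_ideal_of UNIV I}" using is_ideal_of_colon[OF M N] by blast
  obtain P where P: "P \<in> ?X" and max: "\<And>Y. Y \<in> ?X \<Longrightarrow> P \<subseteq> Y \<Longrightarrow> Y = P"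
    by (rule ascending_chains_stop_maximal[OF noeth[unfolded noetherian_subring_def] sub ex], rule that)
  obtain x where x: "x \<in> carrier M" "x \<notin> N" "P = ?ann x" using P by blast
  have assoc: "(a * b) \<odot> x = a \<odot> (b \<odot> x)" for a b using M.smult_assoc1[of a b x] x(1) by simp
  have sx: "a \<odot> x \<in> carrier M" for a using M.smult_closed[of a x] x(1) by simp
  have "b \<in> ?ann x" if ab: "a * b \<in> ?ann x" and a: "a \<notin> ?ann x" for a b
  proof -
    have "?ann (a \<odot> x) \<in> ?X" using a sx by blast
    moreover have "P \<subseteq> ?ann (a \<odot> x)"
    proof
      fix r assume "r \<in> P"
      then have "a \<odot> (r \<odot> x) \<in> N" using x(3) Nf by simp
      then show "r \<in> ?ann (a \<odot> x)" using assoc[of a r] assoc[of r a] by (simp add: mult.commute)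
    qed
    ultimately have "?ann (a \<odot> x) = P" by (rule max)
    moreover have "b \<in> ?ann (a \<odot> x)" using ab assoc[of b a] by (simp add: mult.commute)
    ultimately show ?thesis using x(3) by blast
  qed
  moreover have "1 \<notin> ?ann x" using M.smult_one[OF x(1)] x(2) by simp
  ultimately have "primeideal (?ann x) class_ring"
    unfolding primeideal_class_ring_iff using is_ideal_of_colon[OF M N x(1)] by blast
  then show thesis using that x by blast
qed

text \<open>
  A maximal member among the annihilators contained in \<open>Q\<close> is prime. If \<open>a b\<close> kills \<open>y\<close> and the
  annihilator of \<open>a y\<close> is not below \<open>Q\<close>, some \<open>s\<close> outside \<open>Q\<close> kills \<open>a y\<close>; but multiplying by \<open>s\<close>
  does not change the annihilator of \<open>y\<close>.
\<close>

lemma ex_associated_prime_below: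
  fixes M :: "('a::comm_ring_1, 'b, 'x) module_scheme" (structure)
  assumes M: "Module.module class_ring M" and noeth: "noetherian_subring (UNIV :: 'a set)"
    and Q: "primeideal Q (class_ring :: 'a ring)" and x: "x \<in> carrier M" "{r. r \<odot> x = \<zero>} \<subseteq> Q"
  shows "\<exists>P \<in> associated_primes class_ring M. P \<subseteq> Q"
proof -
  interpret M: Module.module class_ring M by (rule M)
  have zero: "submod {\<zero>} M" unfolding submod_iff[OF M] using M.smult_r_null by auto
  let ?ann = "\<lambda>x. {r. r \<odot> x = \<zero>}"
  let ?X = "?ann ` {y \<in> carrier M. ?ann y \<subseteq> Q}"
  have ideal: "is_ideal_of UNIV (?ann y)" if "y \<in> carrier M" for y
    using is_ideal_of_colon[OF M zero that] by simp
  have ex: "?X \<noteq> {}" using x by blast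
  have subI: "?X \<subseteq> {I. is_ideal_of UNIV I}" using ideal by blast
  obtain P where P: "P \<in> ?X" and max: "\<And>Y. Y \<in> ?X \<Longrightarrow> P \<subseteq> Y \<Longrightarrow> Y = P"
    by (rule ascending_chains_stop_maximal[OF noeth[unfolded noetherian_subring_def] subI ex], rule that)
  obtain y where y: "y \<in> carrier M" "?ann y \<subseteq> Q" "P = ?ann y" using P by blast
  have Qf: "1 \<notin> Q" "\<And>a b. a * b \<in> Q \<Longrightarrow> a \<in> Q \<or> b \<in> Q" using Q unfolding primeideal_class_ring_iff by blast+
  have assoc: "(a * b) \<odot> y = a \<odot> (b \<odot> y)" for a b using M.smult_assoc1[of a b y] y(1) by simp
  have sy: "a \<odot> y \<in> carrier M" for a using M.smult_closed[of a y] y(1) by simp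
  have null: "a \<odot> \<zero> = \<zero>" for a using M.smult_r_null[of a] by simp
  have sub: "P \<subseteq> ?ann (a \<odot> y)" for a
  proof
    fix r assume "r \<in> P"
    then have "a \<odot> (r \<odot> y) = \<zero>" using y(3) null by simp
    then show "r \<in> ?ann (a \<odot> y)" using assoc[of a r] assoc[of r a] by (simp add: mult.commute)
  qed
  \<comment> \<open>Scalars outside \<open>Q\<close> leave the annihilator below \<open>Q\<close>, hence, by maximality, unchanged.\<close>
  have outside: "?ann (s \<odot> y) = P" if s: "s \<notin> Q" for s
  proof -
    have "r \<in> Q" if "r \<in> ?ann (s \<odot> y)" for r
    proof -
      have "r * s \<in> ?ann y" using that assoc[of r s] by simp
      then have "r * s \<in> Q" using y(2) by blast
      then show ?thesis using Qf(2) s by blast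
    qed
    then have "?ann (s \<odot> y) \<in> ?X" using sy by blast
    then show ?thesis using sub by (intro max)
  qed
  have "b \<in> P" if ab: "a * b \<in> P" and a: "a \<notin> P" for a b
  proof -
    have b_in: "b \<in> ?ann (a \<odot> y)" using ab y(3) assoc[of b a] by (simp add: mult.commute)
    show ?thesis
    proof (cases "?ann (a \<odot> y) \<subseteq> Q")
      case True
      then have "?ann (a \<odot> y) \<in> ?X" using sy by blast
      then have "?ann (a \<odot> y) = P" using sub by (intro max)
      then show ?thesis using b_in by blast
    next
      case False
      then obtain s where s: "s \<notin> Q" "s \<odot> (a \<odot> y) = \<zero>" by blast
      then have "a \<in> ?ann (s \<odot> y)" using assoc[of s a] assoc[of a s] by (simp add: mult.commute)
      then have "a \<in> P" using outside[OF s(1)] by blast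
      then show ?thesis using a by blast
    qed
  qed
  moreover have "1 \<notin> P" using Qf(1) y(2,3) by blast
  ultimately have "primeideal P class_ring"
    unfolding primeideal_class_ring_iff using ideal[OF y(1)] y(3) by blast
  then have "P \<in> associated_primes class_ring M"
    unfolding associated_primes_def using y(1,3) by (intro CollectI conjI bexI[of _ y]) auto
  then show ?thesis using y(2,3) by blast
qed

lemma restrict_submod:
  fixes M :: "('a::comm_ring_1, 'b, 'x) module_scheme" (structure)
  assumes M: "Module.module class_ring M" and N: "submod N M" and H: "submod H M" and sub: "N \<subseteq> H"
  shows "Module.module class_ring (M\<lparr>carrier := H\<rparr>)" "submod N (M\<lparr>carrier := H\<rparr>)"
proof -
  show *: "Module.module class_ring (M\<lparr>carrier := H\<rparr>)" by (rule Module.submodule.submodule_is_module[OF H M])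
  show "submod N (M\<lparr>carrier := H\<rparr>)"
    using N sub unfolding submod_iff[OF *] submod_iff[OF M] by simp
qed

lemma filtration_step_iff:
  fixes M :: "('a::comm_ring_1, 'b, 'x) module_scheme" (structure)
  assumes M: "Module.module class_ring M" and N: "submod N M" and H: "submod H M" and sub: "N \<subseteq> H"
    and Q: "primeideal Q (class_ring :: 'a ring)"
  shows "module_isomorphic class_ring (quotient_module (M\<lparr>carrier := H\<rparr>) N)
           (quotient_module (ring_as_module (class_ring :: 'a ring)) Q)
    \<longleftrightarrow> (\<exists>x\<in>H. (\<forall>y\<in>H. \<exists>n\<in>N. \<exists>r. y = n \<oplus> r \<odot> x) \<and> (\<forall>r. r \<odot> x \<in> N \<longleftrightarrow> r \<in> Q))"
  using module_isomorphic_cyclic_iff[OF restrict_submod[OF M N H sub] primeideal.axioms(1)[OF Q]] by simp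

lemma submod_add_generator:
  fixes M :: "('a::comm_ring_1, 'b, 'x) module_scheme" (structure)
  assumes M: "Module.module class_ring M" and N: "submod N M" and x: "x \<in> carrier M"
  defines "H \<equiv> {n \<oplus> r \<odot> x | n r. n \<in> N}"
  shows "submod H M" "N \<subseteq> H" "x \<in> H"
proof -
  interpret M: Module.module class_ring M by (rule M)
  note Nf = N[unfolded submod_iff[OF M]]
  have sc: "a \<odot> y \<in> carrier M" if "y \<in> carrier M" for a y using M.smult_closed[of a y] that by simp
  have Nc: "n \<in> carrier M" if "n \<in> N" for n using that Nf by blast
  have zero: "0 \<odot> x = \<zero>" using M.smult_l_null[OF x] by simp
  have one: "1 \<odot> x = x" using M.smult_one[OF x] by simp
  show sub: "N \<subseteq> H"
  proof
    fix n assume n: "n \<in> N"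
    then have "n = n \<oplus> 0 \<odot> x" using zero Nc by simp
    then show "n \<in> H" unfolding H_def using n by blast
  qed
  have "x = \<zero> \<oplus> 1 \<odot> x" using one x by simp
  then show "x \<in> H" unfolding H_def using Nf by blast
  show "submod H M"
    unfolding submod_iff[OF M]
  proof (intro conjI ballI allI)
    show "H \<subseteq> carrier M" unfolding H_def using Nc sc[OF x] by auto
    show "\<zero> \<in> H" using sub Nf by blast
    fix y assume "y \<in> H"
    then obtain n r where y: "n \<in> N" "y = n \<oplus> r \<odot> x" unfolding H_def by blast
    show "s \<odot> y \<in> H" for s
    proof -
      have "s \<odot> y = s \<odot> n \<oplus> (s * r) \<odot> x"
        using M.smult_r_distr[of s n "r \<odot> x"] M.smult_assoc1[of s r x] y x Nc sc by simp
      moreover have "s \<odot> n \<in> N" using Nf y(1) by blast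
      ultimately show ?thesis unfolding H_def by blast
    qed
    fix z assume "z \<in> H"
    then obtain m s where z: "m \<in> N" "z = m \<oplus> s \<odot> x" unfolding H_def by blast
    have "y \<oplus> z = (n \<oplus> m) \<oplus> (r \<odot> x \<oplus> s \<odot> x)"
      using y z Nc sc[OF x] by (simp add: M.a_ac)
    also have "r \<odot> x \<oplus> s \<odot> x = (r + s) \<odot> x" using M.smult_l_distr[of r s x] x by simp
    finally have "y \<oplus> z = (n \<oplus> m) \<oplus> (r + s) \<odot> x" .
    moreover have "n \<oplus> m \<in> N" using Nf y(1) z(1) by blast
    ultimately show "y \<oplus> z \<in> H" unfolding H_def by blast
  qed
qed

text \<open>
  A maximal submodule among those with a prime filtration is the whole module, since otherwise
  \<open>ex_prime_colon\<close> yields one more step, whose prime contains an associated prime of \<open>M\<close> by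
  \<open>ex_associated_prime_below\<close>.
\<close>

lemma prime_filtration_exists:
  fixes M :: "('a::comm_ring_1, 'b, 'x) module_scheme" (structure)
  assumes M: "Module.module class_ring M" and noeth: "noetherian_subring (UNIV :: 'a set)"
    and acc: "ascending_chains_stop {N. submod N M}"
  shows "\<exists>l N Q. prime_filtration class_ring M l N Q"
proof -
  interpret M: Module.module class_ring M by (rule M)
  have zero: "submod {\<zero>} M" unfolding submod_iff[OF M] using M.smult_r_null by auto
  let ?step = "\<lambda>N Q j. N (j - 1) \<subset> N j \<and> primeideal (Q j) class_ring \<and> (\<exists>P \<in> associated_primes class_ring M. P \<subseteq> Q j) \<and>
        module_isomorphic class_ring (quotient_module (M\<lparr>carrier := N j\<rparr>) (N (j - 1)))
          (quotient_module (ring_as_module (class_ring :: 'a ring)) (Q j))"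
  define fil where "fil H l N Q \<longleftrightarrow> N 0 = {\<zero>} \<and> N l = H \<and> (\<forall>j\<le>l. submod (N j) M) \<and> (\<forall>j\<in>{1..l}. ?step N Q j)"
    for H :: "'b set" and l :: nat and N :: "nat \<Rightarrow> 'b set" and Q :: "nat \<Rightarrow> 'a set"
  let ?X = "{H. \<exists>l N Q. fil H l N Q}"
  have "fil {\<zero>} 0 (\<lambda>_. {\<zero>}) (\<lambda>_. {})" unfolding fil_def using zero by simp
  then have ne: "?X \<noteq> {}" by blast
  have sub: "?X \<subseteq> {N. submod N M}" unfolding fil_def by auto
  obtain H where H: "H \<in> ?X" and max: "\<And>Y. Y \<in> ?X \<Longrightarrow> H \<subseteq> Y \<Longrightarrow> Y = H"
    by (rule ascending_chains_stop_maximal[OF acc sub ne], rule that)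
  obtain l N Q where fil: "fil H l N Q" using H by blast
  have Hs: "submod H M" using H sub by blast
  have "H = carrier M"
  proof (rule ccontr)
    assume ne: "H \<noteq> carrier M"
    obtain x where x: "x \<in> carrier M" "x \<notin> H" "primeideal {r. r \<odot> x \<in> H} class_ring"
      by (rule ex_prime_colon[OF M noeth Hs ne])
    let ?q = "{r. r \<odot> x \<in> H}"
    define H' where "H' = {n \<oplus> r \<odot> x | n r. n \<in> H}"
    note H' = submod_add_generator[OF M Hs x(1), folded H'_def]
    have "\<zero> \<in> H" using Hs unfolding submod_iff[OF M] by blast
    then have "{r. r \<odot> x = \<zero>} \<subseteq> ?q" by auto
    then have ass: "\<exists>P \<in> associated_primes class_ring M. P \<subseteq> ?q"
      by (rule ex_associated_prime_below[OF M noeth x(3,1)])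
    have "\<forall>y\<in>H'. \<exists>n\<in>H. \<exists>r. y = n \<oplus> r \<odot> x" unfolding H'_def by blast
    then have iso: "module_isomorphic class_ring (quotient_module (M\<lparr>carrier := H'\<rparr>) H)
        (quotient_module (ring_as_module (class_ring :: 'a ring)) ?q)"
      unfolding filtration_step_iff[OF M Hs H'(1,2) x(3)] using H'(3) by (intro bexI[of _ x] conjI) simp_all
    let ?N = "N(Suc l := H')" let ?Q = "Q(Suc l := ?q)"
    have Nl: "N l = H" using fil unfolding fil_def by blast
    have "fil H' (Suc l) ?N ?Q"
      unfolding fil_def
    proof (intro conjI ballI allI impI)
      show "?N 0 = {\<zero>}" "?N (Suc l) = H'" using fil unfolding fil_def by simp_all
      show "submod (?N j) M" if "j \<le> Suc l" for j using fil that H'(1) unfolding fil_def by (cases "j = Suc l") simp_all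
      fix j assume j: "j \<in> {1..Suc l}"
      have "?step ?N ?Q j"
      proof (cases "j = Suc l")
        case True
        then show ?thesis using H'(2,3) x(2,3) ass iso Nl by auto
      next
        case False
        then have jl: "j \<in> {1..l}" "j \<noteq> Suc l" "j - 1 \<noteq> Suc l" using j by auto
        have "?step N Q j" using fil jl(1) unfolding fil_def by blast
        then show ?thesis using jl by simp
      qed
      then show "?N (j - 1) \<subset> ?N j" "primeideal (?Q j) class_ring" "\<exists>P \<in> associated_primes class_ring M. P \<subseteq> ?Q j"
        "module_isomorphic class_ring (quotient_module (M\<lparr>carrier := ?N j\<rparr>) (?N (j - 1)))
          (quotient_module (ring_as_module (class_ring :: 'a ring)) (?Q j))"
        by blast+
    qed
    then have "H' = H" using H'(2) by (intro max) blast
    then show False using H'(3) x(2) by blast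
  qed
  then have "prime_filtration class_ring M l N Q"
    using fil unfolding prime_filtration_def fil_def by simp
  then show ?thesis by blast
qed

section \<open>Submodules of the free module\<close>

no_notation fps_nth (infixl "$" 75)

lemma module_module_vec: "Module.module (class_ring :: 'a::comm_ring_1 ring) (module_vec TYPE('a) k)"
proof (rule moduleI)
  show "cring (class_ring :: 'a ring)" by (rule class_cring.is_cring)
  show "abelian_group (module_vec TYPE('a) k)"
  proof (rule abelian_groupI)
    fix x assume x: "x \<in> carrier (module_vec TYPE('a) k)"
    show "\<exists>y\<in>carrier (module_vec TYPE('a) k). y \<oplus>\<^bsub>module_vec TYPE('a) k\<^esub> x = \<zero>\<^bsub>module_vec TYPE('a) k\<^esub>"
      using x by (intro bexI[of _ "- x"]) (auto simp: module_vec_simps)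
  qed (auto simp: module_vec_simps assoc_add_vec[of _ k] comm_add_vec[of _ k])
qed (auto simp: module_vec_simps add_smult_distrib_vec smult_add_distrib_vec[of _ k] smult_smult_assoc)

lemma submod_module_vec_iff:
  fixes N :: "'a::comm_ring_1 vec set"
  shows "submod N (module_vec TYPE('a) k) \<longleftrightarrow> vec_submodule k N"
  unfolding submod_iff[OF module_module_vec] vec_submodule_def module_vec_simps ..

text \<open>
  A submodule of \<open>R\<^sup>k\<close> is determined, among the submodules containing it, by the \<open>k\<close> ideals
  \<open>L N j\<close> of \<open>j\<close>-th entries of its vectors whose first \<open>j\<close> entries vanish.
\<close>

lemma ascending_chains_stop_vec_submodules:
  assumes noeth: "noetherian_subring (UNIV :: 'a::comm_ring_1 set)"
  shows "ascending_chains_stop {N :: 'a vec set. vec_submodule k N}"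
proof -
  define L where "L N j = {x $ j | x. x \<in> N \<and> (\<forall>i<j. x $ i = 0)}" for N :: "'a vec set" and j
  have ideal: "is_ideal_of UNIV (L N j)" if N: "vec_submodule k N" and j: "j < k" for N j
    unfolding is_ideal_of_def
  proof (intro conjI ballI subset_UNIV)
    note ND = vec_submoduleD[OF N]
    show "0 \<in> L N j" unfolding L_def using ND(2) j by (intro CollectI exI[of _ "0\<^sub>v k"]) auto
    fix a assume "a \<in> L N j"
    then obtain x where x: "x \<in> N" "\<forall>i<j. x $ i = 0" "a = x $ j" unfolding L_def by blast
    have xc: "x \<in> carrier_vec k" by (rule ND(1)[OF x(1)])
    show "b * a \<in> L N j" for b
      unfolding L_def using x xc j ND(4)[OF x(1), of b] by (intro CollectI exI[of _ "b \<cdot>\<^sub>v x"]) auto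
    fix b assume "b \<in> L N j"
    then obtain y where y: "y \<in> N" "\<forall>i<j. y $ i = 0" "b = y $ j" unfolding L_def by blast
    have yc: "y \<in> carrier_vec k" by (rule ND(1)[OF y(1)])
    show "a + b \<in> L N j"
      unfolding L_def using x y xc yc j ND(3)[OF x(1) y(1)] by (intro CollectI exI[of _ "x + y"]) auto
  qed
  have L_inj: "N' \<subseteq> N" if N: "vec_submodule k N" and N': "vec_submodule k N'" and sub: "N \<subseteq> N'"
    and eq: "\<And>j. j < k \<Longrightarrow> L N' j = L N j" for N N'
  proof -
    note ND = vec_submoduleD[OF N] and ND' = vec_submoduleD[OF N']
    have "x \<in> N" if "j \<le> k" "x \<in> N'" "\<forall>i<j. x $ i = 0" for j x
      using that
    proof (induction arbitrary: x rule: inc_induct)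
      case base
      have "x = 0\<^sub>v k" using base ND'(1)[of x] by (intro eq_vecI) auto
      then show ?case using ND(2) by simp
    next
      case (step j)
      have "x $ j \<in> L N' j" unfolding L_def using step.prems by blast
      then have "x $ j \<in> L N j" using eq[OF step.hyps(2)] by simp
      then obtain y where y: "y \<in> N" "\<forall>i<j. y $ i = 0" "x $ j = y $ j" unfolding L_def by blast
      have xc: "x \<in> carrier_vec k" and yc: "y \<in> carrier_vec k" using ND'(1) ND(1) step.prems(1) y(1) by blast+
      let ?z = "x + (- 1) \<cdot>\<^sub>v y"
      have "(- 1) \<cdot>\<^sub>v y \<in> N'" using ND(4)[OF y(1)] sub by blast
      then have "?z \<in> N'" by (rule ND'(3)[OF step.prems(1)])
      moreover have "\<forall>i<Suc j. ?z $ i = 0"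
        using step.prems(2) y(2,3) xc yc step.hyps(2) by (auto simp: less_Suc_eq)
      ultimately have "?z \<in> N" by (rule step.IH)
      then have "?z + y \<in> N" by (rule ND(3)[OF _ y(1)])
      moreover have "?z + y = x" using xc yc by (intro eq_vecI) auto
      ultimately show ?case by simp
    qed
    note all = this
    show "N' \<subseteq> N" using all[of 0] by blast
  qed
  show ?thesis
    unfolding ascending_chains_stop_def
  proof (intro allI impI, elim conjE)
    fix I :: "nat \<Rightarrow> 'a vec set"
    assume I: "\<forall>n. I n \<in> {N. vec_submodule k N}" and up: "\<forall>n. I n \<subseteq> I (Suc n)"
    have sub: "vec_submodule k (I n)" for n using I by blast
    have mono: "I m \<subseteq> I n" if "m \<le> n" for m n using lift_Suc_mono_le[of I, OF _ that] up by blast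
    have "\<exists>s. j < k \<longrightarrow> (\<forall>n\<ge>s. L (I n) j = L (I s) j)" for j
    proof (cases "j < k")
      case True
      have a: "L (I n) j \<in> {I. is_ideal_of UNIV I}" for n using ideal[OF sub True] by blast
      have b: "L (I n) j \<subseteq> L (I (Suc n)) j" for n using up unfolding L_def by blast
      obtain m where "\<And>n. n \<ge> m \<Longrightarrow> L (I n) j = L (I m) j"
        by (rule ascending_chains_stopD[OF noeth[unfolded noetherian_subring_def], of "\<lambda>n. L (I n) j", OF a b], rule that)
      then show ?thesis by blast
    qed simp
    then have "\<forall>j. \<exists>s. j < k \<longrightarrow> (\<forall>n\<ge>s. L (I n) j = L (I s) j)" ..
    then obtain s where s: "\<forall>j. j < k \<longrightarrow> (\<forall>n\<ge>s j. L (I n) j = L (I (s j)) j)" by (rule choice[THEN exE])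
    define m where "m = (\<Sum>j<k. s j)"
    have "I n = I m" if n: "n \<ge> m" for n
    proof
      show "I m \<subseteq> I n" by (rule mono[OF n])
      show "I n \<subseteq> I m"
      proof (rule L_inj[OF sub sub mono[OF n]])
        fix j assume j: "j < k"
        have sm: "s j \<le> m" unfolding m_def using j by (intro member_le_sum) auto
        have "\<forall>n\<ge>s j. L (I n) j = L (I (s j)) j" using s j by blast
        note * = this[THEN spec, THEN mp]
        show "L (I n) j = L (I m) j" by (rule trans[OF *[OF order_trans[OF sm n]] *[OF sm, symmetric]])
      qed
    qed
    then show "\<exists>m. \<forall>n\<ge>m. I n = I m" by blast
  qed
qed

section \<open>Principal associated primes of the cokernel\<close>

context
  fixes A :: "'a::idom mat" and k n :: nat
  assumes A: "A \<in> carrier_mat k n"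
begin

abbreviation (input) "free \<equiv> module_vec TYPE('a) k"
abbreviation (input) "coker \<equiv> cokernel_module A"
abbreviation (input) "coset \<equiv> \<lambda>x. column_span A +>\<^bsub>free\<^esub> x"

lemma cokernel_eq: "coker = quotient_module free (column_span A)"
  unfolding cokernel_module_def column_span_def using A by simp

interpretation Q: submodule_quotient free "column_span A"
  by (rule submodule_quotient.intro[OF module_module_vec]) (simp add: submod_module_vec_iff vec_submodule_column_span[OF A])

lemma module_cokernel: "Module.module class_ring coker"
  unfolding cokernel_eq by (rule Q.module_quotient)

lemma cokernel_simps:
  "carrier coker = coset ` carrier_vec k" "\<zero>\<^bsub>coker\<^esub> = column_span A"
  "x \<in> carrier_vec k \<Longrightarrow> y \<in> carrier_vec k \<Longrightarrow> coset x \<oplus>\<^bsub>coker\<^esub> coset y = coset (x + y)"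
  "x \<in> carrier_vec k \<Longrightarrow> r \<odot>\<^bsub>coker\<^esub> coset x = coset (r \<cdot>\<^sub>v x)"
  "x \<in> carrier_vec k \<Longrightarrow> coset x = column_span A \<longleftrightarrow> x \<in> column_span A"
  unfolding cokernel_eq
  using Q.carrier_quotient Q.zero_quotient Q.add_quotient Q.smult_quotient Q.coset_eq_N_iff
  by (simp_all add: module_vec_simps)

text \<open>
  Submodules of the cokernel are studied through their preimages in \<open>R\<^sup>k\<close>, where
  determinants make sense.
\<close>

definition preimage :: "'a vec set set \<Rightarrow> 'a vec set" where
  "preimage H = {x \<in> carrier_vec k. coset x \<in> H}"

lemma vec_submodule_preimage:
  assumes "submod H coker"
  shows "vec_submodule k (preimage H)"
proof -
  note H = assms[unfolded submod_iff[OF module_cokernel]]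
  have "coset (0\<^sub>v k) = column_span A"
    using cokernel_simps(5)[of "0\<^sub>v k"] vec_submoduleD(2)[OF vec_submodule_column_span[OF A]] by simp
  then show ?thesis
    using H unfolding vec_submodule_def preimage_def by (auto simp flip: cokernel_simps(3,4) simp: cokernel_simps(2))
qed

lemma preimage_zero: "preimage {\<zero>\<^bsub>coker\<^esub>} = column_span A"
proof (intro equalityI subsetI)
  fix x assume "x \<in> preimage {\<zero>\<^bsub>coker\<^esub>}"
  then have "x \<in> carrier_vec k" "coset x = column_span A" unfolding preimage_def cokernel_simps(2) by simp_all
  then show "x \<in> column_span A" using cokernel_simps(5) by blast
next
  fix x assume x: "x \<in> column_span A"
  have xc: "x \<in> carrier_vec k" by (rule vec_submoduleD(1)[OF vec_submodule_column_span[OF A] x])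
  then have "coset x = column_span A" using x cokernel_simps(5) by blast
  then show "x \<in> preimage {\<zero>\<^bsub>coker\<^esub>}" unfolding preimage_def cokernel_simps(2) using xc by simp
qed

lemma preimage_carrier: "preimage (carrier coker) = carrier_vec k"
  unfolding preimage_def cokernel_simps(1) by blast

lemma ascending_chains_stop_cokernel:
  assumes noeth: "noetherian_subring (UNIV :: 'a set)"
  shows "ascending_chains_stop {H. submod H coker}"
proof (rule ascending_chains_stop_transfer[OF ascending_chains_stop_vec_submodules[OF noeth, of k], of _ preimage])
  fix H assume "H \<in> {H. submod H coker}"
  then have H: "submod H coker" by simp
  then show "preimage H \<in> {N. vec_submodule k N}" by (simp add: vec_submodule_preimage)
  fix H' assume "H' \<in> {H. submod H coker}"
  then have H': "submod H' coker" by simp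
  show "preimage H \<subseteq> preimage H'" if "H \<subseteq> H'" using that unfolding preimage_def by blast
  have img: "K = coset ` preimage K" if "submod K coker" for K
  proof -
    have "K \<subseteq> coset ` carrier_vec k"
      using that unfolding submod_iff[OF module_cokernel] cokernel_simps(1) by blast
    then show ?thesis unfolding preimage_def by blast
  qed
  show "H = H'" if "preimage H = preimage H'" using img[OF H] img[OF H'] unfolding that by simp
qed

lemma associated_primes_cokernel:
  "P \<in> associated_primes class_ring coker \<longleftrightarrow>
     primeideal P class_ring \<and> (\<exists>x\<in>carrier_vec k. P = {r. r \<cdot>\<^sub>v x \<in> column_span A})"
proof -
  have "r \<odot>\<^bsub>coker\<^esub> coset x = \<zero>\<^bsub>coker\<^esub> \<longleftrightarrow> r \<cdot>\<^sub>v x \<in> column_span A" if "x \<in> carrier_vec k" for r x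
    using that by (simp add: cokernel_simps)
  then show ?thesis unfolding associated_primes_def by (auto simp: cokernel_simps(1))
qed

lemma preimage_filtration_step:
  assumes H: "submod H coker" and H': "submod H' coker" and sub: "H \<subseteq> H'"
    and Q: "primeideal P (class_ring :: 'a ring)"
    and iso: "module_isomorphic class_ring (quotient_module (coker\<lparr>carrier := H'\<rparr>) H)
           (quotient_module (ring_as_module (class_ring :: 'a ring)) P)"
  obtains x where "x \<in> preimage H'" "\<And>y. y \<in> preimage H' \<Longrightarrow> \<exists>n\<in>preimage H. \<exists>r. y = n + r \<cdot>\<^sub>v x"
    "\<And>r. r \<cdot>\<^sub>v x \<in> preimage H \<longleftrightarrow> r \<in> P"
proof -
  interpret coker: Module.module class_ring coker by (rule module_cokernel)
  note Hf = H[unfolded submod_iff[OF module_cokernel]] and Hf' = H'[unfolded submod_iff[OF module_cokernel]]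
  obtain X where X: "X \<in> H'" and gen: "\<forall>Y\<in>H'. \<exists>n\<in>H. \<exists>r. Y = n \<oplus>\<^bsub>coker\<^esub> r \<odot>\<^bsub>coker\<^esub> X"
    and ann: "\<forall>r. r \<odot>\<^bsub>coker\<^esub> X \<in> H \<longleftrightarrow> r \<in> P"
    using iso unfolding filtration_step_iff[OF module_cokernel H H' sub Q] by blast
  obtain x where x: "x \<in> carrier_vec k" "X = coset x" using X Hf' unfolding cokernel_simps(1) by blast
  show thesis
  proof (rule that)
    show "x \<in> preimage H'" unfolding preimage_def using x X by simp
    show "r \<cdot>\<^sub>v x \<in> preimage H \<longleftrightarrow> r \<in> P" for r
      using ann x unfolding preimage_def by (simp add: cokernel_simps(4))
    fix y assume "y \<in> preimage H'"
    then have y: "y \<in> carrier_vec k" "coset y \<in> H'" unfolding preimage_def by auto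
    obtain Y r where Y: "Y \<in> H" "coset y = Y \<oplus>\<^bsub>coker\<^esub> r \<odot>\<^bsub>coker\<^esub> X" using gen y(2) by blast
    obtain z where z: "z \<in> carrier_vec k" "Y = coset z" using Y(1) Hf unfolding cokernel_simps(1) by blast
    let ?n = "y + (- r) \<cdot>\<^sub>v x"
    have "coset ?n = coset y \<oplus>\<^bsub>coker\<^esub> coset ((- r) \<cdot>\<^sub>v x)" using y x by (simp add: cokernel_simps(3))
    also have "\<dots> = coset (z + r \<cdot>\<^sub>v x) \<oplus>\<^bsub>coker\<^esub> coset ((- r) \<cdot>\<^sub>v x)"
      unfolding Y(2) z(2) x(2) using x z by (simp add: cokernel_simps(3,4))
    also have "\<dots> = coset (z + r \<cdot>\<^sub>v x + (- r) \<cdot>\<^sub>v x)" using x z by (simp add: cokernel_simps(3))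
    also have "z + r \<cdot>\<^sub>v x + (- r) \<cdot>\<^sub>v x = z" using x z by (intro eq_vecI) auto
    finally have "?n \<in> preimage H" unfolding preimage_def using Y(1) z(2) x y by simp
    moreover have "y = ?n + r \<cdot>\<^sub>v x" using x y by (intro eq_vecI) auto
    ultimately show "\<exists>n\<in>preimage H. \<exists>r. y = n + r \<cdot>\<^sub>v x" by blast
  qed
qed

lemma dvd_gcd_minors_iff:
  assumes g: "is_gcd_of (Idl\<^bsub>class_ring\<^esub> (minors k A)) g"
  shows "c dvd g \<longleftrightarrow> (\<forall>f. (\<forall>i<k. f i \<in> column_span A) \<longrightarrow> c dvd det_rows k f)"
proof -
  let ?J = "Idl\<^bsub>class_ring\<^esub> (minors k A)"
  have "minors k A \<subseteq> ?J" using ring.genideal_self[OF class_ring.ring_axioms, of "minors k A"] by simp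
  have "is_ideal_of UNIV {x. c dvd x}" unfolding is_ideal_of_def by auto
  then have ideal: "ideal {x. c dvd x} (class_ring :: 'a ring)" unfolding ideal_class_ring_iff .
  have "c dvd g \<longleftrightarrow> (\<forall>a\<in>?J. c dvd a)"
  proof
    show "\<forall>a\<in>?J. c dvd a" if "c dvd g"
      using g dvd_trans[OF that] unfolding is_gcd_of_def by blast
    show "c dvd g" if "\<forall>a\<in>?J. c dvd a"
      using g that unfolding is_gcd_of_def by blast
  qed
  also have "\<dots> \<longleftrightarrow> (\<forall>a\<in>minors k A. c dvd a)"
  proof
    assume "\<forall>a\<in>minors k A. c dvd a"
    then have "?J \<subseteq> {x. c dvd x}" using ring.genideal_minimal[OF class_ring.ring_axioms ideal, of "minors k A"] by blast
    then show "\<forall>a\<in>?J. c dvd a" by blast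
  qed (use \<open>minors k A \<subseteq> ?J\<close> in blast)
  also have "\<dots> \<longleftrightarrow> (\<forall>f. (\<forall>i<k. f i \<in> column_span A) \<longrightarrow> c dvd det_rows k f)"
    by (rule dvd_minors_iff_dvd_det_rows[OF A])
  finally show ?thesis .
qed

lemma nonzero_det_smult_in_column_span:
  assumes f: "\<forall>i<k. f i \<in> column_span A" and d: "det_rows k f \<noteq> 0" and x: "x \<in> carrier_vec k"
  shows "det_rows k f \<cdot>\<^sub>v x \<in> column_span A"
  using f by (intro cramer_in_submodule[OF vec_submodule_column_span[OF A] _ x, of f 1] d) auto

text \<open>
  Going down the filtration from \<open>R\<^sup>k\<close>, of order \<open>0\<close>, the order increases by one at each
  factor \<open>R/(p)\<close> and stays the same at every other factor.
\<close>

lemma has_order_filtration: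
  assumes fact: "factorial_subring (UNIV :: 'a set)" and p: "prime_elem p"
    and f: "\<forall>i<k. f i \<in> column_span A" and d: "det_rows k f \<noteq> 0"
    and fil: "prime_filtration class_ring coker l N Q" and j: "j \<le> l"
  shows "has_order k p (preimage (N j)) (card {i\<in>{Suc j..l}. Q i = {x. p dvd x}})"
  using j
proof (induction rule: inc_induct)
  case base
  have "N l = carrier coker" using fil unfolding prime_filtration_def by blast
  then show ?case using has_order_full[OF p] by (simp add: preimage_carrier)
next
  case (step j)
  let ?P = "{x. p dvd x}"
  have sub: "submod (N i) coker" if "i \<le> l" for i using fil that unfolding prime_filtration_def by blast
  have "Suc j \<in> {1..l}" using step.hyps by simp
  then have s: "N j \<subset> N (Suc j)" "primeideal (Q (Suc j)) class_ring"
      "module_isomorphic class_ring (quotient_module (coker\<lparr>carrier := N (Suc j)\<rparr>) (N j))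
        (quotient_module (ring_as_module class_ring) (Q (Suc j)))"
    using fil unfolding prime_filtration_def by (metis diff_Suc_1)+
  have j: "submod (N j) coker" "submod (N (Suc j)) coker" "N j \<subseteq> N (Suc j)" using sub step.hyps s(1) by auto
  obtain x where x: "x \<in> preimage (N (Suc j))" and gen: "\<And>y. y \<in> preimage (N (Suc j)) \<Longrightarrow> \<exists>n\<in>preimage (N j). \<exists>r. y = n + r \<cdot>\<^sub>v x"
    and ann: "\<And>r. r \<cdot>\<^sub>v x \<in> preimage (N j) \<longleftrightarrow> r \<in> Q (Suc j)"
    by (rule preimage_filtration_step[OF j s(2,3)], rule that)
  note N = vec_submodule_preimage[OF j(1)] and N' = vec_submodule_preimage[OF j(2)]
  have mono: "preimage (N j) \<subseteq> preimage (N (Suc j))" using j(3) unfolding preimage_def by blast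
  have xc: "x \<in> carrier_vec k" by (rule vec_submoduleD(1)[OF N' x])
  have set: "{i\<in>{Suc j..l}. Q i = ?P} =
      (if Q (Suc j) = ?P then insert (Suc j) {i\<in>{Suc (Suc j)..l}. Q i = ?P} else {i\<in>{Suc (Suc j)..l}. Q i = ?P})"
  proof -
    have "{Suc j..l} = insert (Suc j) {Suc (Suc j)..l}"
      using atLeastAtMost_insertL[of "Suc j" l] step.hyps by simp
    then show ?thesis by auto
  qed
  show ?case
  proof (cases "\<forall>r\<in>Q (Suc j). p dvd r")
    case True
    have "\<zero>\<^bsub>coker\<^esub> \<in> N j" using j(1) unfolding submod_iff[OF module_cokernel] by blast
    then have "preimage {\<zero>\<^bsub>coker\<^esub>} \<subseteq> preimage (N j)" unfolding preimage_def by (intro subsetI CollectI) simp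
    then have "column_span A \<subseteq> preimage (N j)" unfolding preimage_zero .
    \<comment> \<open>The nonzero determinant annihilates the cokernel, so \<open>Q (Suc j)\<close> is nonzero and must be \<open>(p)\<close>.\<close>
    then have "det_rows k f \<in> Q (Suc j)"
      using ann nonzero_det_smult_in_column_span[OF f d xc] by blast
    then have Q: "Q (Suc j) = ?P" using True by (intro prime_ideal_below_principal[OF fact p s(2) _ d]) auto
    have "has_order k p (preimage (N j)) (Suc (card {i\<in>{Suc (Suc j)..l}. Q i = ?P}))"
      using ann unfolding Q by (intro has_order_step_up[OF p N N' mono x gen _ step.IH]) auto
    then show ?thesis unfolding set using Q by simp
  next
    case False
    then obtain r where r: "r \<in> Q (Suc j)" "\<not> p dvd r" by blast
    have "r \<cdot>\<^sub>v y \<in> preimage (N j)" if y: "y \<in> preimage (N (Suc j))" for y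
    proof -
      obtain n t where n: "n \<in> preimage (N j)" "y = n + t \<cdot>\<^sub>v x" using gen[OF y] by blast
      have nc: "n \<in> carrier_vec k" by (rule vec_submoduleD(1)[OF N n(1)])
      have "r \<cdot>\<^sub>v y = r \<cdot>\<^sub>v n + t \<cdot>\<^sub>v (r \<cdot>\<^sub>v x)" unfolding n(2) using nc xc by (intro eq_vecI) (auto simp: algebra_simps)
      moreover have "r \<cdot>\<^sub>v x \<in> preimage (N j)" using ann r(1) by blast
      ultimately show ?thesis using n(1) by (simp add: vec_submoduleD(3,4)[OF N])
    qed
    then have "has_order k p (preimage (N j)) (card {i\<in>{Suc (Suc j)..l}. Q i = ?P})"
      by (intro has_order_step_same[OF p N' mono r(2) _ step.IH])
    moreover have "Q (Suc j) \<noteq> ?P" using False by blast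
    ultimately show ?thesis unfolding set by simp
  qed
qed

text \<open>
  The order of \<open>p\<close> along the column span counts the factors \<open>R/(p)\<close> of every prime filtration of
  the cokernel, and it is the exponent of \<open>p\<close> in the greatest common divisor of the maximal
  minors.
\<close>

lemma multiplicities_agree:
  assumes noeth: "noetherian_subring (UNIV :: 'a set)" and fact: "factorial_subring (UNIV :: 'a set)"
    and p: "prime_elem p" and f: "\<forall>i<k. f i \<in> column_span A" and d: "det_rows k f \<noteq> 0"
    and g: "is_gcd_of (Idl\<^bsub>class_ring\<^esub> (minors k A)) g"
  shows "\<exists>m. has_prime_multiplicity class_ring coker {x. p dvd x} m \<and> has_factor_multiplicity p g m"
proof -
  have ex: "\<exists>l N Q. prime_filtration class_ring coker l N Q"
    by (rule prime_filtration_exists[OF module_cokernel noeth ascending_chains_stop_cokernel[OF noeth]])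
  have ord: "has_order k p (column_span A) (card {i\<in>{1..l}. Q i = {x. p dvd x}})"
    if fil: "prime_filtration class_ring coker l N Q" for l N Q
  proof -
    have "N 0 = {\<zero>\<^bsub>coker\<^esub>}" using fil unfolding prime_filtration_def by blast
    then show ?thesis using has_order_filtration[OF fact p f d fil, of 0] preimage_zero by simp
  qed
  obtain m where m: "has_order k p (column_span A) m" using ex ord by blast
  have "has_prime_multiplicity class_ring coker {x. p dvd x} m"
    unfolding has_prime_multiplicity_def using ex has_order_unique[OF ord m] by blast
  moreover have "has_factor_multiplicity p g m"
  proof (rule has_factor_multiplicityI[OF fact p])
    have "det_rows k f \<noteq> 0 \<Longrightarrow> \<not> 0 dvd det_rows k f" by simp
    then have "\<not> 0 dvd g" unfolding dvd_gcd_minors_iff[OF g] using f d by blast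
    then show "g \<noteq> 0" by simp
    show "p ^ m dvd g" unfolding dvd_gcd_minors_iff[OF g] using has_order_dvd[OF m] by blast
    show "\<not> p ^ Suc m dvd g" unfolding dvd_gcd_minors_iff[OF g] by (rule has_order_witness[OF m]) blast
  qed
  ultimately show ?thesis by blast
qed

text \<open>
  If \<open>(p)\<close> is the annihilator of the class of \<open>x\<close>, Cramer's rule puts every determinant into it.
  Conversely, if \<open>p\<close> divides all determinants, some \<open>x\<close> is not moved into the column span by any
  scalar outside \<open>(p)\<close>, although \<open>p ^ e * s\<close> moves it there for some \<open>s\<close> outside \<open>(p)\<close>; the last
  nonzero stage on the way has annihilator \<open>(p)\<close>.
\<close>

lemma principal_associated_iff_dvd_gcd:
  assumes fact: "factorial_subring (UNIV :: 'a set)"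
    and p: "prime_elem p" and f: "\<forall>i<k. f i \<in> column_span A" and d: "det_rows k f \<noteq> 0"
    and g: "is_gcd_of (Idl\<^bsub>class_ring\<^esub> (minors k A)) g"
  shows "{x. p dvd x} \<in> associated_primes class_ring coker \<longleftrightarrow> p dvd g"
proof
  assume "{x. p dvd x} \<in> associated_primes class_ring coker"
  then obtain x where x: "x \<in> carrier_vec k" "{r. p dvd r} = {r. r \<cdot>\<^sub>v x \<in> column_span A}"
    unfolding associated_primes_cokernel by blast
  show "p dvd g"
    unfolding dvd_gcd_minors_iff[OF g]
  proof (intro allI impI)
    fix h assume h: "\<forall>i<k. h i \<in> column_span A"
    show "p dvd det_rows k h"
    proof (cases "det_rows k h = 0")
      case False
      have "det_rows k h \<cdot>\<^sub>v x \<in> column_span A" by (rule nonzero_det_smult_in_column_span[OF h False x(1)])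
      then show ?thesis using x(2) by blast
    qed simp
  qed
next
  assume pg: "p dvd g"
  note N = vec_submodule_column_span[OF A]
  obtain e s where es: "det_rows k f = p ^ e * s" "\<not> p dvd s" by (rule prime_power_part[OF fact p d])
  \<comment> \<open>Otherwise multiples of the unit vectors by scalars outside \<open>(p)\<close> would give a determinant outside \<open>(p)\<close>.\<close>
  have not_all: "\<exists>x\<in>carrier_vec k. \<forall>t. \<not> p dvd t \<longrightarrow> t \<cdot>\<^sub>v x \<notin> column_span A"
  proof (rule ccontr)
    assume "\<not> ?thesis"
    then have all: "\<exists>t. \<not> p dvd t \<and> t \<cdot>\<^sub>v x \<in> column_span A" if "x \<in> carrier_vec k" for x using that by blast
    have "\<forall>i. \<exists>t. \<not> p dvd t \<and> t \<cdot>\<^sub>v unit_vec k i \<in> column_span A" using all by simp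
    then obtain t where t: "\<forall>i. \<not> p dvd t i \<and> t i \<cdot>\<^sub>v unit_vec k i \<in> column_span A" by (rule choice[THEN exE])
    have "p dvd det_rows k (\<lambda>i. t i \<cdot>\<^sub>v unit_vec k i)"
      by (rule pg[unfolded dvd_gcd_minors_iff[OF g], THEN spec, THEN mp]) (use t in simp)
    also have "det_rows k (\<lambda>i. t i \<cdot>\<^sub>v unit_vec k i) = (\<Prod>i<k. t i) * det_rows k (unit_vec k)"
      by (rule det_rows_smult_all) simp
    also have "mat\<^sub>r k k (unit_vec k) = (1\<^sub>m k :: 'a mat)" by (rule eq_matI) auto
    finally have "p dvd (\<Prod>i<k. t i)" by simp
    moreover have "\<not> p dvd (\<Prod>i<m. t i)" for m
    proof (induction m)
      case 0
      then show ?case using p by (simp add: prime_elem_def)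
    next
      case (Suc m)
      then show ?case using prime_elem_dvd_multD[OF p, of "\<Prod>i<m. t i" "t m"] t by auto
    qed
    ultimately show False by blast
  qed
  then obtain x where x: "x \<in> carrier_vec k" "\<And>t. \<not> p dvd t \<Longrightarrow> t \<cdot>\<^sub>v x \<notin> column_span A" by blast
  let ?Q = "\<lambda>e. \<exists>s. \<not> p dvd s \<and> (p ^ e * s) \<cdot>\<^sub>v x \<in> column_span A"
  have "?Q e" using es nonzero_det_smult_in_column_span[OF f d x(1)] by auto
  \<comment> \<open>With \<open>m\<close> minimal, \<open>p ^ (m - 1)\<close> times a suitable multiple of \<open>x\<close> is killed modulo the column span by \<open>p\<close> but by nothing outside \<open>(p)\<close>.\<close>
  define m where "m = (LEAST e. ?Q e)"
  have Qm: "?Q m" unfolding m_def by (rule LeastI[of ?Q, OF \<open>?Q e\<close>])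
  have least: "\<not> ?Q i" if "i < m" for i using not_less_Least[of i ?Q] that unfolding m_def by blast
  obtain t where t: "\<not> p dvd t" "(p ^ m * t) \<cdot>\<^sub>v x \<in> column_span A" using Qm by blast
  have "m \<noteq> 0" using t x(2)[OF t(1)] by (cases m) auto
  then obtain i where i: "m = Suc i" using not0_implies_Suc by blast
  define y where "y = (p ^ i * t) \<cdot>\<^sub>v x"
  have yc: "y \<in> carrier_vec k" unfolding y_def using x(1) by simp
  have "r \<cdot>\<^sub>v y \<in> column_span A \<longleftrightarrow> p dvd r" for r
  proof
    assume r: "r \<cdot>\<^sub>v y \<in> column_span A"
    show "p dvd r"
    proof (rule ccontr)
      assume "\<not> p dvd r"
      then have "\<not> p dvd t * r" using t(1) prime_elem_dvd_multD[OF p] by blast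
      moreover have "(p ^ i * (t * r)) \<cdot>\<^sub>v x \<in> column_span A"
        using r unfolding y_def smult_smult_assoc by (simp only: ac_simps)
      ultimately show False using least[of i] i by blast
    qed
  next
    assume "p dvd r"
    then obtain q where q: "r = p * q" by blast
    have "q \<cdot>\<^sub>v ((p ^ m * t) \<cdot>\<^sub>v x) \<in> column_span A" by (rule vec_submoduleD(4)[OF N t(2)])
    also have "q \<cdot>\<^sub>v ((p ^ m * t) \<cdot>\<^sub>v x) = r \<cdot>\<^sub>v y"
      unfolding y_def smult_smult_assoc q i power_Suc by (simp only: ac_simps)
    finally show "r \<cdot>\<^sub>v y \<in> column_span A" .
  qed
  then have "{r. p dvd r} = {r. r \<cdot>\<^sub>v y \<in> column_span A}" by blast
  moreover have "primeideal {r. p dvd r} (class_ring :: 'a ring)"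
    unfolding primeideal_class_ring_iff is_ideal_of_def using p by (auto simp: prime_elem_def)
  ultimately show "{x. p dvd x} \<in> associated_primes class_ring coker"
    unfolding associated_primes_cokernel using yc by blast
qed

end

lemma genideal_singleton: "Idl\<^bsub>class_ring\<^esub> {a :: 'a::comm_ring_1} = {x. a dvd x}"
proof -
  have "Idl\<^bsub>class_ring\<^esub> {a} = PIdl\<^bsub>class_ring\<^esub> a" using cring.cgenideal_eq_genideal[OF class_cring.is_cring, of a] by simp
  also have "\<dots> = {x. a dvd x}" unfolding cgenideal_def by (auto simp: dvd_def mult.commute)
  finally show ?thesis .
qed

text \<open>
  Laurent polynomials enter only as a Noetherian factorial domain.
\<close>

theorem principal_associated_primes_of_cokernel:
  fixes A :: "'a::idom mat"
  assumes noeth: "noetherian_subring (UNIV :: 'a set)" and fact: "factorial_subring (UNIV :: 'a set)"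
    and A: "A \<in> carrier_mat k n" and rank: "fraction_rank A = k"
    and g: "is_gcd_of (Idl\<^bsub>class_ring\<^esub> (minors k A)) g"
  shows "{P \<in> associated_primes class_ring (cokernel_module A). principalideal P class_ring}
           = {Idl\<^bsub>class_ring\<^esub> {\<pi>} | \<pi>. Factorial_Ring.irreducible \<pi> \<and> \<pi> dvd g}"
    and "Idl\<^bsub>class_ring\<^esub> {\<pi>} \<in> associated_primes class_ring (cokernel_module A) \<Longrightarrow>
            \<exists>m. has_prime_multiplicity class_ring (cokernel_module A) (Idl\<^bsub>class_ring\<^esub> {\<pi>}) m
               \<and> has_factor_multiplicity \<pi> g m"
proof -
  obtain a where "a \<in> minors k A" "a \<noteq> 0" using full_rank_imp_nonzero_minor[OF A rank] by blast
  then have "\<not> (\<forall>a\<in>minors k A. 0 dvd a)" by auto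
  then obtain f where f: "\<forall>i<k. f i \<in> column_span A" and d: "det_rows k f \<noteq> 0"
    unfolding dvd_minors_iff_dvd_det_rows[OF A] by auto
  have prime: "prime_elem p" if p: "{x. p dvd x} \<in> associated_primes class_ring (cokernel_module A)" for p
  proof -
    obtain x where x: "x \<in> carrier_vec k" "{r. p dvd r} = {r. r \<cdot>\<^sub>v x \<in> column_span A}"
      and pi: "primeideal {x. p dvd x} (class_ring :: 'a ring)"
      using p unfolding associated_primes_cokernel[OF A] by blast
    have "p dvd det_rows k f" using x(2) nonzero_det_smult_in_column_span[OF A f d x(1)] by blast
    then have "p \<noteq> 0" using d by auto
    then show ?thesis using pi unfolding primeideal_class_ring_iff prime_elem_def by blast
  qed
  note iff = principal_associated_iff_dvd_gcd[OF A fact _ f d g]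
  show "{P \<in> associated_primes class_ring (cokernel_module A). principalideal P class_ring}
           = {Idl\<^bsub>class_ring\<^esub> {\<pi>} | \<pi>. Factorial_Ring.irreducible \<pi> \<and> \<pi> dvd g}"
  proof (intro equalityI subsetI)
    fix P assume "P \<in> {P \<in> associated_primes class_ring (cokernel_module A). principalideal P class_ring}"
    then have P: "P \<in> associated_primes class_ring (cokernel_module A)" and "principalideal P class_ring" by auto
    then obtain p where Pp: "P = {x. p dvd x}" using principalideal.generate[of P class_ring] genideal_singleton by auto
    have p: "prime_elem p" by (rule prime) (use P Pp in simp)
    have "p dvd g" using iff[OF p] P Pp by simp
    then show "P \<in> {Idl\<^bsub>class_ring\<^esub> {\<pi>} | \<pi>. Factorial_Ring.irreducible \<pi> \<and> \<pi> dvd g}"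
      unfolding genideal_singleton using Pp prime_elem_imp_irreducible[OF p] by blast
  next
    fix P assume "P \<in> {Idl\<^bsub>class_ring\<^esub> {\<pi>} | \<pi>. Factorial_Ring.irreducible \<pi> \<and> \<pi> dvd g}"
    then obtain p where p: "P = Idl\<^bsub>class_ring\<^esub> {p}" "Factorial_Ring.irreducible p" "p dvd g" by blast
    have "prime_elem p" by (rule factorial_irreducible_imp_prime[OF fact p(2)])
    then have "P \<in> associated_primes class_ring (cokernel_module A)" unfolding p(1) genideal_singleton using iff p(3) by blast
    moreover have "ideal P (class_ring :: 'a ring)" unfolding p(1) genideal_singleton ideal_class_ring_iff is_ideal_of_def by auto
    then have "principalideal P class_ring" using p(1) by (intro principalidealI) auto
    ultimately show "P \<in> {P \<in> associated_primes class_ring (cokernel_module A). principalideal P class_ring}" by blast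
  qed
  show "\<exists>m. has_prime_multiplicity class_ring (cokernel_module A) (Idl\<^bsub>class_ring\<^esub> {\<pi>}) m \<and> has_factor_multiplicity \<pi> g m"
    if "Idl\<^bsub>class_ring\<^esub> {\<pi>} \<in> associated_primes class_ring (cokernel_module A)"
    using multiplicities_agree[OF A noeth fact prime f d g] that unfolding genideal_singleton by blast
qed

theorem lemma4p2:
  fixes A :: "'d::{finite, linorder} laurent mat"
    and k n :: nat
    and J :: "'d laurent set"
    and g :: "'d laurent"
  assumes "A \<in> carrier_mat k n"
    and "fraction_rank A = k"
    and "J = Idl\<^bsub>class_ring\<^esub> (minors k A)"
    and "is_gcd_of J g"
  shows "{P \<in> associated_primes class_ring (cokernel_module A). principalideal P class_ring}
           = {Idl\<^bsub>class_ring\<^esub> {\<pi>} | \<pi>. Factorial_Ring.irreducible \<pi> \<and> \<pi> dvd g}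
       \<and> (\<forall>\<pi>. Idl\<^bsub>class_ring\<^esub> {\<pi>} \<in> associated_primes class_ring (cokernel_module A) \<longrightarrow>
            (\<exists>m. has_prime_multiplicity class_ring (cokernel_module A) (Idl\<^bsub>class_ring\<^esub> {\<pi>}) m
               \<and> has_factor_multiplicity \<pi> g m))"
proof -
  note * = principal_associated_primes_of_cokernel[OF noetherian_laurent factorial_laurent assms(1,2)
      assms(4)[unfolded assms(3)]]
  show ?thesis by (intro conjI allI impI) (rule *(1), rule *(2))
qed

end
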